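(* If $\mathsf{P}\neq\mathsf{NP}$, then there is no algorithm which, given an $(n,2)$-PPCFG $\Gamma$ and a finite set $W$ of strings (a positive presentation), runs in time polynomial in the size of $\Gamma$ and the total length of $W$ and outputs a parameter setting $p$ with $W\subseteq L(\Gamma_p)$ whenever such a $p$ exists, and otherwise reports that no such $p$ exists. In this sense, if $\mathsf{P}\neq\mathsf{NP}$ no efficient algorithm learns the PPCFGs from positive presentations.
   Context: An $(n,k)$-principled parametric context-free grammar ($(n,k)$-PPCFG) is a 4-tuple $\Gamma=(V,\Sigma,\Pi,S)$ where $V$ is a finite set of nonterminals, $\Sigma$ a finite set of terminals, $S\in V$ the start symbol, and $\Pi$ a list of $n$ production groups, the $i$-th being a $k$-tuple of context-free productions $\Pi_{i,1},\dots,\Pi_{i,k}$. A parameter setting is $p=(p_1,\dots,p_n)\in\{1,\dots,k\}^n$, and $\Gamma_p$ is the context-free grammar $(V,\Sigma,\{\Pi_{i,p_i}:1\le i\le n\},S)$ with language $L(\Gamma_p)$. *)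

theory Defs
  imports Main
begin

text \<open>Grammar symbols: nonterminals and terminals, both named by natural numbers
  (the tags keep V and Sigma disjoint). A production is (A, rhs).\<close>

datatype sym = NT nat | T nat

type_synonym prod = "nat \<times> sym list"

inductive gen :: "prod set \<Rightarrow> sym list \<Rightarrow> nat list \<Rightarrow> bool"
  and derives :: "prod set \<Rightarrow> nat \<Rightarrow> nat list \<Rightarrow> bool"
  for P :: "prod set" where
  gen_Nil: "gen P [] []"
| gen_T: "gen P rest w \<Longrightarrow> gen P (T a # rest) (a # w)"
| gen_NT: "derives P A u \<Longrightarrow> gen P rest w \<Longrightarrow> gen P (NT A # rest) (u @ w)"
| derives_prod: "(A, rhs) \<in> P \<Longrightarrow> gen P rhs w \<Longrightarrow> derives P A w"

definition cfg_lang :: "prod set \<Rightarrow> nat \<Rightarrow> nat list set" where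
  "cfg_lang P S = {w. derives P S w}"

text \<open>A PPCFG  Gamma = (V, Sigma, Pi, S): V and Sigma finite (given as lists),
  Pi is the list of the n production groups, each a list (k-tuple) of productions.\<close>

type_synonym ppcfg = "nat list \<times> nat list \<times> prod list list \<times> nat"

fun ppcfg_V :: "ppcfg \<Rightarrow> nat list" where "ppcfg_V (V, Sig, Pi, S) = V"
fun ppcfg_Sigma :: "ppcfg \<Rightarrow> nat list" where "ppcfg_Sigma (V, Sig, Pi, S) = Sig"
fun ppcfg_Pi :: "ppcfg \<Rightarrow> prod list list" where "ppcfg_Pi (V, Sig, Pi, S) = Pi"
fun ppcfg_S :: "ppcfg \<Rightarrow> nat" where "ppcfg_S (V, Sig, Pi, S) = S"

definition wf_prod :: "nat list \<Rightarrow> nat list \<Rightarrow> prod \<Rightarrow> bool" where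
  "wf_prod V Sig pr \<longleftrightarrow> fst pr \<in> set V \<and>
     (\<forall>s \<in> set (snd pr). case s of NT B \<Rightarrow> B \<in> set V | T a \<Rightarrow> a \<in> set Sig)"

definition is_ppcfg :: "nat \<Rightarrow> nat \<Rightarrow> ppcfg \<Rightarrow> bool" where
  "is_ppcfg n k G \<longleftrightarrow> length (ppcfg_Pi G) = n \<and> ppcfg_S G \<in> set (ppcfg_V G) \<and>
     (\<forall>g \<in> set (ppcfg_Pi G). length g = k \<and> (\<forall>pr \<in> set g. wf_prod (ppcfg_V G) (ppcfg_Sigma G) pr))"

text \<open>Parameter settings p = (p_1..p_n) in {1..k}^n (stored 0-indexed in a list,
  values 1-based as in the paper), and the CFG Gamma_p.\<close>
definition param_setting :: "nat \<Rightarrow> nat \<Rightarrow> nat list \<Rightarrow> bool" where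
  "param_setting n k p \<longleftrightarrow> length p = n \<and> (\<forall>i < n. 1 \<le> p ! i \<and> p ! i \<le> k)"

definition ppcfg_prods :: "ppcfg \<Rightarrow> nat list \<Rightarrow> prod set" where
  "ppcfg_prods G p = {ppcfg_Pi G ! i ! (p ! i - 1) | i. i < length (ppcfg_Pi G)}"

definition ppcfg_lang :: "ppcfg \<Rightarrow> nat list \<Rightarrow> nat list set" where
  "ppcfg_lang G p = cfg_lang (ppcfg_prods G p) (ppcfg_S G)"

definition consistent_setting :: "ppcfg \<Rightarrow> nat list list \<Rightarrow> nat list \<Rightarrow> bool" where
  "consistent_setting G W p \<longleftrightarrow> param_setting (length (ppcfg_Pi G)) 2 p \<and>
     set W \<subseteq> ppcfg_lang G p"

definition valid_instance :: "ppcfg \<Rightarrow> nat list list \<Rightarrow> bool" where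
  "valid_instance G W \<longleftrightarrow> is_ppcfg (length (ppcfg_Pi G)) 2 G \<and>
     (\<forall>w \<in> set W. set w \<subseteq> set (ppcfg_Sigma G))"

datatype tok = B0 | B1 | LB | RB

fun bin :: "nat \<Rightarrow> tok list" where
  "bin n = (if n = 0 then [] else (if n mod 2 = 1 then B1 else B0) # bin (n div 2))"

definition en_nat :: "nat \<Rightarrow> tok list" where
  "en_nat n = [LB] @ bin n @ [RB]"

definition en_list :: "('a \<Rightarrow> tok list) \<Rightarrow> 'a list \<Rightarrow> tok list" where
  "en_list f xs = [LB] @ concat (map f xs) @ [RB]"

fun en_sym :: "sym \<Rightarrow> tok list" where
  "en_sym (NT A) = [LB, B0] @ en_nat A @ [RB]"
| "en_sym (T a) = [LB, B1] @ en_nat a @ [RB]"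

fun en_prod :: "prod \<Rightarrow> tok list" where
  "en_prod (A, rhs) = [LB] @ en_nat A @ en_list en_sym rhs @ [RB]"

fun en_ppcfg :: "ppcfg \<Rightarrow> tok list" where
  "en_ppcfg (V, Sig, Pi, S) =
     [LB] @ en_list en_nat V @ en_list en_nat Sig @ en_list (en_list en_prod) Pi @ en_nat S @ [RB]"

definition en_instance :: "ppcfg \<Rightarrow> nat list list \<Rightarrow> tok list" where
  "en_instance G W = [LB] @ en_ppcfg G @ en_list (en_list en_nat) W @ [RB]"

fun tok_bits :: "tok \<Rightarrow> bool list" where
  "tok_bits B0 = [False, False]"
| "tok_bits B1 = [False, True]"
| "tok_bits LB = [True, False]"
| "tok_bits RB = [True, True]"

definition to_bits :: "tok list \<Rightarrow> bool list" where
  "to_bits ts = concat (map tok_bits ts)"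

fun en_answer :: "nat list option \<Rightarrow> bool list" where
  "en_answer None = [False]"
| "en_answer (Some p) = True # map (\<lambda>j. j = 2) p"

text \<open>A TM is (Q, G, delta): states {0..<Q} (0 start, 1 accept, 2 reject; 1 and 2 halting),
  tape symbols {0..<G} (0 blank, 1 encodes bit False, 2 encodes bit True),
  delta q a = (q', a', d) with head move d in {-1,0,1}.\<close>

type_synonym tm = "nat \<times> nat \<times> (nat \<Rightarrow> nat \<Rightarrow> nat \<times> nat \<times> int)"
type_synonym config = "nat \<times> (int \<Rightarrow> nat) \<times> int"

definition wf_tm :: "tm \<Rightarrow> bool" where
  "wf_tm M = (case M of (Q, G, \<delta>) \<Rightarrow> 3 \<le> Q \<and> 3 \<le> G \<and>
     (\<forall>q < Q. \<forall>a < G. case \<delta> q a of (q', a', d) \<Rightarrow> q' < Q \<and> a' < G \<and> d \<in> {-1, 0, 1}))"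

definition bit_code :: "bool \<Rightarrow> nat" where
  "bit_code b = (if b then 2 else 1)"

definition tm_step :: "tm \<Rightarrow> config \<Rightarrow> config" where
  "tm_step M c = (case M of (Q, G, \<delta>) \<Rightarrow> case c of (q, tp, h) \<Rightarrow>
     if q = 1 \<or> q = 2 then c
     else (case \<delta> q (tp h) of (q', a', d) \<Rightarrow> (q', tp(h := a'), h + d)))"

definition tm_init :: "bool list \<Rightarrow> config" where
  "tm_init x = (0, \<lambda>i. if 0 \<le> i \<and> nat i < length x then bit_code (x ! nat i) else 0, 0)"

definition tm_run :: "tm \<Rightarrow> bool list \<Rightarrow> nat \<Rightarrow> config" where
  "tm_run M x t = (tm_step M ^^ t) (tm_init x)"

definition halted :: "config \<Rightarrow> bool" where
  "halted c \<longleftrightarrow> fst c = 1 \<or> fst c = 2"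

definition tm_output :: "config \<Rightarrow> nat list" where
  "tm_output c = (case c of (q, tp, h) \<Rightarrow> map (\<lambda>i. tp (int i)) [0..<(LEAST k. tp (int k) = 0)])"

definition in_P :: "bool list set \<Rightarrow> bool" where
  "in_P L \<longleftrightarrow> (\<exists>M c k. wf_tm M \<and> (\<forall>x. \<exists>t \<le> c * (length x + 1) ^ k.
      halted (tm_run M x t) \<and> (fst (tm_run M x t) = 1 \<longleftrightarrow> x \<in> L)))"

definition pair_enc :: "bool list \<Rightarrow> bool list \<Rightarrow> bool list" where
  "pair_enc x y = concat (map (\<lambda>b. [True, b]) x) @ [False, False] @ y"

definition in_NP :: "bool list set \<Rightarrow> bool" where
  "in_NP L \<longleftrightarrow> (\<exists>V c k. in_P V \<and> (\<forall>x. x \<in> L \<longleftrightarrow>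
      (\<exists>y. length y \<le> c * (length x + 1) ^ k \<and> pair_enc x y \<in> V)))"

definition P_neq_NP :: bool where
  "P_neq_NP \<longleftrightarrow> (\<exists>L. in_NP L \<and> \<not> in_P L)"

definition poly_time_ppcfg_learner :: "tm \<Rightarrow> bool" where
  "poly_time_ppcfg_learner M \<longleftrightarrow> wf_tm M \<and> (\<exists>c k. \<forall>G W. valid_instance G W \<longrightarrow>
     (let x = to_bits (en_instance G W) in
      \<exists>t \<le> c * (length x + 1) ^ k. halted (tm_run M x t) \<and>
        (if (\<exists>p. consistent_setting G W p)
         then (\<exists>p. consistent_setting G W p \<and>
                   tm_output (tm_run M x t) = map bit_code (en_answer (Some p)))
         else tm_output (tm_run M x t) = map bit_code (en_answer None))))"

end

theory Submission
  imports Defs "HOL-Library.Countable"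
begin

text \<open>A polynomial-time learner puts every NP language in P, already on inputs with W consisting of the
  empty word only. A grammar whose right-hand sides contain nonterminals only derives the empty word iff
  its start symbol is a consequence of the productions read as Horn clauses, and Horn clauses can follow a
  run of a deterministic machine: the nonterminal with index j and cell code c says that cell j of the
  space-time diagram, laid out as one helix, contains c. The binary choices of the production groups guess
  the certificate. All machine constructions go through queue automata, which delete the front symbol and
  append a word at the back: one sweep over the queue is a finite-state transduction, and transductions
  suffice to write down the grammar, to sort, and to simulate the learner step by step. A single-tape
  machine simulates a queue automaton with quadratic overhead.\<close>

section \<open>Queue automata on a single tape\<close>

text \<open>Horn clauses cannot express that a cell does not contain something. Correctness rests on
  determinism instead: once a certificate is read off the setting, the true cell contents form a set
  of names closed under all chosen clauses, so nothing false is derivable. As certificates of every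
  length up to a bound are allowed, each position also chooses whether the certificate goes on. The
  helix has a computational reason: the three predecessors of a cell lie at distances that do not
  depend on its column, so all rule blocks are shifted copies of one text and row ends need no
  special treatment. Names hold their index as a run of digits, so that a shift is an insertion
  without carries; the text stays polynomial because there are only polynomially many indices. All
  block counts have the form constant times a power of n + 1, n the input length, since repeated
  multiplication by n + 1 can be done by marking counters. The learner's answer is read off its
  first output symbol, which tells whether a setting exists.\<close>

definition poly_bounded :: "(nat \<Rightarrow> nat) \<Rightarrow> bool" where
  "poly_bounded f \<longleftrightarrow> (\<exists>c k. \<forall>n. f n \<le> c * (n + 1) ^ k)"

lemma poly_bounded_const: "poly_bounded (\<lambda>n. c)"
  unfolding poly_bounded_def by (rule exI[of _ c], rule exI[of _ 0]) simp

lemma poly_bounded_id: "poly_bounded (\<lambda>n. n)"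
  unfolding poly_bounded_def by (rule exI[of _ 1], rule exI[of _ 1]) simp

lemma poly_bounded_add:
  assumes "poly_bounded f" "poly_bounded g"
  shows "poly_bounded (\<lambda>n. f n + g n)"
proof -
  obtain c k d l where f: "\<And>n. f n \<le> c * (n + 1) ^ k" and g: "\<And>n. g n \<le> d * (n + 1) ^ l"
    using assms unfolding poly_bounded_def by metis
  have "f n + g n \<le> (c + d) * (n + 1) ^ (k + l)" for n
  proof -
    have "c * (n + 1) ^ k \<le> c * (n + 1) ^ (k + l)" "d * (n + 1) ^ l \<le> d * (n + 1) ^ (k + l)"
      by (intro mult_le_mono2 power_increasing; simp)+
    then show ?thesis using f[of n] g[of n] by (simp only: add_mult_distrib)
  qed
  then show ?thesis unfolding poly_bounded_def by blast
qed

lemma poly_bounded_mult: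
  assumes "poly_bounded f" "poly_bounded g"
  shows "poly_bounded (\<lambda>n. f n * g n)"
proof -
  obtain c k d l where f: "\<And>n. f n \<le> c * (n + 1) ^ k" and g: "\<And>n. g n \<le> d * (n + 1) ^ l"
    using assms unfolding poly_bounded_def by metis
  have "f n * g n \<le> (c * d) * (n + 1) ^ (k + l)" for n
    using mult_le_mono[OF f[of n] g[of n]] by (simp only: power_add mult_ac)
  then show ?thesis unfolding poly_bounded_def by blast
qed

lemma poly_bounded_power: "poly_bounded f \<Longrightarrow> poly_bounded (\<lambda>n. f n ^ k)"
  by (induction k) (auto intro: poly_bounded_const poly_bounded_mult)

lemmas poly_bounded_intros =
  poly_bounded_const poly_bounded_id poly_bounded_add poly_bounded_mult poly_bounded_power

section \<open>Machines over arbitrary finite types, renumbered to the concrete model\<close>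

lemma funpow_trans: "(f ^^ a) x = y \<Longrightarrow> (f ^^ b) y = z \<Longrightarrow> (f ^^ (b + a)) x = z"
  by (simp add: funpow_add)

fun gen_step :: "('q \<Rightarrow> 'b \<Rightarrow> 'q \<times> 'b \<times> int) \<Rightarrow> 'q set \<Rightarrow> 'q \<times> (int \<Rightarrow> 'b) \<times> int \<Rightarrow> 'q \<times> (int \<Rightarrow> 'b) \<times> int" where
  "gen_step d F (q, tp, h) = (if q \<in> F then (q, tp, h)
     else (case d q (tp h) of (q', b, e) \<Rightarrow> (q', tp(h := b), h + e)))"

text \<open>The machine model prescribes numbers for just three states (start, accept, reject) and
  three symbols (blank and the two bits); the rest may be numbered arbitrarily from 3 on.\<close>

lemma ex_numbering:
  assumes "finite A" "a \<noteq> b" "a \<noteq> c" "b \<noteq> c"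
  shows "\<exists>f (n::nat). inj_on f A \<and> f a = 0 \<and> f b = 1 \<and> f c = 2 \<and> (\<forall>x\<in>A. f x < n) \<and> 3 \<le> n"
proof -
  have "finite (A - {a, b, c})" using assms by simp
  from ex_bij_betw_finite_nat[OF this]
  obtain h where h: "bij_betw h (A - {a, b, c}) {0..<card (A - {a, b, c})}" ..
  define f where "f x = (if x = a then 0 else if x = b then 1 else if x = c then 2 else 3 + h x)" for x
  have "inj_on f A"
  proof (rule inj_onI)
    fix x y assume xy: "x \<in> A" "y \<in> A" "f x = f y"
    show "x = y"
    proof (cases "x \<in> {a, b, c} \<or> y \<in> {a, b, c}")
      case True
      then show ?thesis using xy(3) by (auto simp: f_def split: if_splits)
    next
      case False
      then have "h x = h y" "x \<in> A - {a, b, c}" "y \<in> A - {a, b, c}" using xy by (auto simp: f_def)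
      then show ?thesis using inj_onD[OF bij_betw_imp_inj_on[OF h]] by blast
    qed
  qed
  moreover have "\<forall>x\<in>A. f x < 3 + card (A - {a, b, c})"
    using bij_betw_apply[OF h] by (auto simp: f_def)
  moreover have "f a = 0" "f b = 1" "f c = 2" using assms by (auto simp: f_def)
  ultimately show ?thesis by (intro exI[of _ f] exI[of _ "3 + card (A - {a, b, c})"]) auto
qed

text \<open>Renaming along injective numberings commutes with every step as long as states and
  symbols stay in \<open>Qs\<close> and \<open>Bs\<close>, which the closure hypothesis
  guarantees.\<close>

lemma ex_tm_of_gen_step:
  fixes d :: "'q \<Rightarrow> 'b \<Rightarrow> 'q \<times> 'b \<times> int"
  assumes fin: "finite Qs" "finite Bs"
    and q: "qi \<in> Qs" "qa \<in> Qs" "qr \<in> Qs" "qi \<noteq> qa" "qi \<noteq> qr" "qa \<noteq> qr"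
    and b: "bl \<in> Bs" "bt False \<in> Bs" "bt True \<in> Bs" "bl \<noteq> bt False" "bl \<noteq> bt True"
      "bt False \<noteq> bt True"
    and cl: "\<And>q a. q \<in> Qs \<Longrightarrow> a \<in> Bs \<Longrightarrow>
        fst (d q a) \<in> Qs \<and> fst (snd (d q a)) \<in> Bs \<and> snd (snd (d q a)) \<in> {-1, 0, 1}"
  shows "\<exists>M. wf_tm M \<and> (\<forall>x t. let s = fst ((gen_step d {qa, qr} ^^ t)
            (qi, \<lambda>i. if 0 \<le> i \<and> nat i < length x then bt (x ! nat i) else bl, 0)) in
          (halted (tm_run M x t) \<longleftrightarrow> s \<in> {qa, qr}) \<and> (fst (tm_run M x t) = 1 \<longleftrightarrow> s = qa))"
proof -
  obtain f Q where f: "inj_on f Qs" "f qi = 0" "f qa = 1" "f qr = 2" "\<And>x. x \<in> Qs \<Longrightarrow> f x < Q" "(3::nat) \<le> Q"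
    using ex_numbering[OF fin(1) q(4,5,6)] by blast
  obtain g G where g: "inj_on g Bs" "g bl = 0" "g (bt False) = 1" "g (bt True) = 2"
      "\<And>x. x \<in> Bs \<Longrightarrow> g x < G" "(3::nat) \<le> G"
    using ex_numbering[OF fin(2) b(4,5,6)] by blast
  \<comment> \<open>\<open>wf_tm\<close> speaks of all numbers below the bounds, including those
    that name nothing; there the default \<open>(0, 0, 0)\<close> keeps the table
    well-formed.\<close>
  define dl where "dl q a = (if q \<in> f ` Qs \<and> a \<in> g ` Bs
     then (case d (inv_into Qs f q) (inv_into Bs g a) of (q', a', e) \<Rightarrow> (f q', g a', e)) else (0, 0, 0))"
    for q a
  let ?M = "(Q, G, dl)"
  have dlc: "dl (f q) (g a) = (f (fst (d q a)), g (fst (snd (d q a))), snd (snd (d q a)))"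
    if "q \<in> Qs" "a \<in> Bs" for q a
    using that f(1) g(1) by (simp add: dl_def split: prod.split)
  have dl_wf: "case dl q a of (q', a', d) \<Rightarrow> q' < Q \<and> a' < G \<and> d \<in> {-1, 0, 1}" for q a
  proof (cases "q \<in> f ` Qs \<and> a \<in> g ` Bs")
    case True
    then obtain q1 a1 where "q = f q1" "a = g a1" "q1 \<in> Qs" "a1 \<in> Bs" by auto
    then show ?thesis using dlc[of q1 a1] cl[of q1 a1] f(5) g(5) by auto
  next
    case False
    then have "dl q a = (0, 0, 0)" by (auto simp: dl_def)
    then show ?thesis using f(6) g(6) by simp
  qed
  have wf: "wf_tm ?M"
    unfolding wf_tm_def prod.case by (intro conjI allI impI f(6) g(6) dl_wf)
  define enc where "enc = (\<lambda>(q, tp, h::int). (f q, \<lambda>i::int. g (tp i), h))"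
  define ok where "ok = (\<lambda>(q, tp, h::int). q \<in> Qs \<and> (\<forall>i::int. tp i \<in> Bs))"
  have st: "ok (gen_step d {qa, qr} c) \<and> tm_step ?M (enc c) = enc (gen_step d {qa, qr} c)" if okc: "ok c" for c
  proof -
    obtain q tp h where c: "c = (q, tp, h)" by (cases c) auto
    have qq: "q \<in> Qs" "\<And>i. tp i \<in> Bs" using okc c by (auto simp: ok_def)
    have h12: "f q = 1 \<longleftrightarrow> q = qa" "f q = 2 \<longleftrightarrow> q = qr"
      using f(1,3,4) qq(1) q(2,3) by (metis inj_onD)+
    show ?thesis
    proof (cases "q = qa \<or> q = qr")
      case True
      then show ?thesis using c okc h12 by (auto simp: tm_step_def enc_def)
    next
      case False
      obtain q' a' e where d: "d q (tp h) = (q', a', e)" by (cases "d q (tp h)") auto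
      have "tm_step ?M (enc c) = enc (gen_step d {qa, qr} c)"
        using False c h12 dlc[OF qq(1) qq(2)[of h]] d by (auto simp: tm_step_def enc_def)
      moreover have "ok (gen_step d {qa, qr} c)"
        using False c d cl[OF qq(1) qq(2)[of h]] qq by (auto simp: ok_def)
      ultimately show ?thesis by simp
    qed
  qed
  let ?i = "\<lambda>x. (qi, \<lambda>i. if 0 \<le> i \<and> nat i < length x then bt (x ! nat i) else bl, 0::int)"
  have bitB: "bt z \<in> Bs" for z using b by (cases z) auto
  have run: "ok ((gen_step d {qa, qr} ^^ t) (?i x)) \<and> tm_run ?M x t = enc ((gen_step d {qa, qr} ^^ t) (?i x))" for x t
  proof (induction t)
    case 0
    have "g (bt z) = bit_code z" for z using g by (cases z) (auto simp: bit_code_def)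
    then show ?case using q b bitB f g by (auto simp: tm_run_def tm_init_def ok_def enc_def)
  next
    case (Suc t)
    then show ?case using st by (auto simp: tm_run_def)
  qed
  have fin_iff: "halted (enc c) \<longleftrightarrow> fst c \<in> {qa, qr}" "fst (enc c) = 1 \<longleftrightarrow> fst c = qa" if "ok c" for c
  proof -
    have "fst c \<in> Qs" using that by (auto simp: ok_def)
    then have h12: "f (fst c) = 1 \<longleftrightarrow> fst c = qa" "f (fst c) = 2 \<longleftrightarrow> fst c = qr"
      using f(1,3,4) q(2,3) by (metis inj_onD)+
    have e: "fst (enc c) = f (fst c)" by (simp add: enc_def split_beta)
    show "halted (enc c) \<longleftrightarrow> fst c \<in> {qa, qr}" unfolding halted_def e h12 by blast
    show "fst (enc c) = 1 \<longleftrightarrow> fst c = qa" unfolding e by (rule h12)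
  qed
  show ?thesis
  proof (intro exI conjI allI)
    show "wf_tm ?M" by (rule wf)
    show "let s = fst ((gen_step d {qa, qr} ^^ t) (?i x)) in
      (halted (tm_run ?M x t) \<longleftrightarrow> s \<in> {qa, qr}) \<and> (fst (tm_run ?M x t) = 1 \<longleftrightarrow> s = qa)" for x t
      unfolding Let_def using fin_iff[of "(gen_step d {qa, qr} ^^ t) (?i x)"] run[of t x] by presburger
  qed
qed

section \<open>A queue as a tape segment drifting to the right\<close>

fun qstep :: "('s \<Rightarrow> 'a \<Rightarrow> 's \<times> 'a list) \<Rightarrow> 's \<times> 'a list \<Rightarrow> 's \<times> 'a list" where
  "qstep nx (q, []) = (q, [])"
| "qstep nx (q, a # w) = (fst (nx q a), w @ snd (nx q a))"

text \<open>\<open>Ini\<close> walks to the end of the input, \<open>Pop\<close> stands on the front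
  symbol, \<open>Rgt\<close> carries the word still to be appended, \<open>Lft\<close> returns to
  the front.\<close>

datatype ('s, 'a) qtm = Ini | Pop 's | Rgt 's "'a list" | Lft 's

text \<open>The front sits at \<open>z\<close>, which moves right by one with every deletion, so the
  queue is never shifted back.\<close>

definition lay :: "int \<Rightarrow> 'a list \<Rightarrow> int \<Rightarrow> 'a option" where
  "lay z w i = (if z \<le> i \<and> nat (i - z) < length w then Some (w ! nat (i - z)) else None)"

lemma lay_pop: "(lay z (a # w))(z := None) = lay (z + 1) w"
proof
  fix i show "((lay z (a # w))(z := None)) i = lay (z + 1) w i"
  proof (cases "z + 1 \<le> i")
    case True
    then have "nat (i - z) = Suc (nat (i - (z + 1)))" by simp
    then show ?thesis using True by (simp add: lay_def)
  next
    case False then show ?thesis by (auto simp: lay_def)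
  qed
qed

lemma lay_push: "(lay z w)(z + int (length w) := Some y) = lay z (w @ [y])"
  by (rule ext) (auto simp: lay_def nth_append)

lemma lay_end: "lay z w (z + int (length w)) = None" by (simp add: lay_def)
lemma lay_before: "lay z w (z - 1) = None" by (simp add: lay_def)
lemma lay_in: "i < length w \<Longrightarrow> lay z w (z + int i) = Some (w ! i)" by (simp add: lay_def)

locale queue_automaton =
  fixes nx :: "'s \<Rightarrow> 'a \<Rightarrow> 's \<times> 'a list" and St :: "'s set" and Sy :: "'a set"
    and q0 acc rej :: 's and bt :: "bool \<Rightarrow> 'a" and hash :: 'a
  assumes fin: "finite St" "finite Sy"
    and states: "q0 \<in> St" "acc \<in> St" "rej \<in> St" "acc \<noteq> rej"
    and syms: "\<And>b. bt b \<in> Sy" "bt True \<noteq> bt False" "hash \<in> Sy"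
    and closed: "\<And>q a. q \<in> St \<Longrightarrow> a \<in> Sy \<Longrightarrow> fst (nx q a) \<in> St \<and> set (snd (nx q a)) \<subseteq> Sy"
    and final: "\<And>a. fst (nx acc a) = acc" "\<And>a. fst (nx rej a) = rej"
begin

text \<open>The blank \<open>None\<close> delimits the queue on both sides. A deleted front symbol
  becomes blank, so the walk back to the left stops exactly before the new front.\<close>

fun dl :: "('s, 'a) qtm \<Rightarrow> 'a option \<Rightarrow> ('s, 'a) qtm \<times> 'a option \<times> int" where
  "dl Ini None = (Lft q0, Some hash, -1)"
| "dl Ini (Some a) = (Ini, Some a, 1)"
| "dl (Lft q) (Some a) = (Lft q, Some a, -1)"
| "dl (Lft q) None = (Pop q, None, 1)"
| "dl (Pop q) (Some a) = (Rgt (fst (nx q a)) (snd (nx q a)), None, 1)"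
| "dl (Pop q) None = (Pop q, None, 0)"
| "dl (Rgt q ys) (Some a) = (Rgt q ys, Some a, 1)"
| "dl (Rgt q []) None = (Lft q, None, -1)"
| "dl (Rgt q (y # ys)) None = (Rgt q ys, Some y, 1)"

abbreviation "stp \<equiv> gen_step dl {Pop acc, Pop rej}"

lemma run_ini:
  "i \<le> length w \<Longrightarrow> (stp ^^ (length w - i)) (Ini, lay z w, z + int i) = (Ini, lay z w, z + int (length w))"
proof (induction "length w - i" arbitrary: i)
  case (Suc m)
  then have i: "i < length w" by simp
  have "(stp ^^ (length w - Suc i)) (Ini, lay z w, z + int (Suc i)) = (Ini, lay z w, z + int (length w))"
    using Suc i by (intro Suc(1)) auto
  moreover have "stp (Ini, lay z w, z + int i) = (Ini, lay z w, z + int (Suc i))"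
    using lay_in[OF i] by (auto simp: fun_upd_idem)
  moreover have "length w - i = Suc (length w - Suc i)" using i by simp
  ultimately show ?case by (simp only: funpow_Suc_right o_def)
qed auto

lemma run_right:
  "i \<le> length w \<Longrightarrow> (stp ^^ (length w - i)) (Rgt q ys, lay z w, z + int i) = (Rgt q ys, lay z w, z + int (length w))"
proof (induction "length w - i" arbitrary: i)
  case (Suc m)
  then have i: "i < length w" by simp
  have "(stp ^^ (length w - Suc i)) (Rgt q ys, lay z w, z + int (Suc i)) = (Rgt q ys, lay z w, z + int (length w))"
    using Suc i by (intro Suc(1)) auto
  moreover have "stp (Rgt q ys, lay z w, z + int i) = (Rgt q ys, lay z w, z + int (Suc i))"
    using lay_in[OF i] by (auto simp: fun_upd_idem)
  moreover have "length w - i = Suc (length w - Suc i)" using i by simp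
  ultimately show ?case by (simp only: funpow_Suc_right o_def)
qed auto

lemma run_write:
  "(stp ^^ (length ys + 1)) (Rgt q ys, lay z w, z + int (length w)) =
     (Lft q, lay z (w @ ys), z + int (length (w @ ys)) - 1)"
proof (induction ys arbitrary: w)
  case Nil
  then show ?case by (simp add: lay_end fun_upd_idem)
next
  case (Cons y ys)
  have "stp (Rgt q (y # ys), lay z w, z + int (length w)) = (Rgt q ys, lay z (w @ [y]), z + int (length (w @ [y])))"
    by (simp add: lay_end lay_push)
  then have "(stp ^^ 1) (Rgt q (y # ys), lay z w, z + int (length w)) = (Rgt q ys, lay z (w @ [y]), z + int (length (w @ [y])))"
    by simp
  from funpow_trans[OF this Cons[of "w @ [y]"]] show ?case by simp
qed

lemma run_left:
  "i \<le> length w \<Longrightarrow> (stp ^^ (i + 1)) (Lft q, lay z w, z + int i - 1) = (Pop q, lay z w, z)"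
proof (induction i)
  case 0
  then show ?case by (simp add: lay_before fun_upd_idem)
next
  case (Suc i)
  have "stp (Lft q, lay z w, z + int (Suc i) - 1) = (Lft q, lay z w, z + int i - 1)"
    using lay_in[of i w z] Suc by (auto simp: fun_upd_idem)
  then have "(stp ^^ 1) (Lft q, lay z w, z + int (Suc i) - 1) = (Lft q, lay z w, z + int i - 1)" by simp
  from funpow_trans[OF this Suc.IH] Suc.prems show ?case by simp
qed

lemma run_qstep:
  assumes "q \<noteq> acc" "q \<noteq> rej"
  shows "\<exists>t \<le> 2 * length w + 2 * length (snd (nx q a)) + 3.
    (stp ^^ t) (Pop q, lay z (a # w), z) = (Pop (fst (nx q a)), lay (z + 1) (w @ snd (nx q a)), z + 1)"
proof -
  let ?q = "fst (nx q a)" and ?ys = "snd (nx q a)" and ?z = "z + 1"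
  have 1: "(stp ^^ 1) (Pop q, lay z (a # w), z) = (Rgt ?q ?ys, lay ?z w, ?z + int 0)"
    using assms lay_in[of 0 "a # w" z] by (simp add: lay_pop)
  have 2: "(stp ^^ length w) (Rgt ?q ?ys, lay ?z w, ?z + int 0) = (Rgt ?q ?ys, lay ?z w, ?z + int (length w))"
    using run_right[of 0 w ?q ?ys ?z] by simp
  have 3: "(stp ^^ (length ?ys + 1)) (Rgt ?q ?ys, lay ?z w, ?z + int (length w)) =
     (Lft ?q, lay ?z (w @ ?ys), ?z + int (length (w @ ?ys)) - 1)"
    by (rule run_write)
  have 4: "(stp ^^ (length (w @ ?ys) + 1)) (Lft ?q, lay ?z (w @ ?ys), ?z + int (length (w @ ?ys)) - 1) =
     (Pop ?q, lay ?z (w @ ?ys), ?z)"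
    by (rule run_left) simp
  show ?thesis
    by (rule exI, rule conjI[OF _ funpow_trans[OF funpow_trans[OF funpow_trans[OF 1 2] 3] 4]]) simp
qed

lemma qstep_final: "fst ((qstep nx ^^ k) (q, w)) = q" if "q = acc \<or> q = rej"
proof (induction k arbitrary: w)
  case (Suc k)
  have "fst (qstep nx (q, w)) = q" using that final by (cases w) auto
  then obtain w' where "qstep nx (q, w) = (q, w')" by (cases "qstep nx (q, w)") auto
  then show ?case using Suc by (simp only: funpow_Suc_right o_def)
qed simp

lemma qstep_empty: "(qstep nx ^^ k) (q, []) = (q, [])" by (induction k) auto

text \<open>A queue step costs two walks along the queue, whose length never exceeds
  \<open>L + D * k\<close>. The bound \<open>L\<close> is generalised because the remaining run
  starts from a queue that may be longer by \<open>D\<close>.\<close>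

lemma run_queue:
  assumes D: "\<And>q a. q \<in> St \<Longrightarrow> a \<in> Sy \<Longrightarrow> length (snd (nx q a)) \<le> D"
    and "q \<in> St" "set w \<subseteq> Sy" "length w \<le> L"
    and "fst ((qstep nx ^^ k) (q, w)) = s" "s = acc \<or> s = rej"
  shows "\<exists>t \<le> k * (2 * (L + D * k) + 2 * D + 3). fst ((stp ^^ t) (Pop q, lay z w, z)) = Pop s"
  using assms(2-5)
proof (induction k arbitrary: q w L z)
  case 0
  then show ?case by auto
next
  case (Suc k)
  show ?case
  proof (cases "q = acc \<or> q = rej")
    case True
    then have "s = q" using Suc.prems(4) qstep_final by metis
    then show ?thesis by (intro exI[of _ 0]) auto
  next
    case False
    have "w \<noteq> []" using Suc.prems(4) qstep_empty[of "Suc k" q] False assms(6) by auto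
    then obtain a v where w: "w = a # v" by (cases w) auto
    let ?q = "fst (nx q a)" and ?v = "v @ snd (nx q a)"
    have aS: "a \<in> Sy" "set v \<subseteq> Sy" using Suc.prems w by auto
    have len: "length (snd (nx q a)) \<le> D" using D Suc.prems(1) aS by auto
    obtain t1 where t1: "t1 \<le> 2 * length v + 2 * length (snd (nx q a)) + 3"
      "(stp ^^ t1) (Pop q, lay z w, z) = (Pop ?q, lay (z + 1) ?v, z + 1)"
      using run_qstep[of q v a z] False w by blast
    have "fst ((qstep nx ^^ k) (?q, ?v)) = s"
      using Suc.prems(4) w by (simp only: funpow_Suc_right o_def qstep.simps)
    moreover have "length ?v \<le> L + D" using Suc.prems(3) w len by simp
    ultimately obtain t2 where t2: "t2 \<le> k * (2 * (L + D + D * k) + 2 * D + 3)"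
      "fst ((stp ^^ t2) (Pop ?q, lay (z + 1) ?v, z + 1)) = Pop s"
      using Suc.IH[of ?q ?v "L + D" "z + 1"] closed[OF Suc.prems(1) aS(1)] aS(2) by auto
    have "t2 + t1 \<le> Suc k * (2 * (L + D * Suc k) + 2 * D + 3)"
    proof -
      have "t1 \<le> 2 * (L + D * Suc k) + 2 * D + 3" using t1(1) len Suc.prems(3) w by simp
      moreover have "L + D + D * k = L + D * Suc k" by simp
      ultimately show ?thesis using t2(1) by (simp only: mult_Suc)
    qed
    moreover have "fst ((stp ^^ (t2 + t1)) (Pop q, lay z w, z)) = Pop s"
      using t1(2) t2(2) by (simp add: funpow_add)
    ultimately show ?thesis by blast
  qed
qed

theorem in_P_if_queue_run:
  assumes F: "poly_bounded F"
    and run: "\<And>x. \<exists>k \<le> F (length x). fst ((qstep nx ^^ k) (q0, map bt x @ [hash])) = (if x \<in> L then acc else rej)"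
  shows "in_P L"
proof -
  have "finite ((\<lambda>(q, a). length (snd (nx q a))) ` (St \<times> Sy))" using fin by simp
  note Max_ge[OF this]
  moreover define D where "D = Max ((\<lambda>(q, a). length (snd (nx q a))) ` (St \<times> Sy))"
  ultimately have D: "length (snd (nx q a)) \<le> D" if "q \<in> St" "a \<in> Sy" for q a
    using that by (metis (no_types, lifting) SigmaI case_prod_conv imageI)
  \<comment> \<open>Finite because a word being appended is never longer than the longest transition
    output.\<close>
  define Qs where "Qs = {Ini} \<union> Pop ` St \<union> Lft ` St \<union> (\<lambda>(q, ys). Rgt q ys) ` (St \<times> {ys. set ys \<subseteq> Sy \<and> length ys \<le> D})"
  define Bs where "Bs = insert None (Some ` Sy)"
  have finQ: "finite Qs" "finite Bs"
    using fin finite_lists_length_le[OF fin(2)] by (auto simp: Qs_def Bs_def)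
  have mem: "Ini \<in> Qs" "Pop q \<in> Qs \<longleftrightarrow> q \<in> St" "Lft q \<in> Qs \<longleftrightarrow> q \<in> St"
    "Rgt q ys \<in> Qs \<longleftrightarrow> q \<in> St \<and> set ys \<subseteq> Sy \<and> length ys \<le> D"
    "None \<in> Bs" "Some a \<in> Bs \<longleftrightarrow> a \<in> Sy" for q ys a
    by (auto simp: Qs_def Bs_def)
  have cl: "fst (dl q a) \<in> Qs \<and> fst (snd (dl q a)) \<in> Bs \<and> snd (snd (dl q a)) \<in> {-1, 0, 1}"
    if "q \<in> Qs" "a \<in> Bs" for q a
  proof (cases "(q, a)" rule: dl.cases)
    case (5 q' a')
    then show ?thesis using that closed[of q' a'] D[of q' a'] by (simp add: mem)
  qed (use that states syms in \<open>simp_all add: mem\<close>)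
  obtain M where M: "wf_tm M" "\<And>x t. let s = fst ((stp ^^ t)
            (Ini, \<lambda>i. if 0 \<le> i \<and> nat i < length x then Some (bt (x ! nat i)) else None, 0)) in
          (halted (tm_run M x t) \<longleftrightarrow> s \<in> {Pop acc, Pop rej}) \<and> (fst (tm_run M x t) = 1 \<longleftrightarrow> s = Pop acc)"
    using ex_tm_of_gen_step[OF finQ, where qi = Ini and qa = "Pop acc" and qr = "Pop rej" and bl = None
        and bt = "\<lambda>b. Some (bt b)" and d = dl, OF _ _ _ _ _ _ _ _ _ _ _ _ cl] states syms
    by (auto simp: mem)
  have lay0: "(\<lambda>i. if 0 \<le> i \<and> nat i < length x then Some (bt (x ! nat i)) else None) = lay 0 (map bt x)" for x
    by (rule ext) (auto simp: lay_def)
  \<comment> \<open>The first summand is the simulation from a queue of length n + 1; the rest is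
    the walk to the end of the input, the writing of \<open>hash\<close> and the walk back.\<close>
  define B where "B n = F n * (2 * ((n + 1) + D * F n) + 2 * D + 3) + (n + 2 + n)" for n
  have "\<exists>t \<le> B (length x). halted (tm_run M x t) \<and> (fst (tm_run M x t) = 1 \<longleftrightarrow> x \<in> L)" for x
  proof -
    let ?w = "map bt x" and ?n = "length x" and ?i = "(Ini, lay 0 (map bt x), 0::int)"
    have 1: "(stp ^^ ?n) (Ini, lay 0 ?w, 0) = (Ini, lay 0 ?w, 0 + int ?n)"
      using run_ini[of 0 ?w 0] by simp
    have 2: "(stp ^^ 1) (Ini, lay 0 ?w, 0 + int ?n) = (Lft q0, lay 0 (?w @ [hash]), 0 + int ?n - 1)"
      using lay_end[of 0 ?w] lay_push[of 0 ?w hash] by simp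
    have 3: "(stp ^^ (?n + 1)) (Lft q0, lay 0 (?w @ [hash]), 0 + int ?n - 1) = (Pop q0, lay 0 (?w @ [hash]), 0)"
      using run_left[of ?n "?w @ [hash]" q0 0] by simp
    obtain k where k: "k \<le> F ?n" "fst ((qstep nx ^^ k) (q0, ?w @ [hash])) = (if x \<in> L then acc else rej)"
      using run by blast
    obtain t where t: "t \<le> k * (2 * ((?n + 1) + D * k) + 2 * D + 3)"
      "fst ((stp ^^ t) (Pop q0, lay 0 (?w @ [hash]), 0)) = Pop (if x \<in> L then acc else rej)"
    proof -
      have "set (?w @ [hash]) \<subseteq> Sy" "length (?w @ [hash]) \<le> ?n + 1" using syms by auto
      moreover have "(if x \<in> L then acc else rej) = acc \<or> (if x \<in> L then acc else rej) = rej" by simp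
      ultimately show ?thesis using run_queue[OF D states(1) _ _ k(2), where z = 0] that by blast
    qed
    let ?t = "t + ((?n + 1) + (1 + ?n))"
    have "(stp ^^ ((?n + 1) + (1 + ?n))) ?i = (Pop q0, lay 0 (?w @ [hash]), 0)"
      by (rule funpow_trans[OF funpow_trans[OF 1 2] 3])
    then have s: "fst ((stp ^^ ?t) ?i) = Pop (if x \<in> L then acc else rej)"
      using t(2) by (simp only: funpow_add[of t] o_def)
    have "k * (2 * ((?n + 1) + D * k) + 2 * D + 3) \<le> F ?n * (2 * ((?n + 1) + D * F ?n) + 2 * D + 3)"
      using k(1) by (intro mult_le_mono add_le_mono) auto
    then have "?t \<le> B ?n" using t(1) by (simp add: B_def)
    moreover have "halted (tm_run M x ?t) \<and> (fst (tm_run M x ?t) = 1 \<longleftrightarrow> x \<in> L)"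
      using M(2)[where x = x and t = ?t] s states(4) unfolding lay0 Let_def by simp
    ultimately show ?thesis by blast
  qed
  moreover have "poly_bounded B" unfolding B_def
    by (intro poly_bounded_intros F)
  then obtain c k where "\<And>n. B n \<le> c * (n + 1) ^ k" unfolding poly_bounded_def by blast
  ultimately have "\<forall>x. \<exists>t \<le> c * (length x + 1) ^ k. halted (tm_run M x t) \<and> (fst (tm_run M x t) = 1 \<longleftrightarrow> x \<in> L)"
    by (meson order_trans)
  then show ?thesis unfolding in_P_def using M(1) by blast
qed

end

section \<open>Machine runs as a local rule on cells\<close>

type_synonym cell = "nat \<times> nat option"

abbreviation blank_cell :: cell where "blank_cell \<equiv> (0, None)"

text \<open>Halting states become states that stand still, so a halted row is copied unchanged
  forever.\<close>

definition act :: "tm \<Rightarrow> nat \<Rightarrow> nat \<Rightarrow> nat \<times> nat \<times> int" where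
  "act M q a = (if q = 1 \<or> q = 2 then (q, a, 0) else snd (snd M) q a)"

definition arrival :: "tm \<Rightarrow> int \<Rightarrow> cell \<Rightarrow> nat option" where
  "arrival M d c = (case snd c of None \<Rightarrow> None | Some q \<Rightarrow>
     if snd (snd (act M q (fst c))) = d then Some (fst (act M q (fst c))) else None)"

text \<open>A head enters the middle cell from the left moving by 1, from the right moving by -1, or
  stays. Along a run there is a single head, so at most one case applies; the order of the cases
  only makes the rule total.\<close>

definition local_step :: "tm \<Rightarrow> cell \<Rightarrow> cell \<Rightarrow> cell \<Rightarrow> cell" where
  "local_step M a b c =
     (case snd b of None \<Rightarrow> fst b | Some q \<Rightarrow> fst (snd (act M q (fst b))),
      case arrival M 0 b of Some q \<Rightarrow> Some q | None \<Rightarrow>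
        (case arrival M 1 a of Some q \<Rightarrow> Some q | None \<Rightarrow> arrival M (-1) c))"

definition cell_at :: "config \<Rightarrow> int \<Rightarrow> cell" where
  "cell_at c i = (fst (snd c) i, if snd (snd c) = i then Some (fst c) else None)"

definition cells :: "tm \<Rightarrow> cell set" where
  "cells M = {..<fst (snd M)} \<times> insert None (Some ` {..<fst M})"

lemma finite_cells: "finite (cells M)" by (simp add: cells_def)

lemma blank_in_cells: "wf_tm M \<Longrightarrow> blank_cell \<in> cells M"
  by (auto simp: wf_tm_def cells_def split: prod.splits)

lemma act_wf:
  assumes "wf_tm M" "q < fst M" "a < fst (snd M)"
  shows "fst (act M q a) < fst M" "fst (snd (act M q a)) < fst (snd M)"
    "snd (snd (act M q a)) = - 1 \<or> snd (snd (act M q a)) = 0 \<or> snd (snd (act M q a)) = 1"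
proof -
  obtain Q G d where M: "M = (Q, G, d)" by (cases M) auto
  obtain q' a' e where d: "d q a = (q', a', e)" by (cases "d q a") auto
  have "\<forall>q < Q. \<forall>a < G. case d q a of (q', a', d) \<Rightarrow> q' < Q \<and> a' < G \<and> d \<in> {-1, 0, 1}"
    using assms(1) unfolding wf_tm_def M prod.case by (elim conjE)
  then have "case d q a of (q', a', d) \<Rightarrow> q' < Q \<and> a' < G \<and> d \<in> {-1, 0, 1}"
    using assms(2,3) unfolding M fst_conv snd_conv by (elim allE impE)
  then show "fst (act M q a) < fst M" "fst (snd (act M q a)) < fst (snd M)"
    "snd (snd (act M q a)) = - 1 \<or> snd (snd (act M q a)) = 0 \<or> snd (snd (act M q a)) = 1"
    using assms(2,3) M d by (auto simp: act_def)
qed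

lemma tm_step_act: "tm_step M (q, tp, h) =
    (fst (act M q (tp h)), tp(h := fst (snd (act M q (tp h)))), h + snd (snd (act M q (tp h))))"
  by (auto simp: tm_step_def act_def split: prod.splits)

lemma in_cells_iff: "c \<in> cells M \<longleftrightarrow> fst c < fst (snd M) \<and> (\<forall>q. snd c = Some q \<longrightarrow> q < fst M)"
  unfolding cells_def by (cases c, cases "snd c") auto

lemma arrival_less: "wf_tm M \<Longrightarrow> c \<in> cells M \<Longrightarrow> arrival M d c = Some q \<Longrightarrow> q < fst M"
  using act_wf(1)[of M _ "fst c"] by (auto simp: arrival_def in_cells_iff split: option.splits if_splits)

lemma local_step_in_cells:
  assumes "wf_tm M" "a \<in> cells M" "b \<in> cells M" "c \<in> cells M"
  shows "local_step M a b c \<in> cells M"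
proof -
  have "fst (local_step M a b c) < fst (snd M)"
    using assms(3) act_wf(2)[OF assms(1), of _ "fst b"]
    by (auto simp: local_step_def in_cells_iff split: option.splits)
  moreover have "q < fst M" if "snd (local_step M a b c) = Some q" for q
  proof -
    have "arrival M 0 b = Some q \<or> arrival M 1 a = Some q \<or> arrival M (-1) c = Some q"
      using that by (simp add: local_step_def split: option.splits)
    then show ?thesis using arrival_less assms by blast
  qed
  ultimately show ?thesis unfolding in_cells_iff by blast
qed

lemma local_step_blank: "local_step M blank_cell blank_cell blank_cell = blank_cell"
  by (simp add: local_step_def arrival_def)

section \<open>Runs seen cell by cell, and where they are blank\<close>

definition config_ok :: "tm \<Rightarrow> config \<Rightarrow> bool" where
  "config_ok M c \<longleftrightarrow> fst c < fst M \<and> (\<forall>i. fst (snd c) i < fst (snd M))"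

lemma cell_at_in_cells: "config_ok M c \<Longrightarrow> cell_at c i \<in> cells M"
  by (auto simp: config_ok_def cell_at_def cells_def)

lemma config_ok_step: "wf_tm M \<Longrightarrow> config_ok M c \<Longrightarrow> config_ok M (tm_step M c)"
  using act_wf[of M] by (cases c) (auto simp: config_ok_def tm_step_act)

lemma config_ok_run: "wf_tm M \<Longrightarrow> config_ok M (tm_run M x t)"
proof (induction t)
  case 0
  then have "3 \<le> fst M" "3 \<le> fst (snd M)" by (auto simp: wf_tm_def split: prod.splits)
  then show ?case by (auto simp: tm_run_def tm_init_def config_ok_def bit_code_def)
qed (simp add: tm_run_def config_ok_step)

lemma cell_at_step:
  assumes "wf_tm M" "config_ok M c"
  shows "cell_at (tm_step M c) i = local_step M (cell_at c (i - 1)) (cell_at c i) (cell_at c (i + 1))"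
proof -
  obtain q tp h where c: "c = (q, tp, h)" by (cases c) auto
  have "snd (snd (act M q (tp h))) = - 1 \<or> snd (snd (act M q (tp h))) = 0 \<or> snd (snd (act M q (tp h))) = 1"
    using assms c by (intro act_wf) (auto simp: config_ok_def)
  then show ?thesis
    unfolding c tm_step_act cell_at_def local_step_def arrival_def by (auto split: option.splits)
qed

lemma cell_at_run_Suc: "wf_tm M \<Longrightarrow> cell_at (tm_run M x (Suc t)) i =
    local_step M (cell_at (tm_run M x t) (i - 1)) (cell_at (tm_run M x t) i) (cell_at (tm_run M x t) (i + 1))"
  using cell_at_step[OF _ config_ok_run] by (simp add: tm_run_def)

text \<open>The head moves at most one cell per step. The right bound excludes the cell at
  \<open>length x\<close> because for empty input the head starts there.\<close>

lemma cell_at_run_outside: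
  assumes "wf_tm M"
  shows "i < - int t \<or> i > int (length x) + int t \<Longrightarrow> cell_at (tm_run M x t) i = blank_cell"
proof (induction t arbitrary: i)
  case 0
  then show ?case by (auto simp: tm_run_def tm_init_def cell_at_def)
next
  case (Suc t)
  have "cell_at (tm_run M x t) (i - 1) = blank_cell" "cell_at (tm_run M x t) i = blank_cell"
    "cell_at (tm_run M x t) (i + 1) = blank_cell"
    using Suc.prems by (auto intro!: Suc.IH)
  then show ?case using assms by (simp add: cell_at_run_Suc local_step_blank)
qed

lemma run_halted: "halted (tm_run M x s) \<Longrightarrow> s \<le> t \<Longrightarrow> tm_run M x t = tm_run M x s"
proof (induction t)
  case (Suc t)
  show ?case
  proof (cases "s = Suc t")
    case False
    then have "tm_run M x t = tm_run M x s" using Suc by simp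
    moreover have "tm_step M c = c" if "halted c" for c
      using that by (cases c) (auto simp: halted_def tm_step_act act_def)
    ultimately show ?thesis using Suc.prems(1) by (simp add: tm_run_def)
  qed simp
qed simp

text \<open>Nothing changes after halting, so one strip serves all times and rows of fixed length
  can be glued together without end.\<close>

lemma cell_at_run_outside_halted:
  assumes "wf_tm M" "halted (tm_run M x s)" "s \<le> D" "i < - int D \<or> i > int (length x) + int D"
  shows "cell_at (tm_run M x t) i = blank_cell"
proof (cases "t \<le> D")
  case True
  then show ?thesis using assms cell_at_run_outside[OF assms(1), of i t] by auto
next
  case False
  then have "s \<le> t" using assms(3) by simp
  then have "tm_run M x t = tm_run M x D"
    using run_halted[OF assms(2) assms(3)] run_halted[OF assms(2)] by metis
  then show ?thesis using assms cell_at_run_outside[OF assms(1), of i D] by auto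
qed

text \<open>Rows of length \<open>length r - 1\<close> glued one after the other. The wrap-around at the row ends is harmless as
  long as the cells there stay blank.\<close>

function helix :: "tm \<Rightarrow> cell list \<Rightarrow> nat \<Rightarrow> cell" where
  "helix M r j = (if j < length r then r ! j else if length r < 3 then blank_cell
     else local_step M (helix M r (j - length r)) (helix M r (j - length r + 1)) (helix M r (j - length r + 2)))"
  by pat_completeness auto
termination by (relation "measure (\<lambda>(M, r, j). j)") auto
declare helix.simps [simp del]

lemma helix_in_cells:
  assumes "wf_tm M" "set r \<subseteq> cells M"
  shows "helix M r j \<in> cells M"
proof (induction j rule: less_induct)
  case (less j)
  have "j < length r \<Longrightarrow> r ! j \<in> cells M" using assms(2) by (meson nth_mem subsetD)
  then show ?case
    using assms(1) less by (subst helix.simps) (simp add: local_step_in_cells blank_in_cells)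
qed

text \<open>The gluing gives wrong neighbours only in the first and last column. There both the
  wrong and the true neighbours are blank, because two columns on each side are assumed blank at all
  times.\<close>

lemma helix_eq:
  assumes step: "\<And>t p. C (Suc t) p = local_step M (C t (p - 1)) (C t p) (C t (p + 1))"
    and len: "length r = Suc N" "3 \<le> N"
    and init: "\<And>i. i \<le> N \<Longrightarrow> r ! i = C 0 (int i - z)"
    and left: "\<And>t. C t (0 - z) = blank_cell" "\<And>t. C t (1 - z) = blank_cell"
    and right: "\<And>t. C t (int N - 1 - z) = blank_cell" "\<And>t. C t (int N - z) = blank_cell"
  shows "i \<le> N \<Longrightarrow> helix M r (t * N + i) = C t (int i - z)"
proof -
  have main: "i < N \<Longrightarrow> j = t * N + i \<Longrightarrow> helix M r j = C t (int i - z)" for i j t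
  proof (induction j arbitrary: t i rule: less_induct)
    case (less j)
    show ?case
    proof (cases "j < Suc N")
      case True
      show ?thesis
      proof (cases t)
        case 0
        then show ?thesis using True len less.prems init by (subst helix.simps) simp
      next
        case (Suc t')
        \<comment> \<open>\<open>r\<close> has N + 1 entries: beyond row 0 it covers only the first
          cell of row 1.\<close>
        then have "t' * N + i = 0" using True less.prems by simp
        then have "t = 1" "i = 0" "j = N" using Suc less.prems len by auto
        then show ?thesis using True len init[of N] left right by (subst helix.simps) simp
      qed
    next
      case False
      have "t \<noteq> 0" using False less.prems by (cases t) auto
      then obtain t' where t: "t = Suc t'" by (cases t) auto
      have h: "helix M r j = local_step M (helix M r (j - Suc N)) (helix M r (j - Suc N + 1)) (helix M r (j - Suc N + 2))"
        using False len by (subst helix.simps) simp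
      have IH: "helix M r k = C s (int l - z)" if "k = s * N + l" "l < N" "k < j" for k s l
        using less.IH[OF that(3) that(2) that(1)] .
      show ?thesis
      proof (cases i)
        \<comment> \<open>The predecessors of the first cell of a row are the last cell two rows up
          and the first two cells of the row above; all are blank.\<close>
        case 0
        have "t' \<noteq> 0" using False less.prems 0 t by (cases t') auto
        then obtain u where u: "t' = Suc u" by (cases t') auto
        have j: "j = Suc (Suc u) * N" using less.prems t u 0 by simp
        have "helix M r (j - Suc N) = C u (int (N - 1) - z)"
          using j len by (intro IH) auto
        moreover have "helix M r (j - Suc N + 1) = C t' (int 0 - z)"
          using j len u by (intro IH) auto
        moreover have "helix M r (j - Suc N + 2) = C t' (int 1 - z)"
          using j len u by (intro IH) auto
        moreover have "int (N - 1) = int N - 1" using len by simp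
        ultimately have "helix M r j = blank_cell"
          using h left right by (simp add: local_step_blank)
        then show ?thesis using 0 left by simp
      next
        case (Suc k)
        have j: "j = t' * N + N + Suc k" using less.prems t Suc by simp
        have 1: "helix M r (j - Suc N) = C t' (int k - z)"
          using j less.prems Suc len by (intro IH) auto
        have 2: "helix M r (j - Suc N + 1) = C t' (int i - z)"
          using j less.prems Suc len by (intro IH) auto
        have 3: "helix M r (j - Suc N + 2) = C t' (int (Suc i) - z)"
        proof (cases "Suc i = N")
          \<comment> \<open>The right neighbour of the last column is the first cell of the row
            being computed, instead of column N of the row above; both are blank.\<close>
          case True
          have "helix M r (j - Suc N + 2) = C t (int 0 - z)"
            using j True Suc len t by (intro IH) auto
          then show ?thesis using True left right by simp
        next
          case False
          then show ?thesis using j less.prems Suc len by (intro IH) auto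
        qed
        have "int k - z = int i - z - 1" "int (Suc i) - z = int i - z + 1" using Suc by auto
        then show ?thesis unfolding h 1 2 3 t step by (simp only:)
      qed
    qed
  qed
  assume i: "i \<le> N"
  show ?thesis
  \<comment> \<open>Column N of row t is column 0 of row t + 1, and both are blank.\<close>
  proof (cases "i = N")
    case True
    have "helix M r (Suc t * N + 0) = C (Suc t) (int 0 - z)" using len by (intro main) auto
    moreover have "t * N + i = Suc t * N + 0" using True by simp
    moreover have "C t (int i - z) = C (Suc t) (int 0 - z)" using True left right by (simp only: of_nat_0)
    ultimately show ?thesis by (simp only:)
  next
    case False
    then show ?thesis using i main[OF _ refl] by simp
  qed
qed

section \<open>Grammars deriving the empty word\<close>

text \<open>Unary indices in binary notation, least significant bit first: the digits of \<open>num m s\<close> are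
  \<open>1\<^sup>m 0\<^sup>s\<^sup>+\<^sup>1 1\<close>, so that incrementing an index means inserting one digit at the front.\<close>

fun num :: "nat \<Rightarrow> nat \<Rightarrow> nat" where
  "num 0 0 = 2"
| "num 0 (Suc s) = 2 * num 0 s"
| "num (Suc m) s = 2 * num m s + 1"

lemma num_ge2: "2 \<le> num m s"
  by (induction m s rule: num.induct) auto

lemma num_pos: "0 < num m s"
  using num_ge2[of m s] by simp

lemma bin_num: "bin (num m s) = replicate m B1 @ replicate (Suc s) B0 @ [B1]"
proof (induction m s rule: num.induct)
  case 1
  then show ?case by (simp add: bin.simps)
next
  case (2 s)
  have "bin (2 * num 0 s) = B0 # bin (num 0 s)" using num_pos[of 0 s] by (subst bin.simps) simp
  then show ?case using 2 by (simp del: bin.simps)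
next
  case (3 m s)
  have "bin (2 * num m s + 1) = B1 # bin (num m s)" by (subst bin.simps) simp
  then show ?case using 3 by (simp del: bin.simps)
qed
declare bin.simps [simp del]

lemma num_0_inj: "num 0 s = num 0 s' \<longleftrightarrow> s = s'"
proof (induction s arbitrary: s')
  case 0
  have "num 0 0 \<noteq> num 0 (Suc s)" for s using num_ge2[of 0 s] by simp
  then show ?case by (cases s') auto
next
  case (Suc s)
  have "num 0 (Suc s) \<noteq> num 0 0" using num_ge2[of 0 s] by simp
  then show ?case using Suc by (cases s') auto
qed

text \<open>Parity is the first digit: it tells whether \<open>m\<close> is 0, and otherwise one
  leading 1 can be removed on both sides.\<close>

lemma num_inj: "num m s = num m' s' \<longleftrightarrow> m = m' \<and> s = s'"
proof -
  have even_0: "even (num 0 s)" for s by (cases s) auto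
  have odd_Suc: "odd (num (Suc m) s)" for m s by simp
  show ?thesis
  proof (induction m arbitrary: m')
    case 0
    then show ?case using num_0_inj even_0 odd_Suc by (cases m') (simp, metis nat.distinct(1))
  next
    case (Suc m)
    show ?case
    proof (cases m')
      case 0
      then show ?thesis using even_0 odd_Suc by (metis nat.distinct(1))
    next
      case (Suc n)
      then show ?thesis using Suc.IH[of n] by simp
    qed
  qed
qed

declare num.simps [simp del]

text \<open>Names relative to a block: \<open>Rel False off s\<close> has the index of the block plus \<open>off\<close>, \<open>Rel True off s\<close> the
  index of the block one row earlier plus \<open>off\<close>.\<close>

datatype sname = Rel bool nat nat | Abs nat

fun name_val :: "nat \<Rightarrow> nat \<Rightarrow> sname \<Rightarrow> nat" where
  "name_val a b (Rel r off s) = num ((if r then b else a) + off) s"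
| "name_val a b (Abs s) = num 0 s"

type_synonym sprod = "sname \<times> sname list"

fun prod_val :: "nat \<Rightarrow> nat \<Rightarrow> sprod \<Rightarrow> prod" where
  "prod_val a b (h, bs) = (name_val a b h, map (\<lambda>s. NT (name_val a b s)) bs)"

text \<open>Block kinds: input cell (with or without the head), last input cell, certificate cell, blank cell
  (left or right of the input), transition rules. Besides cell codes (which are at least 3), the names carry
  0 for the start symbol and 1 / 2 for "the certificate has not / has ended before this cell".\<close>

datatype kind = KI bool bool | KE | KCh | KB bool | KR

definition code :: "cell \<Rightarrow> nat" where "code c = to_nat c + 3"

lemma code_inj: "code c = code d \<longleftrightarrow> c = d" by (simp add: code_def)
lemma code_neq [simp]: "code c \<noteq> 0" "code c \<noteq> Suc 0" "code c \<noteq> 2" "0 \<noteq> code c" "Suc 0 \<noteq> code c" "2 \<noteq> code c"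
  by (simp_all add: code_def)

abbreviation cell_name :: "cell \<Rightarrow> sname" where "cell_name c \<equiv> Rel False 0 (code c)"

text \<open>Every group must offer two productions; repeating one leaves nothing to choose.\<close>

definition fixed :: "sprod \<Rightarrow> sprod list" where "fixed p = [p, p]"

text \<open>With row distance n the indices j - n, j - n + 1, j - n + 2 are the left, middle and
  right predecessor of index j. The final groups derive the start symbol from any cell holding the
  accepting state 1.\<close>

definition rule_groups :: "tm \<Rightarrow> cell list \<Rightarrow> sprod list list" where
  "rule_groups M cl =
     concat (map (\<lambda>a. concat (map (\<lambda>b. map (\<lambda>c.
       fixed (cell_name (local_step M a b c), [Rel True 0 (code a), Rel True 1 (code b), Rel True 2 (code c)])) cl) cl)) cl)
     @ map (\<lambda>c. fixed (Abs 0, [cell_name c])) (filter (\<lambda>c. snd c = Some 1) cl)"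

text \<open>\<open>KE\<close> and \<open>KCh\<close> also decide about the next index: 1 continues
  the certificate, 2 ends it. Both put this decision into their second group, so that it can be
  looked up uniformly. The cell \<open>(1, None)\<close> of \<open>KE\<close> is the last separator
  bit of \<open>pair_enc\<close>.\<close>

fun groups :: "tm \<Rightarrow> cell list \<Rightarrow> kind \<Rightarrow> sprod list list" where
  "groups M cl (KI h b) = [fixed (cell_name (bit_code b, if h then Some 0 else None), [])]"
| "groups M cl KE = [fixed (cell_name (1, None), []), [(Rel False 1 1, []), (Rel False 1 2, [])]]"
| "groups M cl KCh = [[(cell_name (1, None), [Rel False 0 1]), (cell_name (2, None), [Rel False 0 1])],
     [(Rel False 1 1, [Rel False 0 1]), (Rel False 1 2, [Rel False 0 1])],
     fixed (Rel False 1 2, [Rel False 0 2]), fixed (cell_name (0, None), [Rel False 0 2])]"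
| "groups M cl (KB r) = [fixed (cell_name (0, None), [])]"
| "groups M cl KR = rule_groups M cl"

lemma length_group: "g \<in> set (groups M cl k) \<Longrightarrow> length g = 2"
  by (cases k) (auto simp: fixed_def rule_groups_def)

definition group_names :: "sprod list list \<Rightarrow> sname list" where
  "group_names gs = concat (map (\<lambda>g. concat (map (\<lambda>(h, bs). h # bs) g)) gs)"

text \<open>Nonterminals are listed once per occurrence, since a sweep can copy names but not remove
  duplicates. The truncated \<open>j - n\<close> matters only in rule blocks, the only ones with
  names relative to the previous row.\<close>

definition grammar :: "tm \<Rightarrow> cell list \<Rightarrow> nat \<Rightarrow> kind list \<Rightarrow> ppcfg" where
  "grammar M cl n ks =
    (num 0 0 # concat (map (\<lambda>j. map (name_val j (j - n)) (group_names (groups M cl (ks ! j)))) [0..<length ks]),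
     [],
     concat (map (\<lambda>j. map (map (prod_val j (j - n))) (groups M cl (ks ! j))) [0..<length ks]),
     num 0 0)"

lemma in_group_names_iff:
  "nm \<in> set (group_names gs) \<longleftrightarrow> (\<exists>g \<in> set gs. \<exists>s \<in> set g. nm = fst s \<or> nm \<in> set (snd s))"
  by (auto simp: group_names_def split_beta)

lemma grammar_valid: "valid_instance (grammar M cl n ks) [[]]"
proof -
  have "wf_prod (ppcfg_V (grammar M cl n ks)) [] p"
    if "j < length ks" "g \<in> set (groups M cl (ks ! j))" "s \<in> set g" "p = prod_val j (j - n) s" for j g s p
  proof -
    have "name_val j (j - n) nm \<in> set (ppcfg_V (grammar M cl n ks))" if "nm \<in> set (fst s # snd s)" for nm
    proof -
      have "nm \<in> set (group_names (groups M cl (ks ! j)))"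
        unfolding in_group_names_iff using that \<open>g \<in> _\<close> \<open>s \<in> _\<close> by (intro bexI[of _ g] bexI[of _ s]) auto
      then show ?thesis using \<open>j < _\<close> by (auto simp: grammar_def)
    qed
    then show ?thesis using that(4) by (cases s) (auto simp: wf_prod_def)
  qed
  then show ?thesis
    by (auto simp: valid_instance_def is_ppcfg_def grammar_def length_group)
qed

section \<open>Settings as choices, derivations as Horn consequences\<close>

lemma ex_consistent_iff:
  assumes "\<And>g. g \<in> set Pi \<Longrightarrow> length g = 2"
  shows "(\<exists>p. consistent_setting (V, Sg, Pi, S) [[]] p) \<longleftrightarrow>
    (\<exists>ps. list_all2 (\<lambda>g q. q \<in> set g) Pi ps \<and> derives (set ps) S [])"
proof
  assume "\<exists>p. consistent_setting (V, Sg, Pi, S) [[]] p"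
  then obtain p where p: "param_setting (length Pi) 2 p" "derives (ppcfg_prods (V, Sg, Pi, S) p) S []"
    by (auto simp: consistent_setting_def ppcfg_lang_def cfg_lang_def)
  let ?ps = "map (\<lambda>i. Pi ! i ! (p ! i - 1)) [0..<length Pi]"
  have "p ! i - 1 < length (Pi ! i)" if "i < length Pi" for i
  proof -
    have "1 \<le> p ! i" "p ! i \<le> 2" using p(1) that by (auto simp: param_setting_def)
    then show ?thesis using assms[of "Pi ! i"] that by simp
  qed
  then have "list_all2 (\<lambda>g q. q \<in> set g) Pi ?ps" by (auto simp: list_all2_conv_all_nth)
  moreover have "set ?ps = ppcfg_prods (V, Sg, Pi, S) p" by (auto simp: ppcfg_prods_def)
  ultimately have "list_all2 (\<lambda>g q. q \<in> set g) Pi ?ps \<and> derives (set ?ps) S []"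
    using p(2) by (simp only: conj_ac)
  then show "\<exists>ps. list_all2 (\<lambda>g q. q \<in> set g) Pi ps \<and> derives (set ps) S []" by (rule exI)
next
  assume "\<exists>ps. list_all2 (\<lambda>g q. q \<in> set g) Pi ps \<and> derives (set ps) S []"
  then obtain ps where ps: "list_all2 (\<lambda>g q. q \<in> set g) Pi ps" "derives (set ps) S []" by blast
  have "\<exists>c. 1 \<le> c \<and> c \<le> 2 \<and> Pi ! i ! (c - 1) = ps ! i" if i: "i < length Pi" for i
  proof -
    have "ps ! i \<in> set (Pi ! i)" using ps(1) i by (simp add: list_all2_conv_all_nth)
    moreover have "length (Pi ! i) = 2" using assms i by simp
    ultimately obtain c where "c < 2" "Pi ! i ! c = ps ! i" by (metis in_set_conv_nth)
    then show ?thesis by (intro exI[of _ "Suc c"]) auto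
  qed
  then obtain c where c: "\<And>i. i < length Pi \<Longrightarrow> 1 \<le> c i \<and> c i \<le> 2 \<and> Pi ! i ! (c i - 1) = ps ! i" by metis
  let ?p = "map c [0..<length Pi]"
  have "length ps = length Pi" using ps(1) by (simp add: list_all2_lengthD)
  then have "set ps = ppcfg_prods (V, Sg, Pi, S) ?p"
    using c by (force simp: ppcfg_prods_def set_conv_nth)
  then have "consistent_setting (V, Sg, Pi, S) [[]] ?p"
    using ps(2) c by (auto simp: consistent_setting_def ppcfg_lang_def cfg_lang_def param_setting_def)
  then show "\<exists>p. consistent_setting (V, Sg, Pi, S) [[]] p" by blast
qed

text \<open>Turns a choice from a concatenated list of groups into one choice function on block
  indices; distinctness lets that function be updated at one block without affecting the
  others.\<close>

lemma list_all2_concat_map: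
  assumes "distinct js"
  shows "list_all2 P (concat (map f js)) ps \<longleftrightarrow>
    (\<exists>h. ps = concat (map h js) \<and> (\<forall>j \<in> set js. list_all2 P (f j) (h j)))"
  using assms
proof (induction js arbitrary: ps)
  case (Cons j js)
  show ?case
  proof
    assume "list_all2 P (concat (map f (j # js))) ps"
    then obtain u v where uv: "ps = u @ v" "list_all2 P (f j) u" "list_all2 P (concat (map f js)) v"
      by (auto simp: list_all2_append1)
    then obtain h where h: "v = concat (map h js)" "\<forall>j \<in> set js. list_all2 P (f j) (h j)"
      using Cons by auto
    have "map (h(j := u)) js = map h js" using Cons.prems by (intro map_cong) auto
    then show "\<exists>h. ps = concat (map h (j # js)) \<and> (\<forall>j \<in> set (j # js). list_all2 P (f j) (h j))"
      using uv h Cons.prems by (intro exI[of _ "h(j := u)"]) auto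
  next
    assume "\<exists>h. ps = concat (map h (j # js)) \<and> (\<forall>j \<in> set (j # js). list_all2 P (f j) (h j))"
    then show "list_all2 P (concat (map f (j # js))) ps" using Cons
      by (auto intro!: list_all2_appendI)
  qed
qed auto

text \<open>Least-model bound: terminals impose no condition, so a set of nonterminals closed under
  the clauses contains every nonterminal that derives any word.\<close>

lemma derives_sound:
  assumes "\<And>A rhs. (A, rhs) \<in> P \<Longrightarrow> (\<forall>B. NT B \<in> set rhs \<longrightarrow> B \<in> I) \<Longrightarrow> A \<in> I"
  shows "derives P A w \<Longrightarrow> A \<in> I"
proof -
  have "(gen P r w \<longrightarrow> (\<forall>B. NT B \<in> set r \<longrightarrow> B \<in> I)) \<and> (derives P A w' \<longrightarrow> A \<in> I)" for r w A w'
    by (rule gen_derives.induct) (auto intro: assms)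
  then show "derives P A w \<Longrightarrow> A \<in> I" by blast
qed

lemma derives_Nil:
  assumes "(A, map NT bs) \<in> P" "\<And>B. B \<in> set bs \<Longrightarrow> derives P B []"
  shows "derives P A []"
proof -
  have "gen P (map NT bs) []" using assms(2)
  proof (induction bs)
    case (Cons b bs)
    then have "gen P (NT b # map NT bs) ([] @ [])" by (intro gen_derives.gen_NT) auto
    then show ?case by simp
  qed (simp add: gen_derives.gen_Nil)
  then show ?thesis using assms(1) by (rule gen_derives.derives_prod[rotated])
qed

section \<open>The grammar of a bounded verifier\<close>

text \<open>The blocks of the cells of \<open>pair_enc x []\<close>, the flag putting the head on
  the first one. The second separator cell is \<open>KE\<close>, as it decides whether a certificate
  starts at all.\<close>

fun kbits :: "bool \<Rightarrow> bool list \<Rightarrow> kind list" where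
  "kbits f [] = [KI f False, KE]"
| "kbits f (b # x) = KI f True # KI False b # kbits False x"

lemma length_kbits [simp]: "length (kbits f x) = 2 * length x + 2"
  by (induction f x rule: kbits.induct) auto

lemma pair_enc_Nil [simp]: "pair_enc [] y = False # False # y"
  and pair_enc_Cons [simp]: "pair_enc (b # x) y = True # b # pair_enc x y"
  by (simp_all add: pair_enc_def)

lemma length_pair_enc [simp]: "length (pair_enc x y) = 2 * length x + 2 + length y"
  by (induction x) auto

lemma nth_pair_enc [simp]: "pair_enc x y ! (2 * length x + 2 + i) = y ! i"
  by (induction x) auto

lemma nth_pair_enc_end [simp]: "pair_enc x y ! (2 * length x + 1) = False"
  by (induction x) auto

lemma nth_kbits: "i < 2 * length x + 1 \<Longrightarrow> kbits f x ! i = KI (f \<and> i = 0) (pair_enc x y ! i)"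
proof (induction f x arbitrary: i rule: kbits.induct)
  case (2 f b x)
  show ?case
  proof (cases i)
    case (Suc i')
    then show ?thesis using 2 by (cases i') auto
  qed auto
qed auto

lemma nth_kbits_end: "kbits f x ! (2 * length x + 1) = KE"
  by (induction f x rule: kbits.induct) auto

text \<open>\<open>D\<close> bounds the running time, \<open>B\<close> the certificate length,
  \<open>K\<close> is the blank margin on each side of the first row, and \<open>R\<close> rule
  blocks suffice for \<open>D\<close> further rows.\<close>

locale bounded_verifier =
  fixes M :: tm and cl :: "cell list" and K B R D :: nat and x :: "bool list"
  assumes wf: "wf_tm M" and cl: "set cl = cells M"
    and halts: "\<And>y. length y \<le> B \<Longrightarrow> \<exists>t \<le> D. halted (tm_run M (pair_enc x y) t)"
    and K: "D + 3 \<le> K" and R: "D * (2 * K + B + 2 * length x + 1) \<le> R"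
begin

definition "base = K + 2 * length x + 2"
text \<open>One less than the number of blocks before the rules: the helix starts from N + 1 cells
  for rows of length N.\<close>

definition "N = 2 * K + B + 2 * length x + 1"
definition "ks = replicate K (KB False) @ kbits True x @ replicate B KCh @ replicate K (KB True) @ replicate R KR"
definition "row y = map (\<lambda>j. cell_at (tm_init (pair_enc x y)) (int j - int K)) [0..<Suc N]"

abbreviation "val_at y \<equiv> helix M (row y)"

lemma length_row [simp]: "length (row y) = Suc N" by (simp add: row_def)
lemma N_ge: "3 \<le> N" using K by (simp add: N_def)

lemma val_at_row: "j \<le> N \<Longrightarrow> val_at y j = cell_at (tm_init (pair_enc x y)) (int j - int K)"
  by (subst helix.simps) (auto simp: row_def simp del: upt_Suc)

lemma length_ks: "length ks = Suc N + R"
  by (simp add: ks_def N_def)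

text \<open>Matches each block with its cell of the helix. Among the blocks of the first row only
  choice blocks have a value that varies with the certificate, so all others can state theirs as
  facts.\<close>

lemma kind_cases:
  assumes "j < length ks"
  obtains
    (blank) r where "ks ! j = KB r" "\<And>y. length y \<le> B \<Longrightarrow> val_at y j = blank_cell"
  | (bit) h b where "ks ! j = KI h b" "\<And>y. length y \<le> B \<Longrightarrow> val_at y j = (bit_code b, if h then Some 0 else None)"
  | (last) "ks ! j = KE" "Suc j = base" "\<And>y. length y \<le> B \<Longrightarrow> val_at y j = (1, None)"
  | (choice) i where "ks ! j = KCh" "i < B" "j = base + i"
      "\<And>y. length y \<le> B \<Longrightarrow> val_at y j = (if i < length y then (bit_code (y ! i), None) else blank_cell)"
  | (rule) "ks ! j = KR" "Suc N \<le> j"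
proof -
  have ini: "val_at y j = (if K \<le> j \<and> j - K < 2 * length x + 2 + length y then bit_code (pair_enc x y ! (j - K)) else 0,
      if j = K then Some 0 else None)" if "j \<le> N" for y
    using that by (auto simp: val_at_row cell_at_def tm_init_def nat_diff_distrib)
  consider "j < K" | "K \<le> j" "j < K + (2 * length x + 1)" | "j = K + (2 * length x + 1)"
    | "base \<le> j" "j < base + B" | "base + B \<le> j" "j \<le> N" | "N < j"
    unfolding base_def by linarith
  then show ?thesis
  proof cases
    case 1
    then have "j \<le> N" by (simp add: N_def)
    with 1 show ?thesis using ini by (intro blank[of False]) (auto simp: ks_def nth_append)
  next
    case 2
    then have "j \<le> N" by (simp add: N_def)
    have lt: "j - K < 2 * length x + 1" using 2 by simp
    have k: "ks ! j = kbits True x ! (j - K)" using 2 lt by (simp add: ks_def nth_append)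
    show ?thesis
    proof (rule bit)
      show "ks ! j = KI (j = K) (pair_enc x [] ! (j - K))"
        using nth_kbits[OF lt, of True "[]"] 2(1) k by auto
      fix y :: "bool list" assume "length y \<le> B"
      have "pair_enc x y ! (j - K) = pair_enc x [] ! (j - K)"
        using nth_kbits[OF lt, of True "[]"] nth_kbits[OF lt, of True y] by simp
      then show "val_at y j = (bit_code (pair_enc x [] ! (j - K)), if j = K then Some 0 else None)"
        using ini[OF \<open>j \<le> N\<close>, of y] 2(1) lt by simp
    qed
  next
    case 3
    then have "j \<le> N" by (simp add: N_def)
    have e: "j - K = 2 * length x + 1" using 3 by simp
    show ?thesis
    proof (rule last)
      show "ks ! j = KE" using 3 nth_kbits_end[of True x] by (simp add: ks_def nth_append)
      show "Suc j = base" using 3 by (simp add: base_def)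
      fix y :: "bool list"
      show "val_at y j = (1, None)"
        using ini[OF \<open>j \<le> N\<close>, of y] 3 nth_pair_enc_end[of x y] unfolding e by (simp add: bit_code_def)
    qed
  next
    case 4
    then have "j \<le> N" by (simp add: N_def base_def)
    define i where "i = j - base"
    have i: "j = base + i" "i < B" using 4 by (auto simp: i_def)
    have e: "j - K = 2 * length x + 2 + i" using i(1) by (simp add: base_def)
    have "ks ! j = KCh" using 4 by (auto simp: ks_def nth_append base_def)
    then show ?thesis
    proof (rule choice)
      fix y :: "bool list"
      show "val_at y j = (if i < length y then (bit_code (y ! i), None) else blank_cell)"
        using ini[OF \<open>j \<le> N\<close>, of y] i(1) nth_pair_enc[of x y i] unfolding e by (simp add: base_def)
    qed (use i in auto)
  next
    case 5
    moreover have "ks ! j = KB True" using 5 by (auto simp: ks_def nth_append base_def N_def)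
    ultimately show ?thesis using ini by (intro blank[of True]) (auto simp: base_def)
  next
    case 6
    moreover have "ks ! j = KR" using 6 assms by (auto simp: ks_def nth_append base_def N_def)
    ultimately show ?thesis by (intro rule) auto
  qed
qed

text \<open>Hence the number of rule blocks before block j is \<open>j - Suc N\<close>, which is how
  the automaton will find the index one row earlier.\<close>

lemma KR_iff:
  assumes "i < length ks"
  shows "ks ! i = KR \<longleftrightarrow> Suc N \<le> i"
proof
  assume "ks ! i = KR"
  with assms show "Suc N \<le> i" by (cases rule: kind_cases) auto
next
  assume "Suc N \<le> i"
  then show "ks ! i = KR" using assms by (auto simp: ks_def nth_append base_def N_def)
qed

lemma val_at_in_cells: "val_at y j \<in> cells M"
proof (rule helix_in_cells[OF wf])
  show "set (row y) \<subseteq> cells M"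
    using cell_at_in_cells[OF config_ok_run[OF wf, of "pair_enc x y" 0]] by (auto simp: row_def tm_run_def)
qed

lemma val_at_run:
  assumes "length y \<le> B" "i \<le> N"
  shows "val_at y (t * N + i) = cell_at (tm_run M (pair_enc x y) t) (int i - int K)"
proof (rule helix_eq[where C = "\<lambda>t. cell_at (tm_run M (pair_enc x y) t)"])
  obtain s where s: "s \<le> D" "halted (tm_run M (pair_enc x y) s)" using halts assms(1) by blast
  have out: "cell_at (tm_run M (pair_enc x y) t) i = blank_cell"
    if "i < - int D \<or> i > int (2 * length x + 2 + length y) + int D" for t i
    using cell_at_run_outside_halted[OF wf s(2,1)] that by simp
  show "cell_at (tm_run M (pair_enc x y) t) (0 - int K) = blank_cell" for t
    using K by (intro out) auto
  show "cell_at (tm_run M (pair_enc x y) t) (1 - int K) = blank_cell" for t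
    using K by (intro out) auto
  \<comment> \<open>This column fixes the 3 in \<open>K\<close>: for a certificate of length
    \<open>B\<close>, K + B + 2|x| has to exceed 2|x| + 2 + B + D.\<close>
  show "cell_at (tm_run M (pair_enc x y) t) (int N - 1 - int K) = blank_cell" for t
    using K assms(1) by (intro out) (auto simp: N_def)
  show "cell_at (tm_run M (pair_enc x y) t) (int N - int K) = blank_cell" for t
    using K assms(1) by (intro out) (auto simp: N_def)
  show "row y ! i = cell_at (tm_run M (pair_enc x y) 0) (int i - int K)" if "i \<le> N" for i
    using that by (simp add: row_def tm_run_def del: upt_Suc)
qed (use cell_at_run_Suc[OF wf] N_ge assms(2) in auto)

lemma val_at_accepting:
  assumes "length y \<le> B"
  shows "(\<exists>j. Suc N \<le> j \<and> j < length ks \<and> snd (val_at y j) = Some 1) \<longleftrightarrow>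
    (\<exists>t. fst (tm_run M (pair_enc x y) t) = 1)" (is "?L \<longleftrightarrow> ?Rt")
proof
  assume ?L
  then obtain j where j: "snd (val_at y j) = Some 1" by blast
  \<comment> \<open>Every index lies in some row, and rows after halting still are rows of the
    run.\<close>
  have "j = (j div N) * N + j mod N" "j mod N \<le> N" using N_ge by (auto intro: less_imp_le)
  then have "val_at y j = cell_at (tm_run M (pair_enc x y) (j div N)) (int (j mod N) - int K)"
    using val_at_run[OF assms, of "j mod N" "j div N"] by simp
  then show ?Rt using j by (auto simp: cell_at_def split: if_splits)
next
  let ?c = "tm_run M (pair_enc x y)"
  assume ?Rt
  then obtain t where t: "fst (?c t) = 1" by blast
  obtain s where s: "s \<le> D" "halted (?c s)" using halts assms(1) by blast
  have "halted (?c t)" using t by (simp add: halted_def)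
  then have "?c (max s t) = ?c t" "?c (max s t) = ?c s" "?c D = ?c s"
    using run_halted[of M _ t "max s t"] run_halted[OF s(2), of "max s t"] run_halted[OF s(2) s(1)] by auto
  then have D: "fst (?c D) = 1" using t by simp
  \<comment> \<open>Acceptance is announced by rule blocks only, so the accepting row must not be
    row 0; the start state 0 is not accepting.\<close>
  have D0: "D \<noteq> 0"
  proof
    assume "D = 0"
    then show False using D by (simp add: tm_run_def tm_init_def)
  qed
  define p where "p = snd (snd (?c D))"
  have c: "snd (cell_at (?c D) p) = Some 1" using D by (simp add: cell_at_def p_def)
  then have "\<not> (p < - int D \<or> p > int (2 * length x + 2 + length y) + int D)"
    using cell_at_run_outside_halted[OF wf s(2,1), of p D] by auto
  then have p: "1 \<le> p + int K" "p + int K < int N" using K assms by (auto simp: N_def)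
  let ?i = "nat (p + int K)"
  have "val_at y (D * N + ?i) = cell_at (?c D) p"
    using val_at_run[OF assms, of ?i D] p by simp
  moreover have "Suc N \<le> D * N + ?i" using p D0 by (cases D) auto
  moreover have "D * N \<le> R" using R by (simp only: N_def)
  then have "D * N + ?i < length ks" using p length_ks by simp
  ultimately show ?L using c by metis
qed

section \<open>Soundness and completeness of the grammar\<close>

abbreviation "pval j \<equiv> prod_val j (j - Suc N)"

text \<open>At the first index behind the certificate both 1 and 2 are allowed: no clause uses them there.\<close>

definition "truth y j s \<longleftrightarrow> s = code (val_at y j) \<or>
  (s = 1 \<and> (\<exists>i. j = base + i \<and> (i < length y \<or> B \<le> i))) \<or>
  (s = 2 \<and> (\<exists>i. j = base + i \<and> (length y \<le> i \<or> B \<le> i))) \<or>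
  (s = 0 \<and> j = 0 \<and> (\<exists>j. Suc N \<le> j \<and> j < length ks \<and> snd (val_at y j) = Some 1))"

definition "true_names y = {num j s | j s. truth y j s}"

lemma in_true_names [simp]: "num j s \<in> true_names y \<longleftrightarrow> truth y j s"
  by (auto simp: true_names_def num_inj)

lemma truth_code [simp]: "truth y j (code c) \<longleftrightarrow> val_at y j = c"
  by (auto simp: truth_def code_inj code_neq)

lemma truth_alive: "truth y (base + i) (Suc 0) \<longleftrightarrow> i < length y \<or> B \<le> i"
  and truth_dead: "truth y (base + i) 2 \<longleftrightarrow> length y \<le> i \<or> B \<le> i"
  by (auto simp: truth_def)

lemma val_at_rule: "Suc N \<le> j \<Longrightarrow> val_at y j =
    local_step M (val_at y (j - Suc N)) (val_at y (j - Suc N + 1)) (val_at y (j - Suc N + 2))"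
  using N_ge by (subst helix.simps) simp

text \<open>A certificate is decoded from the chosen productions, and its set of true names is
  closed under all of them. Bits chosen behind the end of the certificate do no harm: their clauses
  have a false premise there.\<close>

lemma sound:
  assumes h: "\<And>j. j < length ks \<Longrightarrow> list_all2 (\<lambda>g q. q \<in> set g) (map (map (pval j)) (groups M cl (ks ! j))) (h j)"
    and d: "derives (set (concat (map h [0..<length ks]))) (num 0 0) []"
  shows "\<exists>y. length y \<le> B \<and> (\<exists>t. fst (tm_run M (pair_enc x y) t) = 1)"
proof -
  \<comment> \<open>Entry 1 is the continuation choice of a block. The choice about certificate
    position \<open>i\<close> is made in the block before it, hence the - 1.\<close>
  define e where "e i \<longleftrightarrow> fst (h (base + i - 1) ! 1) = num (base + i) 1" for i
  define bt where "bt i \<longleftrightarrow> fst (h (base + i) ! 0) = num (base + i) (code (2, None))" for i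
  \<comment> \<open>The certificate ends at the first refused continuation, at the latest at
    \<open>B\<close>.\<close>
  define l where "l = (LEAST i. i = B \<or> \<not> e i)"
  define y where "y = map bt [0..<l]"
  have l: "l = B \<or> \<not> e l" "\<And>i. \<not> e i \<Longrightarrow> l \<le> i" "l \<le> B"
    using LeastI[of "\<lambda>i. i = B \<or> \<not> e i" B] Least_le[of "\<lambda>i. i = B \<or> \<not> e i"] by (auto simp: l_def)
  have len: "length y = l" and y_nth: "\<And>i. i < l \<Longrightarrow> y ! i = bt i" by (auto simp: y_def)
  have yB: "length y \<le> B" using l len by simp
  have "num 0 0 \<in> true_names y"
  proof (rule derives_sound[OF _ d])
    fix A rhs
    assume "(A, rhs) \<in> set (concat (map h [0..<length ks]))" and rhs: "\<forall>B. NT B \<in> set rhs \<longrightarrow> B \<in> true_names y"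
    then obtain j where j: "j < length ks" "(A, rhs) \<in> set (h j)" by auto
    have hj: "list_all2 (\<lambda>g q. q \<in> set g) (map (map (pval j)) (groups M cl (ks ! j))) (h j)" using h j by simp
    show "A \<in> true_names y"
      using j(1)
    proof (cases rule: kind_cases)
      case (blank r)
      then show ?thesis using hj j(2) yB by (auto simp: fixed_def list_all2_Cons1)
    next
      case (bit hd b)
      then show ?thesis using hj j(2) yB by (auto simp: fixed_def list_all2_Cons1)
    next
      case last
      obtain q0 q1 where q: "h j = [q0, q1]" "q0 = (num j (code (1, None)), [])"
        "q1 = (num base 1, []) \<or> q1 = (num base 2, [])"
        using hj last(1,2) by (auto simp: fixed_def list_all2_Cons1)
      have "base - Suc 0 = j" using last(2) by simp
      then have e0: "e 0 \<longleftrightarrow> q1 = (num base 1, [])" using q by (auto simp: e_def num_inj)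
      consider "(A, rhs) = q0" | "(A, rhs) = q1" using j(2) q(1) by auto
      then show ?thesis
      proof cases
        case 1
        then show ?thesis using q(2) last(3)[OF yB] by simp
      next
        case 2
        then show ?thesis using q(3) e0 l len truth_alive[of y 0] truth_dead[of y 0] by (cases "e 0") auto
      qed
    next
      case (choice i)
      obtain q0 q1 q2 q3 where q: "h j = [q0, q1, q2, q3]"
        "q0 = (num j (code (1, None)), [NT (num j 1)]) \<or> q0 = (num j (code (2, None)), [NT (num j 1)])"
        "q1 = (num (Suc j) 1, [NT (num j 1)]) \<or> q1 = (num (Suc j) 2, [NT (num j 1)])"
        "q2 = (num (Suc j) 2, [NT (num j 2)])" "q3 = (num j (code (0, None)), [NT (num j 2)])"
        using hj choice(1) by (auto simp: fixed_def list_all2_Cons1)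
      have eS: "e (Suc i) \<longleftrightarrow> q1 = (num (Suc j) 1, [NT (num j 1)])"
        using q(1,3) choice(3) by (auto simp: e_def num_inj)
      have bi: "bt i \<longleftrightarrow> q0 = (num j (code (2, None)), [NT (num j 1)])"
        using q(1,2) choice(3) by (auto simp: bt_def num_inj code_inj)
      have val: "val_at y j = (if i < l then (bit_code (y ! i), None) else blank_cell)"
        using choice(4)[OF yB] len by simp
      have al: "truth y j 1 \<longleftrightarrow> i < l" "truth y j 2 \<longleftrightarrow> l \<le> i"
        using truth_alive[of y i] truth_dead[of y i] choice(2,3) len by auto
      have al': "truth y (Suc j) 1 \<longleftrightarrow> Suc i < l \<or> B \<le> Suc i" "truth y (Suc j) 2 \<longleftrightarrow> l \<le> Suc i \<or> B \<le> Suc i"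
        using truth_alive[of y "Suc i"] truth_dead[of y "Suc i"] choice(3) len by auto
      consider "(A, rhs) = q0" | "(A, rhs) = q1" | "(A, rhs) = q2" | "(A, rhs) = q3" using j(2) q(1) by auto
      then show ?thesis
      proof cases
        case 1
        then have il: "i < l" using rhs q(2) al(1) by auto
        have "A = num j (code (bit_code (bt i), None))"
          using 1 q(2) bi by (cases "bt i") (auto simp: bit_code_def)
        then show ?thesis using val y_nth[OF il] il by simp
      next
        case 2
        then have il: "i < l" using rhs q(3) al(1) by auto
        show ?thesis
        proof (cases "e (Suc i)")
          case True
          then have "A = num (Suc j) 1" using eS 2 by simp
          \<comment> \<open>\<open>l\<close> can equal \<open>Suc i\<close> despite the chosen
            continuation only if \<open>l = B\<close>, where both markers count as true.\<close>
          moreover have "Suc i < l \<or> B \<le> Suc i" using il l True by (cases "Suc i = l") auto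
          ultimately show ?thesis using al'(1) by simp
        next
          case False
          then have "A = num (Suc j) 2" using eS 2 q(3) by auto
          then show ?thesis using al'(2) l(2)[OF False] by simp
        qed
      next
        case 3
        then have "l \<le> i" using rhs q(4) al(2) by auto
        then show ?thesis using 3 q(4) al'(2) by simp
      next
        case 4
        then have "l \<le> i" using rhs q(5) al(2) by auto
        then show ?thesis using 4 q(5) val by simp
      qed
    next
      case rule
      have "\<exists>g \<in> set (rule_groups M cl). (A, rhs) \<in> set (map (pval j) g)"
        using hj j(2) rule(1) by (force simp: list_all2_conv_all_nth in_set_conv_nth[of "(A, rhs)"])
      then obtain g p where p: "(A, rhs) = pval j p" and gp: "g \<in> set (rule_groups M cl)" "p \<in> set g"
        by auto
      have p2: "(\<exists>a b c. p = (cell_name (local_step M a b c), [Rel True 0 (code a), Rel True 1 (code b), Rel True 2 (code c)]))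
         \<or> (\<exists>c. p = (Abs 0, [cell_name c]) \<and> snd c = Some 1)"
        using gp by (auto simp: rule_groups_def fixed_def code_inj simp del: split_paired_Ex)
      from p2 show ?thesis
      proof (elim disjE exE conjE)
        fix a b c assume pp: "p = (cell_name (local_step M a b c), [Rel True 0 (code a), Rel True 1 (code b), Rel True 2 (code c)])"
        then have "val_at y (j - Suc N) = a" "val_at y (j - Suc N + 1) = b" "val_at y (j - Suc N + 2) = c"
          using rhs p by auto
        then show ?thesis using val_at_rule[OF rule(2), of y] pp p by simp
      next
        fix c assume pp: "p = (Abs 0, [cell_name c])" "snd c = Some 1"
        then have "val_at y j = c" using rhs p by auto
        then have "truth y 0 0" using pp(2) rule(2) j(1) by (auto simp: truth_def)
        then show ?thesis using p pp(1) by (simp only: prod_val.simps prod.inject name_val.simps in_true_names)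
      qed
    qed
  qed
  then have "truth y 0 0" by simp
  then have "\<exists>j. Suc N \<le> j \<and> j < length ks \<and> snd (val_at y j) = Some 1"
    by (auto simp: truth_def)
  then show ?thesis using val_at_accepting[OF yB] yB by blast
qed

text \<open>The choices that encode \<open>y\<close>. Positions behind its end get default values,
  and a fixed group has equal members, so its head may be taken.\<close>

definition "pick y j = (if ks ! j = KE
    then map (pval j) [(cell_name (1, None), []), (Rel False 1 (if y = [] then 2 else 1), [])]
  else if ks ! j = KCh
    then map (pval j) [(cell_name (if j - base < length y \<and> y ! (j - base) then 2 else 1, None), [Rel False 0 1]),
      (Rel False 1 (if Suc (j - base) < length y then 1 else 2), [Rel False 0 1]),
      (Rel False 1 2, [Rel False 0 2]), (cell_name (0, None), [Rel False 0 2])]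
  else map (\<lambda>g. pval j (hd g)) (groups M cl (ks ! j)))"

lemma pick_ok: "list_all2 (\<lambda>g q. q \<in> set g) (map (map (pval j)) (groups M cl (ks ! j))) (pick y j)"
proof -
  have "pval j (hd g) \<in> pval j ` set g" if "g \<in> set (groups M cl k)" for g k
    using length_group[OF that] by (cases g) auto
  then show ?thesis
    by (auto simp: pick_def fixed_def list_all2_map1 list_all2_map2 list.rel_refl_strong)
qed

text \<open>The markers are derived along the certificate (\<open>alive\<close>), then all cells
  along the helix (\<open>val\<close>), where every premise of a rule has a smaller index.\<close>

lemma complete:
  assumes yB: "length y \<le> B" and acc: "fst (tm_run M (pair_enc x y) t) = 1"
  shows "derives (set (concat (map (pick y) [0..<length ks]))) (num 0 0) []" (is "derives ?P _ _")
proof -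
  have use: "derives ?P A []" if "j < length ks" "(A, map NT bs) \<in> set (pick y j)" "\<And>B. B \<in> set bs \<Longrightarrow> derives ?P B []" for j A bs
    using that by (intro derives_Nil[of A bs]) auto
  have alive: "i \<le> B \<Longrightarrow> derives ?P (num (base + i) (if i < length y then 1 else 2)) []" for i
  proof (induction i)
    case 0
    have j: "K + (2 * length x + 1) < length ks" using length_ks by (simp add: N_def)
    have k: "ks ! (K + (2 * length x + 1)) = KE" using nth_kbits_end[of True x] by (simp add: ks_def nth_append)
    have "Suc (K + (2 * length x + 1)) = base" by (simp add: base_def)
    then show ?case using use[OF j, of _ "[]"] k by (auto simp: pick_def)
  next
    case (Suc i)
    then have i: "i < B" by simp
    then have j: "base + i < length ks" using length_ks by (simp add: N_def base_def)
    have k: "ks ! (base + i) = KCh" using i by (auto simp: ks_def nth_append base_def)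
    show ?case
    proof (cases "i < length y")
      case True
      then show ?thesis
        using use[OF j, of "num (base + Suc i) (if Suc i < length y then 1 else 2)" "[num (base + i) 1]"] k Suc
        by (simp add: pick_def)
    next
      case False
      then show ?thesis
        using use[OF j, of "num (base + Suc i) 2" "[num (base + i) 2]"] k Suc
        by (simp add: pick_def)
    qed
  qed
  have val: "j < length ks \<Longrightarrow> derives ?P (num j (code (val_at y j))) []" for j
  proof (induction j rule: less_induct)
    case (less j)
    show ?case
      using less.prems
    proof (cases rule: kind_cases)
      case (blank r)
      then show ?thesis using use[OF less.prems, of _ "[]"] yB by (simp add: pick_def fixed_def)
    next
      case (bit h b)
      then show ?thesis using use[OF less.prems, of _ "[]"] yB by (simp add: pick_def fixed_def)
    next
      case last
      then show ?thesis using use[OF less.prems, of _ "[]"] yB by (simp add: pick_def)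
    next
      case (choice i)
      have al: "derives ?P (num j (if i < length y then 1 else 2)) []" using alive[of i] choice(2,3) by simp
      show ?thesis
      proof (cases "i < length y")
        case True
        have "derives ?P (num j (code (bit_code (y ! i), None))) []"
          using use[OF less.prems, of _ "[num j 1]"] al True choice(1,3)
          by (simp add: pick_def bit_code_def)
        then show ?thesis using choice(4)[OF yB] True by simp
      next
        case False
        have "derives ?P (num j (code (0, None))) []"
          using use[OF less.prems, of _ "[num j 2]"] al False choice(1,3)
          by (simp add: pick_def)
        then show ?thesis using choice(4)[OF yB] False by simp
      qed
    next
      case rule
      let ?a = "val_at y (j - Suc N)" and ?b = "val_at y (j - Suc N + 1)" and ?c = "val_at y (j - Suc N + 2)"
      have "?a \<in> set cl" "?b \<in> set cl" "?c \<in> set cl" using val_at_in_cells cl by auto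
      then have g: "fixed (cell_name (local_step M ?a ?b ?c), [Rel True 0 (code ?a), Rel True 1 (code ?b), Rel True 2 (code ?c)])
        \<in> set (groups M cl (ks ! j))"
        using rule(1) by (auto simp: rule_groups_def)
      let ?p = "pval j (cell_name (local_step M ?a ?b ?c), [Rel True 0 (code ?a), Rel True 1 (code ?b), Rel True 2 (code ?c)])"
      have "?p \<in> set (pick y j)"
        using imageI[OF g, of "\<lambda>g. pval j (hd g)"] rule(1) by (simp add: pick_def fixed_def)
      moreover have "derives ?P B []"
        if "B \<in> {num (j - Suc N) (code ?a), num (j - Suc N + 1) (code ?b), num (j - Suc N + 2) (code ?c)}" for B
        using that less rule(2) N_ge by auto
      ultimately show ?thesis
        using use[OF less.prems, of _ "[num (j - Suc N) (code ?a), num (j - Suc N + 1) (code ?b), num (j - Suc N + 2) (code ?c)]"]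
          val_at_rule[OF rule(2), of y] by simp
    qed
  qed
  obtain j where j: "Suc N \<le> j" "j < length ks" "snd (val_at y j) = Some 1"
    using val_at_accepting[OF yB] acc by blast
  have k: "ks ! j = KR" using j(1,2) by (auto simp: ks_def nth_append base_def N_def)
  have "val_at y j \<in> set cl" using val_at_in_cells cl by simp
  then have g: "fixed (Abs 0, [cell_name (val_at y j)]) \<in> set (groups M cl (ks ! j))"
    using k j(3) by (auto simp: rule_groups_def)
  have "pval j (Abs 0, [cell_name (val_at y j)]) \<in> set (pick y j)"
    using imageI[OF g, of "\<lambda>g. pval j (hd g)"] k by (simp add: pick_def fixed_def)
  then show ?thesis using use[OF j(2), of _ "[num j (code (val_at y j))]"] val[OF j(2)] by simp
qed

theorem ex_consistent_grammar:
  "(\<exists>p. consistent_setting (grammar M cl (Suc N) ks) [[]] p) \<longleftrightarrow>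
    (\<exists>y. length y \<le> B \<and> (\<exists>t. fst (tm_run M (pair_enc x y) t) = 1))"
proof -
  let ?Pi = "concat (map (\<lambda>j. map (map (pval j)) (groups M cl (ks ! j))) [0..<length ks])"
  have "(\<exists>p. consistent_setting (grammar M cl (Suc N) ks) [[]] p) \<longleftrightarrow>
    (\<exists>ps. list_all2 (\<lambda>g q. q \<in> set g) ?Pi ps \<and> derives (set ps) (num 0 0) [])"
    unfolding grammar_def by (rule ex_consistent_iff) (auto simp: length_group)
  also have "\<dots> \<longleftrightarrow> (\<exists>h. (\<forall>j \<in> set [0..<length ks].
      list_all2 (\<lambda>g q. q \<in> set g) (map (map (pval j)) (groups M cl (ks ! j))) (h j)) \<and>
      derives (set (concat (map h [0..<length ks]))) (num 0 0) [])"
    unfolding list_all2_concat_map[OF distinct_upt] by blast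
  also have "\<dots> \<longleftrightarrow> (\<exists>y. length y \<le> B \<and> (\<exists>t. fst (tm_run M (pair_enc x y) t) = 1))"
  proof (intro iffI)
    assume "\<exists>h. (\<forall>j \<in> set [0..<length ks].
      list_all2 (\<lambda>g q. q \<in> set g) (map (map (pval j)) (groups M cl (ks ! j))) (h j)) \<and>
      derives (set (concat (map h [0..<length ks]))) (num 0 0) []"
    then obtain h where h: "\<forall>j \<in> set [0..<length ks].
      list_all2 (\<lambda>g q. q \<in> set g) (map (map (pval j)) (groups M cl (ks ! j))) (h j)"
      and d: "derives (set (concat (map h [0..<length ks]))) (num 0 0) []" by blast
    show "\<exists>y. length y \<le> B \<and> (\<exists>t. fst (tm_run M (pair_enc x y) t) = 1)"
      by (rule sound[OF _ d]) (use h in auto)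
  next
    assume "\<exists>y. length y \<le> B \<and> (\<exists>t. fst (tm_run M (pair_enc x y) t) = 1)"
    then obtain y t where "length y \<le> B" "fst (tm_run M (pair_enc x y) t) = 1" by blast
    from complete[OF this] pick_ok
    show "\<exists>h. (\<forall>j \<in> set [0..<length ks].
      list_all2 (\<lambda>g q. q \<in> set g) (map (map (pval j)) (groups M cl (ks ! j))) (h j)) \<and>
      derives (set (concat (map h [0..<length ks]))) (num 0 0) []" by (intro exI[of _ "pick y"]) auto
  qed
  finally show ?thesis .
qed

end

section \<open>A queue automaton that writes the grammar and runs the learner\<close>

text \<open>Queue symbols. \<open>AU\<close> / \<open>AF\<close> are unmarked / marked copies of the input letters, used as a loop counter;
  \<open>PU\<close> and its offspring \<open>PQ\<close> count in unary; \<open>FU\<close> / \<open>FF\<close> end an open / finished block; \<open>Nm c r\<close> marks the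
  place in a name where index digits are inserted; the number in \<open>Tk\<close> and \<open>Nm\<close> is the part of the output
  (0 to 4) the token belongs to. The flag of \<open>Lc\<close> marks the origin of the learner's tape.\<close>

datatype asym = Bt bool | Hash | AU | AF | PU | PQ | Mac kind | FU bool | FF
  | Tk nat tok | Nm nat bool | Lc bool cell

text \<open>\<open>Srt\<close> knows which of the two sorts is running, the symbol in hand and
  whether a swap occurred; \<open>Lrn\<close> holds the last two cells read, the origin flag of the
  later one, whether a halting head was seen, and whether the origin shows bit True.\<close>

datatype pst = Start bool | Mul nat bool | Conv nat | Srt bool "asym option" bool | Exp
  | Inc "bool option" | Fin bool | Lrn cell bool cell bool bool | Acc | Rej

section \<open>Sweeps as transductions, and bounded reachability\<close>

fun scan :: "('s \<Rightarrow> 'a \<Rightarrow> 's \<times> 'a list) \<Rightarrow> 's \<Rightarrow> 'a list \<Rightarrow> 's \<times> 'a list" where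
  "scan f q [] = (q, [])"
| "scan f q (a # w) = (fst (scan f (fst (f q a)) w), snd (f q a) @ snd (scan f (fst (f q a)) w))"

lemma scan_append:
  "scan f q (u @ v) = (fst (scan f (fst (scan f q u)) v), snd (scan f q u) @ snd (scan f (fst (scan f q u)) v))"
  by (induction u arbitrary: q) auto

lemma scan_hom: "(\<And>a. a \<in> set w \<Longrightarrow> f q a = (q, g a)) \<Longrightarrow> scan f q w = (q, concat (map g w))"
  by (induction w) auto

text \<open>Output collects behind the unread rest, so consuming \<open>w\<close> leaves the
  transduction of \<open>w\<close> at the back.\<close>

lemma qstep_scan: "(qstep f ^^ length w) (q, w @ r) = (fst (scan f q w), r @ snd (scan f q w))"
proof (induction w arbitrary: q r)
  case (Cons a w)
  then show ?case using Cons[of "fst (f q a)" "r @ snd (f q a)"]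
    by (simp only: list.size funpow_Suc_right o_def append_Cons qstep.simps scan.simps add_Suc_right
        add_0_right append_assoc fst_conv snd_conv)
qed simp

definition reach :: "('s \<Rightarrow> 'a \<Rightarrow> 's \<times> 'a list) \<Rightarrow> nat \<Rightarrow> 's \<times> 'a list \<Rightarrow> 's \<times> 'a list \<Rightarrow> bool" where
  "reach f B s s' \<longleftrightarrow> (\<exists>k \<le> B. (qstep f ^^ k) s = s')"

lemma reach_trans: "reach f B s s' \<Longrightarrow> reach f B' s' s'' \<Longrightarrow> reach f (B + B') s s''"
  unfolding reach_def by (metis add.commute add_mono funpow_trans)

lemma reach_mono: "reach f B s s' \<Longrightarrow> B \<le> B' \<Longrightarrow> reach f B' s s'"
  unfolding reach_def by (metis le_trans)

lemma reach_scan: "scan f q w = (q', v) \<Longrightarrow> length w \<le> B \<Longrightarrow> reach f B (q, w) (q', v)"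
  using qstep_scan[where f = f and w = w and q = q and r = "[]"] unfolding reach_def by auto

lemma reach_loop: "(\<And>i. i < m \<Longrightarrow> reach f B (g i) (g (Suc i))) \<Longrightarrow> reach f (m * B) (g 0) (g m)"
proof (induction m)
  case 0
  then show ?case unfolding reach_def by (intro exI[of _ 0]) simp
next
  case (Suc m)
  then have "reach f (m * B) (g 0) (g m)" "reach f B (g m) (g (Suc m))" by auto
  from reach_trans[OF this] show ?case by (simp add: add.commute)
qed

text \<open>For block symbols the key is the place in the block sequence, for text symbols the part
  of the output. \<open>FF\<close> yields no token, so its key is free; 5 is for symbols that are
  gone when sorting starts.\<close>

fun key :: "asym \<Rightarrow> nat" where
  "key (Tk c t) = c"
| "key (Nm c r) = c"
| "key (Mac (KB r)) = (if r then 3 else 0)"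
| "key (Mac (KI h b)) = 1"
| "key (Mac KE) = 1"
| "key (Mac KCh) = 2"
| "key (Mac KR) = 4"
| "key FF = 0"
| "key (FU r) = 0"
| "key _ = 5"

text \<open>\<open>Nm\<close> stands before the run of 1s and later disappears. Absolute names have
  no \<open>Nm\<close> and are therefore never shifted.\<close>

fun en_sname :: "nat \<Rightarrow> sname \<Rightarrow> asym list" where
  "en_sname c (Rel r off s) =
     [Tk c LB, Nm c r] @ replicate off (Tk c B1) @ replicate (Suc s) (Tk c B0) @ [Tk c B1, Tk c RB]"
| "en_sname c (Abs s) = [Tk c LB] @ replicate (Suc s) (Tk c B0) @ [Tk c B1, Tk c RB]"

fun en_sprod :: "nat \<Rightarrow> sprod \<Rightarrow> asym list" where
  "en_sprod c (h, bs) = [Tk c LB] @ en_sname c h @ [Tk c LB] @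
     concat (map (\<lambda>s. [Tk c LB, Tk c B0] @ en_sname c s @ [Tk c RB]) bs) @ [Tk c RB, Tk c RB]"

definition en_group :: "nat \<Rightarrow> sprod list \<Rightarrow> asym list" where
  "en_group c g = [Tk c LB] @ concat (map (en_sprod c) g) @ [Tk c RB]"

text \<open>Everything the blocks do not supply: part 0 opens the instance and lists the start
  symbol, part 2 closes V, gives the empty terminal list and opens the groups, part 4 closes them
  and adds the start symbol and the one empty word.\<close>

definition frame :: "asym list" where
  "frame = map (Tk 0) (LB # LB # LB # en_nat (num 0 0)) @ map (Tk 2) [RB, LB, RB, LB] @
     map (Tk 4) (RB # en_nat (num 0 0) @ [RB, LB, LB, RB, RB, RB])"

fun ins :: "nat \<Rightarrow> nat \<Rightarrow> asym \<Rightarrow> asym list" where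
  "ins a b (Nm c r) = Nm c r # replicate (if r then b else a) (Tk c B1)"
| "ins a b s = [s]"

definition inst :: "nat \<Rightarrow> nat \<Rightarrow> asym list \<Rightarrow> asym list" where
  "inst a b w = concat (map (ins a b) w)"

lemma inst_append [simp]: "inst a b (u @ v) = inst a b u @ inst a b v" by (simp add: inst_def)
lemma inst_Cons [simp]: "inst a b (s # v) = ins a b s @ inst a b v" by (simp add: inst_def)
lemma inst_Nil [simp]: "inst a b [] = []" by (simp add: inst_def)

fun tok_of :: "asym \<Rightarrow> tok list" where
  "tok_of (Tk c t) = [t]"
| "tok_of _ = []"

definition all_toks :: "asym list \<Rightarrow> tok list" where "all_toks w = concat (map tok_of w)"
definition toks :: "nat \<Rightarrow> asym list \<Rightarrow> tok list" where
  "toks c w = all_toks (filter (\<lambda>s. key s = c) w)"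

lemma toks_append [simp]: "toks c (u @ v) = toks c u @ toks c v" by (simp add: toks_def all_toks_def)
lemma toks_Nil [simp]: "toks c [] = []" by (simp add: toks_def all_toks_def)
lemma toks_Cons: "toks c (s # v) = (if key s = c then tok_of s else []) @ toks c v"
  by (simp add: toks_def all_toks_def)
lemma toks_concat: "toks c (concat ws) = concat (map (toks c) ws)" by (induction ws) auto
lemma inst_concat: "inst a b (concat ws) = concat (map (inst a b) ws)" by (induction ws) auto
lemma toks_replicate [simp]: "toks d (replicate k (Tk c t)) = (if d = c then replicate k t else [])"
  by (induction k) (auto simp: toks_Cons)
lemma toks_map_Tk [simp]: "toks d (map (Tk c) ts) = (if d = c then ts else [])"
  by (induction ts) (auto simp: toks_Cons)
lemma inst_replicate [simp]: "inst a b (replicate k (Tk c t)) = replicate k (Tk c t)"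
  by (induction k) auto

lemma toks_en_sname: "toks d (inst a b (en_sname c nm)) = (if d = c then en_nat (name_val a b nm) else [])"
proof (cases nm)
  case (Rel r off s)
  then show ?thesis
    by (auto simp: toks_Cons en_nat_def bin_num replicate_add)
next
  case (Abs s)
  then show ?thesis by (auto simp: toks_Cons en_nat_def bin_num)
qed

lemma toks_en_sprod: "toks d (inst a b (en_sprod c p)) = (if d = c then en_prod (prod_val a b p) else [])"
  by (cases p) (auto simp: toks_Cons toks_en_sname toks_concat inst_concat o_def en_list_def)

lemma toks_en_group: "toks d (inst a b (en_group c g)) = (if d = c then en_list en_prod (map (prod_val a b) g) else [])"
  by (auto simp: en_group_def toks_Cons toks_en_sprod toks_concat inst_concat o_def en_list_def)

section \<open>Stable sorting by key\<close>

definition sort_keys :: "asym list \<Rightarrow> asym list" where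
  "sort_keys w = concat (map (\<lambda>k. filter (\<lambda>s. key s = k) w) [0..<5])"

lemma all_toks_sort_keys: "all_toks (sort_keys w) = concat (map (\<lambda>c. toks c w) [0..<5])"
proof -
  have "all_toks (concat ws) = concat (map all_toks ws)" for ws by (induction ws) (auto simp: all_toks_def)
  then show ?thesis by (simp add: sort_keys_def toks_def o_def)
qed

text \<open>One sweep of bubble sort is a transduction with one symbol of memory.\<close>

fun bubble :: "asym \<Rightarrow> asym list \<Rightarrow> asym list" where
  "bubble a [] = [a]"
| "bubble a (b # w) = (if key a \<le> key b then a # bubble b w else b # bubble a w)"

fun swaps :: "asym \<Rightarrow> asym list \<Rightarrow> bool" where
  "swaps a [] = False"
| "swaps a (b # w) = (if key a \<le> key b then swaps b w else True)"

fun inversions :: "asym list \<Rightarrow> nat" where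
  "inversions [] = 0"
| "inversions (a # w) = length (filter (\<lambda>b. key b < key a) w) + inversions w"

lemma filter_bubble: "filter (\<lambda>s. key s = k) (bubble a w) = filter (\<lambda>s. key s = k) (a # w)"
  by (induction a w rule: bubble.induct) auto

lemma length_filter_bubble: "length (filter P (bubble a w)) = length (filter P (a # w))"
  by (induction a w rule: bubble.induct) auto

lemma inversions_bubble: "inversions (bubble a w) \<le> inversions (a # w)"
  by (induction a w rule: bubble.induct) (auto simp: length_filter_bubble)

text \<open>Inversions are the termination measure: each sweep that swaps removes at least one, so
  quadratically many sweeps suffice.\<close>

lemma inversions_bubble_less: "swaps a w \<Longrightarrow> inversions (bubble a w) < inversions (a # w)"
proof (induction a w rule: bubble.induct)
  case (2 a b w)
  then show ?case using inversions_bubble[of a w] by (auto simp: length_filter_bubble)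
qed auto

lemma bubble_no_swap: "\<not> swaps a w \<Longrightarrow> bubble a w = a # w \<and> sorted (map key (a # w))"
  by (induction a w rule: bubble.induct) (auto split: if_splits)

lemma inversions_le: "inversions w \<le> length w * length w"
proof (induction w)
  case (Cons a w)
  have "inversions (a # w) \<le> length w + length w * length w"
    unfolding inversions.simps by (rule add_mono[OF length_filter_le Cons.IH])
  then show ?case by simp
qed simp

lemma sort_keys_bubble: "sort_keys (bubble a w) = sort_keys (a # w)"
  by (simp only: sort_keys_def filter_bubble)

lemma sort_keys_sorted:
  assumes "sorted (map key w)" "\<forall>s \<in> set w. key s < 5"
  shows "sort_keys w = w"
proof -
  have "concat (map (\<lambda>k. filter (\<lambda>s. key s = k) w) [0..<n]) = filter (\<lambda>s. key s < n) w" for n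
  proof (induction n)
    case (Suc n)
    have "filter (\<lambda>s. key s < n) w @ filter (\<lambda>s. key s = n) w = filter (\<lambda>s. key s < Suc n) w"
      using assms(1)
    proof (induction w)
      case (Cons a w)
      show ?case
      proof (cases "key a < n")
        case False
        then have "filter (\<lambda>s. key s < n) w = []" using Cons.prems by (auto simp: filter_empty_conv)
        then show ?thesis using False Cons by auto
      qed (use Cons in auto)
    qed simp
    then show ?case using Suc by simp
  qed simp
  then show ?thesis using assms(2) by (simp add: sort_keys_def filter_id_conv)
qed

lemma length_sort_keys: "\<forall>s \<in> set w. key s < 5 \<Longrightarrow> length (sort_keys w) = length w"
proof (induction w)
  case (Cons a w)
  have "key a \<in> {0, 1, 2, 3, 4}" using Cons.prems by auto
  then show ?case using Cons by (auto simp: sort_keys_def numeral_eq_Suc)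
qed (simp add: sort_keys_def)

text \<open>The flag says that nothing has been written yet: the first cell then receives the head
  in state 0 and the origin mark.\<close>

definition start_cells :: "bool \<Rightarrow> bool list \<Rightarrow> asym list" where
  "start_cells f bs = (case bs of [] \<Rightarrow> [] | b # bs' \<Rightarrow>
     Lc f (bit_code b, if f then Some 0 else None) # map (\<lambda>b. Lc False (bit_code b, None)) bs')"

text \<open>\<open>M\<close> is the verifier and \<open>M'\<close> the learner. With n the input
  length, \<open>c1 * (n + 1) ^ k1\<close> choice blocks, \<open>c2 * (n + 1) ^ k2\<close> blanks on
  each side and \<open>c3 * (n + 1) ^ k3\<close> rule blocks are produced; \<open>k3\<close> is the
  last level.\<close>

locale learner_reduction =
  fixes M :: tm and cl :: "cell list" and M' :: tm and k1 c1 k2 c2 k3 c3 :: nat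
  assumes wf': "wf_tm M'" and k: "k1 \<le> k3" "k2 \<le> k3" "0 < k3"
begin

text \<open>Level i is reached after i multiplications of the number of \<open>PU\<close> by n + 1, so symbols emitted there
  occur a multiple of (n + 1) ^ i times.\<close>

definition emit :: "nat \<Rightarrow> asym list" where
  "emit i = (if i = k1 then replicate c1 (Mac KCh) else []) @
     (if i = k2 then replicate c2 (Mac (KB False)) @ replicate c2 (Mac (KB True)) else []) @
     (if i = k3 then replicate c3 (Mac KR) else [PU])"

text \<open>One pass over a block yields both its entries in V (part 1) and its groups (part 3); the
  second sort separates them.\<close>

definition body :: "kind \<Rightarrow> asym list" where
  "body kd = concat (map (en_sname 1) (group_names (groups M cl kd))) @ concat (map (en_group 3) (groups M cl kd))"

text \<open>The end marker comes last, so the sweep that finishes a block leaves the names of that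
  block alone and shifts those behind it.\<close>

definition template :: "kind \<Rightarrow> asym list" where
  "template kd = body kd @ [FU (kd = KR)]"

definition nx_start :: "bool \<Rightarrow> asym \<Rightarrow> pst \<times> asym list" where
  "nx_start f s = (case s of
     Bt b \<Rightarrow> (Start False, [Mac (KI f True), Mac (KI False b), AU])
   | Hash \<Rightarrow> (Mul 0 False, [Mac (KI f False), Mac KE] @ emit 0 @ [Hash])
   | _ \<Rightarrow> (Start f, []))"

text \<open>Each sweep marks one counter and adds one \<open>PQ\<close> behind every
  \<open>PU\<close>. The sweep that finds no unmarked counter adds one too, which makes the factor n
  + 1 rather than n.\<close>

definition nx_mul :: "nat \<Rightarrow> bool \<Rightarrow> asym \<Rightarrow> pst \<times> asym list" where
  "nx_mul i b s = (case s of
     AU \<Rightarrow> (Mul i True, [if b then AU else AF])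
   | PU \<Rightarrow> (Mul i b, [PU, PQ])
   | Hash \<Rightarrow> (if b then Mul i False else Conv (Suc i), [Hash])
   | _ \<Rightarrow> (Mul i b, [s]))"

definition nx_conv :: "nat \<Rightarrow> asym \<Rightarrow> pst \<times> asym list" where
  "nx_conv i s = (case s of
     AF \<Rightarrow> (Conv i, if i < k3 then [AU] else [])
   | PU \<Rightarrow> (Conv i, [])
   | PQ \<Rightarrow> (Conv i, emit i)
   | Hash \<Rightarrow> (if i < k3 then Mul i False else Srt False None False, [Hash])
   | _ \<Rightarrow> (Conv i, [s]))"

definition nx_sort :: "bool \<Rightarrow> asym option \<Rightarrow> bool \<Rightarrow> asym \<Rightarrow> pst \<times> asym list" where
  "nx_sort g m sw s = (if s = Hash
     then (if sw then Srt g None False else if g then Fin True else Exp, (case m of None \<Rightarrow> [] | Some a \<Rightarrow> [a]) @ [Hash])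
     else (case m of None \<Rightarrow> (Srt g (Some s) sw, [])
       | Some a \<Rightarrow> if key a \<le> key s then (Srt g (Some s) sw, [a]) else (Srt g (Some a) True, [s])))"

definition nx_expand :: "asym \<Rightarrow> pst \<times> asym list" where
  "nx_expand s = (case s of
     Mac kd \<Rightarrow> (Exp, template kd)
   | Hash \<Rightarrow> (Inc None, frame @ [Hash])
   | _ \<Rightarrow> (Exp, []))"

text \<open>The memory is \<open>None\<close> until the first open block ends, then tells whether
  that was a rule block. A sweep that meets no open block leads on to the second sort.\<close>

definition nx_inc :: "bool option \<Rightarrow> asym \<Rightarrow> pst \<times> asym list" where
  "nx_inc m s = (case s of
     FU r \<Rightarrow> if m = None then (Inc (Some r), [FF]) else (Inc m, [FU r])
   | Nm c r \<Rightarrow> (Inc m, if m = None \<or> r \<and> m = Some False then [Nm c r] else [Nm c r, Tk c B1])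
   | Hash \<Rightarrow> (if m = None then Srt True None False else Inc None, [Hash])
   | _ \<Rightarrow> (Inc m, [s]))"

definition nx_fin :: "bool \<Rightarrow> asym \<Rightarrow> pst \<times> asym list" where
  "nx_fin f s = (case s of
     Tk c t \<Rightarrow> (Fin False, start_cells f (tok_bits t))
   | Hash \<Rightarrow> (Lrn blank_cell False blank_cell False False, [Lc False blank_cell, Hash])
   | _ \<Rightarrow> (Fin f, []))"

text \<open>The written cell lags one behind the cell read, because its right neighbour must be
  known. Two further cells are written at \<open>Hash\<close>, so each sweep extends the window by
  one cell on either side.\<close>

definition nx_learn :: "cell \<Rightarrow> bool \<Rightarrow> cell \<Rightarrow> bool \<Rightarrow> bool \<Rightarrow> asym \<Rightarrow> pst \<times> asym list" where
  "nx_learn a ob b h r s = (case s of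
     Lc oc c \<Rightarrow> (Lrn b oc c (h \<or> snd c = Some 1 \<or> snd c = Some 2) (r \<or> oc \<and> fst c = 2), [Lc ob (local_step M' a b c)])
   | Hash \<Rightarrow> (if h then (if r then Acc else Rej, [Hash])
       else (Lrn blank_cell False blank_cell False False,
         [Lc ob (local_step M' a b blank_cell), Lc False (local_step M' b blank_cell blank_cell), Hash]))
   | _ \<Rightarrow> (Lrn a ob b h r, []))"

fun nx :: "pst \<Rightarrow> asym \<Rightarrow> pst \<times> asym list" where
  "nx (Start f) s = nx_start f s"
| "nx (Mul i b) s = nx_mul i b s"
| "nx (Conv i) s = nx_conv i s"
| "nx (Srt g m sw) s = nx_sort g m sw s"
| "nx Exp s = nx_expand s"
| "nx (Inc m) s = nx_inc m s"
| "nx (Fin f) s = nx_fin f s"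
| "nx (Lrn a ob b h r) s = nx_learn a ob b h r s"
| "nx Acc s = (Acc, [])"
| "nx Rej s = (Rej, [])"

definition syms :: "asym set" where
  "syms = {Hash, AU, AF, PU, PQ, FF} \<union> range Bt \<union> range Mac \<union> range FU
    \<union> (\<lambda>(c, t). Tk c t) ` ({..<5} \<times> UNIV) \<union> (\<lambda>(c, r). Nm c r) ` ({..<5} \<times> UNIV)
    \<union> (\<lambda>(f, c). Lc f c) ` (UNIV \<times> cells M')"

definition states :: "pst set" where
  "states = {Exp, Acc, Rej} \<union> range Start \<union> (\<lambda>(i, b). Mul i b) ` ({..<k3} \<times> UNIV) \<union> Conv ` {..k3}
    \<union> (\<lambda>(g, m, sw). Srt g m sw) ` (UNIV \<times> insert None (Some ` syms) \<times> UNIV)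
    \<union> range Inc \<union> range Fin
    \<union> (\<lambda>(a, ob, b, h, r). Lrn a ob b h r) ` (cells M' \<times> UNIV \<times> cells M' \<times> UNIV \<times> UNIV)"

lemma in_syms [simp]:
  "Hash \<in> syms" "AU \<in> syms" "AF \<in> syms" "PU \<in> syms" "PQ \<in> syms" "FF \<in> syms" "Bt b \<in> syms"
  "Mac kd \<in> syms" "FU b \<in> syms" "Tk c t \<in> syms \<longleftrightarrow> c < 5" "Nm c b \<in> syms \<longleftrightarrow> c < 5"
  "Lc b d \<in> syms \<longleftrightarrow> d \<in> cells M'"
  by (auto simp: syms_def)

lemma in_states [simp]:
  "Exp \<in> states" "Acc \<in> states" "Rej \<in> states" "Start f \<in> states" "Mul i b \<in> states \<longleftrightarrow> i < k3"
  "Conv i \<in> states \<longleftrightarrow> i \<le> k3" "Srt g m sw \<in> states \<longleftrightarrow> m \<in> insert None (Some ` syms)"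
  "Inc m' \<in> states" "Fin f \<in> states"
  "Lrn c ob d h r \<in> states \<longleftrightarrow> c \<in> cells M' \<and> d \<in> cells M'"
  by (auto simp: states_def image_iff)

lemma finite_kinds: "finite (UNIV :: kind set)"
proof -
  have "(UNIV :: kind set) = range (\<lambda>(h, b). KI h b) \<union> {KE, KCh, KR} \<union> range KB"
    by (auto simp: image_iff) (metis kind.exhaust)
  then show ?thesis by (metis finite.emptyI finite.insertI finite_UnI finite_imageI finite_class.finite_UNIV)
qed

lemma finite_syms: "finite syms"
proof -
  note finite_kinds
  moreover have "(UNIV :: tok set) = {B0, B1, LB, RB}"
    by (auto intro: tok.exhaust)
  then have "finite (UNIV :: tok set)" by (metis finite.emptyI finite.insertI)
  ultimately show ?thesis using finite_cells by (simp add: syms_def)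
qed

lemma finite_states: "finite states"
  using finite_syms finite_cells by (simp add: states_def)

lemma en_sname_syms: "c < 5 \<Longrightarrow> set (en_sname c nm) \<subseteq> syms"
  by (cases nm) (auto simp: set_replicate_conv_if)

lemma en_sprod_syms: "c < 5 \<Longrightarrow> set (en_sprod c p) \<subseteq> syms"
  by (cases p) (auto dest: subsetD[OF en_sname_syms])

lemma template_syms: "set (template kd) \<subseteq> syms"
  by (auto simp: template_def body_def en_group_def dest: subsetD[OF en_sname_syms, rotated] subsetD[OF en_sprod_syms, rotated])

lemma frame_syms: "set frame \<subseteq> syms" by (auto simp: frame_def)

lemma emit_syms: "set (emit i) \<subseteq> syms" by (auto simp: emit_def)

lemma start_cells_syms: "set (start_cells f bs) \<subseteq> syms"
proof -
  have "3 \<le> fst M'" "3 \<le> fst (snd M')" using wf' by (auto simp: wf_tm_def split: prod.splits)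
  moreover from this have "bit_code b < fst (snd M')" for b by (simp add: bit_code_def)
  ultimately show ?thesis by (auto simp: start_cells_def in_cells_iff split: list.splits)
qed

lemma nx_closed:
  assumes "q \<in> states" "s \<in> syms"
  shows "fst (nx q s) \<in> states \<and> set (snd (nx q s)) \<subseteq> syms"
proof (cases q)
  case (Start f)
  then show ?thesis using assms k emit_syms[of 0] by (cases s) (auto simp: nx_start_def)
next
  case (Mul i b)
  then show ?thesis using assms by (cases s) (auto simp: nx_mul_def)
next
  case (Conv i)
  then show ?thesis using assms emit_syms[of i] by (cases s) (auto simp: nx_conv_def)
next
  case (Srt g m sw)
  then show ?thesis using assms by (auto simp: nx_sort_def split: option.splits)
next
  case Exp
  then show ?thesis using assms template_syms frame_syms by (cases s) (auto simp: nx_expand_def)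
next
  case (Inc m)
  then show ?thesis using assms by (cases s) (auto simp: nx_inc_def)
next
  case (Fin f)
  then show ?thesis using assms start_cells_syms[of f] blank_in_cells[OF wf']
    by (cases s) (auto simp: nx_fin_def)
next
  case (Lrn a ob b h r)
  then show ?thesis using assms blank_in_cells[OF wf'] local_step_in_cells[OF wf']
    by (cases s) (auto simp: nx_learn_def)
qed auto

sublocale queue_automaton nx states syms "Start True" Acc Rej Bt Hash
  using finite_states finite_syms nx_closed by unfold_locales auto

end

section \<open>Producing the block sequence by repeated multiplication\<close>

lemma filter_eq_replicate: "(\<And>s. s \<in> set w \<Longrightarrow> P s \<Longrightarrow> s = e) \<Longrightarrow> filter P w = replicate (length (filter P w)) e"
  by (induction w) auto

fun first_string :: "bool \<Rightarrow> bool list \<Rightarrow> asym list" where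
  "first_string f [] = [Mac (KI f False), Mac KE]"
| "first_string f (b # x) = [Mac (KI f True), Mac (KI False b), AU] @ first_string False x"

text \<open>A word with its first m counters marked and r symbols \<open>PQ\<close> inserted behind every \<open>PU\<close>.\<close>

fun marked :: "nat \<Rightarrow> nat \<Rightarrow> asym list \<Rightarrow> asym list" where
  "marked m r [] = []"
| "marked m r (s # w) = (if s = PU then PU # replicate r PQ @ marked m r w
     else if s = AU then (if 0 < m then AF else AU) # marked (m - 1) r w
     else s # marked m r w)"

definition plain :: "asym set" where "plain = {AU, PU} \<union> range Mac"

definition count :: "asym \<Rightarrow> asym list \<Rightarrow> nat" where "count s w = length (filter (\<lambda>t. t = s) w)"

lemma count_simps [simp]: "count s [] = 0" "count s (t # w) = (if t = s then Suc (count s w) else count s w)"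
  "count s (u @ v) = count s u + count s v" by (simp_all add: count_def)

lemma marked_0: "marked 0 0 w = w" by (induction w) auto

lemma length_marked: "length (marked m r w) \<le> length w * Suc r"
proof (induction w arbitrary: m)
  case (Cons s w)
  show ?case using Cons[of m] Cons[of "m - 1"] by auto
qed simp

context learner_reduction begin

abbreviation "rch \<equiv> reach nx"

lemma reach_pass:
  assumes "scan nx q w = (q1, v)" "nx q1 Hash = (q', u)" "length w < B"
  shows "rch B (q, w @ [Hash]) (q', v @ u)"
  using assms by (intro reach_scan) (auto simp: scan_append)

lemma reach_start: "rch (length x + 1) (Start True, map Bt x @ [Hash]) (Mul 0 False, (first_string True x @ emit 0) @ [Hash])"
proof -
  have "scan nx (Start f) (map Bt x @ [Hash]) = (Mul 0 False, (first_string f x @ emit 0) @ [Hash])" for f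
    by (induction x arbitrary: f) (auto simp: nx_start_def)
  then show ?thesis by (intro reach_scan) auto
qed

lemma scan_replicate: "nx q s = (q, [s]) \<Longrightarrow> scan nx q (replicate r s) = (q, replicate r s)"
  by (induction r) auto

lemma scan_mul_True:
  "set w \<subseteq> plain \<Longrightarrow> scan nx (Mul i True) (marked 0 r w) = (Mul i True, marked 0 (Suc r) w)"
proof (induction w)
  case (Cons s w)
  have "nx (Mul i True) PQ = (Mul i True, [PQ])" by (simp add: nx_mul_def)
  then show ?case using Cons by (auto simp: plain_def nx_mul_def scan_append scan_replicate)
qed simp

lemma scan_mul_False:
  "set w \<subseteq> plain \<Longrightarrow> scan nx (Mul i False) (marked m r w) =
     (Mul i (m < count AU w), marked (if m < count AU w then Suc m else m) (Suc r) w)"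
proof (induction w arbitrary: m)
  case (Cons s w)
  have pq: "nx (Mul i False) PQ = (Mul i False, [PQ])" by (simp add: nx_mul_def)
  show ?case
  proof (cases "s = AU")
    case True
    show ?thesis
    proof (cases m)
      case 0
      then show ?thesis using True Cons.prems scan_mul_True[of w i r] by (auto simp: nx_mul_def)
    next
      case (Suc m')
      then show ?thesis using True Cons.prems Cons.IH[of m'] by (auto simp: nx_mul_def)
    qed
  next
    case False
    then show ?thesis using Cons.prems Cons.IH[of m] pq
      by (auto simp: plain_def nx_mul_def scan_append scan_replicate)
  qed
qed simp

fun conv :: "nat \<Rightarrow> nat \<Rightarrow> asym \<Rightarrow> asym list" where
  "conv r i s = (if s = PU then concat (replicate r (emit i))
     else if s = AU then (if i < k3 then [AU] else []) else [s])"

definition converted :: "nat \<Rightarrow> nat \<Rightarrow> asym list \<Rightarrow> asym list" where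
  "converted r i w = concat (map (conv r i) w)"

lemma scan_conv:
  "set w \<subseteq> plain \<Longrightarrow> count AU w \<le> m \<Longrightarrow> scan nx (Conv i) (marked m r w) = (Conv i, converted r i w)"
proof (induction w arbitrary: m)
  case (Cons s w)
  have pq: "scan nx (Conv i) (replicate r PQ) = (Conv i, concat (replicate r (emit i)))" for r
    by (induction r) (auto simp: nx_conv_def)
  show ?case
    using Cons.prems Cons.IH[of m] Cons.IH[of "m - 1"] pq[of r]
    by (auto simp: plain_def nx_conv_def scan_append converted_def split: if_splits)
qed (simp add: converted_def)

text \<open>With n counters there are n marking sweeps, one that finds nothing to mark, and one
  conversion: n + 2 passes over words with at most n + 1 symbols \<open>PQ\<close> per
  \<open>PU\<close>.\<close>

lemma reach_level:
  assumes w: "set w \<subseteq> plain"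
  shows "rch ((count AU w + 2) * (length w * (count AU w + 2) + 1)) (Mul i False, w @ [Hash])
    (if Suc i < k3 then Mul (Suc i) False else Srt False None False, converted (Suc (count AU w)) (Suc i) w @ [Hash])"
proof -
  let ?n = "count AU w" and ?g = "\<lambda>j. (Mul i False, marked j j w @ [Hash])"
  let ?B = "length w * (?n + 2) + 1"
  have len: "length (marked m r w) < ?B" if "r \<le> Suc ?n" for m r
  proof -
    have "length (marked m r w) \<le> length w * Suc r" by (rule length_marked)
    also have "\<dots> \<le> length w * (?n + 2)" using that by (intro mult_le_mono2) simp
    finally show ?thesis by simp
  qed
  have 1: "rch (?n * ?B) (?g 0) (?g ?n)"
  proof (rule reach_loop)
    fix j assume j: "j < ?n"
    show "rch ?B (?g j) (?g (Suc j))"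
      using scan_mul_False[OF w, of i j j] j len[of j j]
      by (intro reach_pass) (auto simp: nx_mul_def)
  qed
  have 2: "rch ?B (?g ?n) (Conv (Suc i), marked ?n (Suc ?n) w @ [Hash])"
    using scan_mul_False[OF w, of i ?n ?n] len[of ?n ?n]
    by (intro reach_pass) (auto simp: nx_mul_def)
  have 3: "rch ?B (Conv (Suc i), marked ?n (Suc ?n) w @ [Hash])
    (if Suc i < k3 then Mul (Suc i) False else Srt False None False, converted (Suc ?n) (Suc i) w @ [Hash])"
    using scan_conv[OF w order_refl, of "Suc i" "Suc ?n"] len[of "Suc ?n" ?n]
    by (intro reach_pass) (auto simp: nx_conv_def)
  have "rch (?n * ?B + ?B + ?B) (?g 0)
    (if Suc i < k3 then Mul (Suc i) False else Srt False None False, converted (Suc ?n) (Suc i) w @ [Hash])"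
    by (rule reach_trans[OF reach_trans[OF 1 2] 3])
  moreover have "?n * ?B + ?B + ?B = (?n + 2) * ?B" by (simp add: algebra_simps)
  ultimately show ?thesis by (simp only: marked_0)
qed

fun level :: "bool list \<Rightarrow> nat \<Rightarrow> asym list" where
  "level x 0 = first_string True x @ emit 0"
| "level x (Suc i) = converted (Suc (length x)) (Suc i) (level x i)"

lemma first_string_plain: "set (first_string f x) \<subseteq> plain"
  by (induction f x rule: first_string.induct) (auto simp: plain_def)

lemma emit_plain: "set (emit i) \<subseteq> plain" by (auto simp: emit_def plain_def)

lemma converted_plain: "set w \<subseteq> plain \<Longrightarrow> set (converted r i w) \<subseteq> plain"
  using emit_plain[of i] by (auto simp: converted_def plain_def split: if_splits)

lemma level_plain: "set (level x i) \<subseteq> plain"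
  by (induction i) (auto simp: first_string_plain emit_plain converted_plain del: subsetI)

lemma count_first_string: "count AU (first_string f x) = length x" "count PU (first_string f x) = 0"
  by (induction f x rule: first_string.induct) auto

lemma count_emit: "count AU (emit i) = 0" "count PU (emit i) = (if i = k3 then 0 else 1)"
  by (auto simp: emit_def count_def)

lemma length_filter_converted:
  assumes "\<not> P AU" "\<not> P PU"
  shows "length (filter P (converted r i w)) = length (filter P w) + count PU w * (r * length (filter P (emit i)))"
proof (induction w)
  case (Cons s w)
  have "length (filter P (concat (replicate r u))) = r * length (filter P u)" for u :: "asym list"
    by (induction r) auto
  then show ?case using Cons assms by (auto simp: converted_def)
qed (simp add: converted_def)

lemma filter_converted:
  assumes "\<not> P AU" "\<not> P PU" "filter P (emit i) = []"
  shows "filter P (converted r i w) = filter P w"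
proof (induction w)
  case (Cons s w)
  have "filter P (concat (replicate r (emit i))) = []" using assms(3) by (induction r) auto
  then show ?case using Cons assms by (auto simp: converted_def)
qed (simp add: converted_def)

lemma count_converted:
  "count AU (converted r i w) = (if i < k3 then count AU w else 0)"
  "count PU (converted r i w) = (if i = k3 then 0 else count PU w * r)"
proof -
  have "count AU (concat (replicate r u)) = r * count AU u" "count PU (concat (replicate r u)) = r * count PU u"
    for u :: "asym list" by (induction r) auto
  then show "count AU (converted r i w) = (if i < k3 then count AU w else 0)"
    "count PU (converted r i w) = (if i = k3 then 0 else count PU w * r)"
    by (induction w) (auto simp: converted_def count_emit)
qed

lemma count_level:
  "i < k3 \<Longrightarrow> count AU (level x i) = length x"
  "i \<le> k3 \<Longrightarrow> count PU (level x i) = (if i = k3 then 0 else Suc (length x) ^ i)"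
  "count AU (level x k3) = 0"
proof -
  show 1: "i < k3 \<Longrightarrow> count AU (level x i) = length x" for i
    by (induction i) (auto simp: count_first_string count_emit count_converted)
  show "i \<le> k3 \<Longrightarrow> count PU (level x i) = (if i = k3 then 0 else Suc (length x) ^ i)" for i
    using k(3) by (induction i) (auto simp: count_first_string count_emit count_converted)
  obtain j where "k3 = Suc j" using k(3) by (cases k3) auto
  then have "level x k3 = converted (Suc (length x)) k3 (level x j)" by (metis level.simps(2))
  then show "count AU (level x k3) = 0" by (simp add: count_converted)
qed

text \<open>The symbols in question are emitted only on reaching level \<open>l\<close>, at
  \<open>Suc (length x) ^ l\<close> places, and all later levels keep them.\<close>

lemma length_filter_level:
  assumes "\<not> P AU" "\<not> P PU" "\<And>i. length (filter P (emit i)) = (if i = l then c else 0)"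
    "filter P (first_string True x) = []" "l \<le> k3"
  shows "length (filter P (level x k3)) = c * Suc (length x) ^ l"
proof -
  have "i \<le> k3 \<Longrightarrow> length (filter P (level x i)) = (if l \<le> i then c * Suc (length x) ^ l else 0)" for i
  proof (induction i)
    case 0
    then show ?case using assms(3)[of 0] assms(4) by auto
  next
    case (Suc i)
    then show ?case
      using assms(3)[of "Suc i"] count_level(2)[of i x]
      by (auto simp: length_filter_converted[OF assms(1,2)] le_Suc_eq algebra_simps)
  qed
  then show ?thesis using assms(5) by simp
qed

definition kinds :: "bool list \<Rightarrow> kind list" where
  "kinds x = (let n = Suc (length x) in
     replicate (c2 * n ^ k2) (KB False) @ kbits True x @ replicate (c1 * n ^ k1) KCh @
     replicate (c2 * n ^ k2) (KB True) @ replicate (c3 * n ^ k3) KR)"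

lemma level_keys: "s \<in> set (level x k3) \<Longrightarrow> s \<in> range Mac"
proof -
  have "AU \<notin> set (level x k3)" "PU \<notin> set (level x k3)"
    using count_level(2)[of k3 x] count_level(3)[of x] by (auto simp: count_def filter_empty_conv)
  then show "s \<in> set (level x k3) \<Longrightarrow> s \<in> range Mac" using level_plain[of x k3] by (auto simp: plain_def)
qed

lemma key_Mac: "key (Mac kd) = 0 \<longleftrightarrow> kd = KB False" "key (Mac kd) = 2 \<longleftrightarrow> kd = KCh"
  "key (Mac kd) = 3 \<longleftrightarrow> kd = KB True" "key (Mac kd) = 4 \<longleftrightarrow> kd = KR" "key (Mac kd) < 5"
  by (cases kd; auto split: if_splits)+

text \<open>Every key except 1 belongs to a single kind, so only the number of copies matters. The
  blocks of key 1 all come from the input sweep, and stability keeps their order.\<close>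

lemma sort_level: "sort_keys (level x k3) = map Mac (kinds x)"
proof -
  let ?w = "level x k3" and ?n = "Suc (length x)"
  have fs: "filter (\<lambda>s. key s = j) (first_string f x) = []" if "j \<noteq> 1" "j \<noteq> 5" for j f
    using that by (induction f x rule: first_string.induct) auto
  have rep: "filter (\<lambda>s. key s = j) ?w = replicate (c * ?n ^ l) (Mac kd)"
    if "\<And>i. length (filter (\<lambda>s. key s = j) (emit i)) = (if i = l then c else 0)" "l \<le> k3" "j \<noteq> 1" "j \<noteq> 5"
      "\<And>kd'. key (Mac kd') = j \<Longrightarrow> kd' = kd" for j l c kd
  proof -
    have "length (filter (\<lambda>s. key s = j) ?w) = c * ?n ^ l"
      using that fs[of j] by (intro length_filter_level) auto
    moreover have "filter (\<lambda>s. key s = j) ?w = replicate (length (filter (\<lambda>s. key s = j) ?w)) (Mac kd)"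
      using level_keys that(5) by (intro filter_eq_replicate) auto
    ultimately show ?thesis by simp
  qed
  have 0: "filter (\<lambda>s. key s = 0) ?w = replicate (c2 * ?n ^ k2) (Mac (KB False))"
    using k by (intro rep) (auto simp: emit_def key_Mac)
  have 2: "filter (\<lambda>s. key s = 2) ?w = replicate (c1 * ?n ^ k1) (Mac KCh)"
    using k by (intro rep) (auto simp: emit_def key_Mac)
  have 3: "filter (\<lambda>s. key s = 3) ?w = replicate (c2 * ?n ^ k2) (Mac (KB True))"
    using k by (intro rep) (auto simp: emit_def key_Mac)
  have 4: "filter (\<lambda>s. key s = 4) ?w = replicate (c3 * ?n ^ k3) (Mac KR)"
    by (intro rep) (auto simp: emit_def key_Mac)
  have e1: "filter (\<lambda>s. key s = Suc 0) (emit i) = []" for i by (auto simp: emit_def)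
  have f1: "filter (\<lambda>s. key s = Suc 0) (first_string f x) = map Mac (kbits f x)" for f
    by (induction f x rule: first_string.induct) auto
  have "filter (\<lambda>s. key s = Suc 0) (level x i) = map Mac (kbits True x)" for i
    by (induction i) (auto simp: f1 e1 filter_converted)
  note 1 = this[of k3]
  have "[0..<5] = [0, Suc 0, 2, 3, 4]" by (simp add: upt_rec)
  then show ?thesis
    by (simp only: sort_keys_def list.map concat.simps 0 1 2 3 4 kinds_def Let_def map_append map_replicate append_Nil2)
qed

definition emit_len :: nat where "emit_len = c1 + 2 * c2 + c3 + 1"

lemma length_emit: "length (emit i) \<le> emit_len" by (auto simp: emit_def emit_len_def)

text \<open>The base of the power bounds the text that replaces one symbol when a level is
  passed.\<close>

definition level_len :: "nat \<Rightarrow> nat" where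
  "level_len n = (3 * n + 2 + emit_len) * (Suc n * emit_len + 1) ^ k3"

lemma length_level: "i \<le> k3 \<Longrightarrow> length (level x i) \<le> level_len (length x)"
proof -
  let ?b = "Suc (length x) * emit_len + 1"
  have fs: "length (first_string f x) \<le> 3 * length x + 2" for f
    by (induction f x rule: first_string.induct) auto
  have "length (level x i) \<le> (3 * length x + 2 + emit_len) * ?b ^ i" for i
  proof (induction i)
    case 0
    then show ?case using fs[of True] length_emit[of 0] by simp
  next
    case (Suc i)
    have conv: "length (conv (Suc (length x)) (Suc i) s) \<le> ?b" for s
    proof -
      have "length (concat (replicate r (emit (Suc i)))) \<le> r * emit_len" for r
        using length_emit[of "Suc i"] by (induction r) auto
      from this[of "Suc (length x)"] show ?thesis by auto
    qed
    have "length (converted (Suc (length x)) (Suc i) w) \<le> length w * ?b" for w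
    proof (induction w)
      case (Cons s w)
      then show ?case using conv[of s] by (simp add: converted_def del: conv.simps)
    qed (simp add: converted_def)
    then have "length (level x (Suc i)) \<le> length (level x i) * ?b" by simp
    also have "\<dots> \<le> ((3 * length x + 2 + emit_len) * ?b ^ i) * ?b" by (intro mult_le_mono1 Suc)
    finally show ?case by (simp only: power_Suc mult_ac)
  qed
  note 1 = this
  assume "i \<le> k3"
  then have "?b ^ i \<le> ?b ^ k3" by (intro power_increasing) auto
  then show ?thesis using 1[of i] unfolding level_len_def by (meson mult_le_mono2 order_trans)
qed

lemma reach_levels:
  "rch (k3 * ((length x + 2) * (level_len (length x) * (length x + 2) + 1)))
    (Mul 0 False, level x 0 @ [Hash]) (Srt False None False, level x k3 @ [Hash])"
proof -
  let ?g = "\<lambda>i. (if i < k3 then Mul i False else Srt False None False, level x i @ [Hash])"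
  have "rch (k3 * ((length x + 2) * (level_len (length x) * (length x + 2) + 1))) (?g 0) (?g k3)"
  proof (rule reach_loop)
    fix i assume i: "i < k3"
    have "rch ((length x + 2) * (length (level x i) * (length x + 2) + 1)) (?g i) (?g (Suc i))"
      using reach_level[OF level_plain, of x i i] i count_level(1)[OF i, of x] by simp
    moreover have "(length x + 2) * (length (level x i) * (length x + 2) + 1) \<le>
        (length x + 2) * (level_len (length x) * (length x + 2) + 1)"
      using length_level[of i x] i by (intro mult_le_mono2 add_le_mono1 mult_le_mono1) auto
    ultimately show "rch ((length x + 2) * (level_len (length x) * (length x + 2) + 1)) (?g i) (?g (Suc i))"
      by (rule reach_mono)
  qed
  then show ?thesis using k by simp
qed

lemma scan_sort:
  "Hash \<notin> set w \<Longrightarrow> scan nx (Srt g (Some a) sw) (w @ [Hash]) =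
    (if sw \<or> swaps a w then Srt g None False else if g then Fin True else Exp, bubble a w @ [Hash])"
  by (induction w arbitrary: a sw) (auto simp: nx_sort_def)

text \<open>At most one sweep per inversion, plus the last sweep that finds the word sorted.\<close>

lemma reach_sort:
  assumes "Hash \<notin> set w" "\<forall>s \<in> set w. key s < 5"
  shows "rch ((length w * length w + 1) * (length w + 1)) (Srt g None False, w @ [Hash])
    (if g then Fin True else Exp, sort_keys w @ [Hash])"
proof -
  have "rch ((inversions w + 1) * (length w + 1)) (Srt g None False, w @ [Hash])
    (if g then Fin True else Exp, sort_keys w @ [Hash])"
    using assms
  proof (induction "inversions w" arbitrary: w rule: less_induct)
    case less
    show ?case
    proof (cases w)
      case Nil
      then show ?thesis
        by (intro reach_scan) (auto simp: nx_sort_def sort_keys_def)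
    next
      case (Cons a v)
      have pass: "rch (length w + 1) (Srt g None False, w @ [Hash])
        (if swaps a v then Srt g None False else if g then Fin True else Exp, bubble a v @ [Hash])"
        using scan_sort[of v g a False] Cons less.prems
        by (intro reach_scan) (auto simp: nx_sort_def)
      have set_b: "set (bubble a v) = set w"
      proof -
        have "set (bubble a v) = insert a (set v)" by (induction a v rule: bubble.induct) auto
        then show ?thesis using Cons by simp
      qed
      show ?thesis
      proof (cases "swaps a v")
        case True
        have lt: "inversions (bubble a v) < inversions w"
          using inversions_bubble_less[OF True] Cons by simp
        have lb: "length (bubble a v) = length w"
          using length_filter_bubble[of "\<lambda>_. True" a v] Cons by simp
        have "rch ((inversions (bubble a v) + 1) * (length w + 1)) (Srt g None False, bubble a v @ [Hash])
          (if g then Fin True else Exp, sort_keys (bubble a v) @ [Hash])"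
          using less.hyps[OF lt] less.prems set_b lb by simp
        from reach_trans[OF pass[unfolded if_P[OF True]] this]
        have "rch (length w + 1 + (inversions (bubble a v) + 1) * (length w + 1)) (Srt g None False, w @ [Hash])
          (if g then Fin True else Exp, sort_keys w @ [Hash])"
          using sort_keys_bubble[of a v] Cons by (simp del: bubble.simps)
        moreover have "length w + 1 + (inversions (bubble a v) + 1) * (length w + 1) =
            (inversions (bubble a v) + 2) * (length w + 1)" by simp
        moreover have "(inversions (bubble a v) + 2) * (length w + 1) \<le> (inversions w + 1) * (length w + 1)"
          using lt by (intro mult_le_mono1) simp
        ultimately show ?thesis using reach_mono by metis
      next
        case False
        then have "bubble a v = w" "sort_keys w = w"
          using bubble_no_swap[OF False] sort_keys_sorted[of w] Cons less.prems(2) by auto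
        then show ?thesis using pass False by (auto intro: reach_mono)
      qed
    qed
  qed
  moreover have "(inversions w + 1) * (length w + 1) \<le> (length w * length w + 1) * (length w + 1)"
    using inversions_le[of w] by (intro mult_le_mono1) simp
  ultimately show ?thesis by (rule reach_mono)
qed

lemma reach_expand:
  "rch (length ks + 1) (Exp, map Mac ks @ [Hash]) (Inc None, (concat (map template ks) @ frame) @ [Hash])"
proof -
  have "scan nx Exp (map Mac ks) = (Exp, concat (map template ks))"
    by (induction ks) (auto simp: nx_expand_def)
  then show ?thesis using reach_pass[of Exp "map Mac ks" Exp "concat (map template ks)"]
    by (simp add: nx_expand_def)
qed

end

section \<open>Numbering the blocks and reading off the encoded instance\<close>

definition names_and_toks :: "asym set" where
  "names_and_toks = {s. case s of Tk c t \<Rightarrow> c < 5 | Nm c r \<Rightarrow> c < 5 | _ \<Rightarrow> False}"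

lemma concat_map_concat_map: "concat (map f (concat (map g xs))) = concat (map (\<lambda>x. concat (map f (g x))) xs)"
  by (induction xs) auto

lemma concat_map_Nil: "concat (map (\<lambda>x. []) xs) = []"
  by (induction xs) auto

lemma inst_names_and_toks:
  assumes "set w \<subseteq> names_and_toks"
  shows "set (inst a b w) \<subseteq> names_and_toks"
proof -
  have "set (ins a b s) \<subseteq> names_and_toks" if "s \<in> names_and_toks" for s
    using that by (cases s) (auto simp: names_and_toks_def)
  then show ?thesis using assms by (auto simp: inst_def)
qed

lemma inst_0: "inst 0 0 w = w"
proof -
  have "ins 0 0 s = [s]" for s by (cases s) auto
  then show ?thesis by (induction w) auto
qed

lemma length_inst: "b \<le> a \<Longrightarrow> length (inst a b w) \<le> length w * Suc a"
proof (induction w)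
  case (Cons s w)
  have "length (ins a b s) \<le> Suc a" using Cons.prems by (cases s) auto
  then show ?case using Cons by simp
qed simp

context learner_reduction begin

lemma en_sname_names: "c < 5 \<Longrightarrow> set (en_sname c nm) \<subseteq> names_and_toks"
  by (cases nm) (auto simp: names_and_toks_def set_replicate_conv_if)

lemma en_sprod_names:
  assumes "c < 5"
  shows "set (en_sprod c p) \<subseteq> names_and_toks"
proof -
  have "Tk c t \<in> names_and_toks" for t using assms by (simp add: names_and_toks_def)
  then show ?thesis using en_sname_names[OF assms] by (cases p) auto
qed

lemma body_names: "set (body kd) \<subseteq> names_and_toks"
proof -
  have "set (en_group 3 g) \<subseteq> names_and_toks" for g
    using en_sprod_names[of 3] by (auto simp: en_group_def names_and_toks_def)
  then show ?thesis using en_sname_names[of 1] by (auto simp: body_def)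
qed

text \<open>After m sweeps the first m blocks are finished, and every name in a later block has been
  incremented m times; names relative to the previous row only by the sweeps that finished a rule block,
  of which the first is block n.\<close>

fun staged :: "nat \<Rightarrow> nat \<Rightarrow> nat \<Rightarrow> kind list \<Rightarrow> asym list" where
  "staged n m j [] = []"
| "staged n m j (kd # ks) = inst (min j m) (min j m - n) (body kd) @ (if j < m then FF else FU (kd = KR))
     # staged n m (Suc j) ks"

lemma staged_0: "staged n 0 j ks = concat (map template ks)"
  by (induction ks arbitrary: j) (auto simp: inst_0 template_def)

lemma scan_inc_None:
  assumes "set w \<subseteq> names_and_toks"
  shows "scan nx (Inc None) w = (Inc None, w)"
  using assms by (induction w) (auto simp: names_and_toks_def nx_inc_def split: asym.splits)

lemma scan_inc_Some:
  assumes "set w \<subseteq> names_and_toks"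
  shows "scan nx (Inc (Some r)) (inst a b w) = (Inc (Some r), inst (Suc a) (if r then Suc b else b) w)"
  using assms
proof (induction w)
  case (Cons s w)
  have rep: "scan nx (Inc (Some r)) (replicate i (Tk c t)) = (Inc (Some r), replicate i (Tk c t))" for i c t
    by (rule scan_replicate) (simp add: nx_inc_def)
  from Cons show ?case
    by (cases s) (auto simp: names_and_toks_def nx_inc_def scan_append rep)
qed simp

lemma scan_frame: "scan nx (Inc m) frame = (Inc m, frame)"
proof -
  have "scan nx (Inc m) frame = (Inc m, concat (map (\<lambda>s. [s]) frame))"
    by (rule scan_hom) (auto simp: frame_def nx_inc_def)
  then show ?thesis by simp
qed

text \<open>The truncated difference fits: \<open>Suc m - n\<close> exceeds \<open>m - n\<close>
  exactly when \<open>n \<le> m\<close>, that is, when the block finished in sweep m is a rule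
  block.\<close>

lemma scan_staged_after:
  "m < j \<Longrightarrow> r = (n \<le> m) \<Longrightarrow> scan nx (Inc (Some r)) (staged n m j ks) = (Inc (Some r), staged n (Suc m) j ks)"
proof (induction ks arbitrary: j)
  case (Cons kd ks)
  have "(if r then Suc (m - n) else m - n) = Suc m - n" using Cons.prems by auto
  moreover have "min j m = m" "min j (Suc m) = Suc m" using Cons.prems by auto
  ultimately show ?case using Cons scan_inc_Some[OF body_names, of r m "m - n" kd]
    by (auto simp: nx_inc_def scan_append)
qed simp

lemma scan_body: "scan nx (Inc None) (inst a b (body kd)) = (Inc None, inst a b (body kd))"
  by (intro scan_inc_None inst_names_and_toks body_names)

lemma scan_staged_done: "j + length ks \<le> m \<Longrightarrow> scan nx (Inc None) (staged n m j ks) = (Inc None, staged n m j ks)"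
  by (induction ks arbitrary: j) (auto simp: scan_append scan_body nx_inc_def)

lemma scan_staged:
  assumes "\<And>i. i < length ks \<Longrightarrow> (ks ! i = KR) = (n \<le> j + i)" "j \<le> m" "m < j + length ks"
  shows "scan nx (Inc None) (staged n m j ks) = (Inc (Some (n \<le> m)), staged n (Suc m) j ks)"
  using assms
proof (induction ks arbitrary: j)
  case (Cons kd ks)
  have kd: "(kd = KR) = (n \<le> j)" using Cons.prems(1)[of 0] by simp
  show ?case
  proof (cases "m = j")
    case True
    then show ?thesis using kd scan_staged_after[of m "Suc j" "n \<le> m" n ks]
      by (simp add: scan_append scan_body nx_inc_def)
  next
    case False
    have "scan nx (Inc None) (staged n m (Suc j) ks) = (Inc (Some (n \<le> m)), staged n (Suc m) (Suc j) ks)"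
    proof (rule Cons.IH)
      fix i assume "i < length ks"
      then show "(ks ! i = KR) = (n \<le> Suc j + i)" using Cons.prems(1)[of "Suc i"] by simp
    qed (use False Cons.prems in auto)
    moreover have "min j m = j" "min j (Suc m) = j" "j < m" using False Cons.prems(2) by auto
    ultimately show ?thesis by (simp add: scan_append scan_body nx_inc_def)
  qed
qed simp

definition template_len :: nat where "template_len = Max (range (\<lambda>kd. length (template kd)))"

lemma length_template: "length (template kd) \<le> template_len"
  unfolding template_len_def using finite_kinds by (intro Max_ge) auto

lemma length_staged: "length (staged n m j ks) \<le> length ks * (template_len * Suc m)"
proof (induction ks arbitrary: j)
  case (Cons kd ks)
  have "length (inst (min j m) (min j m - n) (body kd)) \<le> length (body kd) * Suc (min j m)"
    by (rule length_inst[OF diff_le_self])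
  also have "\<dots> \<le> length (body kd) * Suc m" by (intro mult_le_mono2) simp
  finally have "length (inst (min j m) (min j m - n) (body kd)) + 1 \<le> length (template kd) * Suc m"
    by (simp add: template_def)
  also have "\<dots> \<le> template_len * Suc m" by (intro mult_le_mono1 length_template)
  finally show ?case using Cons[of "Suc j"] by simp
qed simp

lemma toks_body:
  "toks c (inst a b (body kd)) =
    (if c = 1 then concat (map (\<lambda>nm. en_nat (name_val a b nm)) (group_names (groups M cl kd)))
     else if c = 3 then concat (map (\<lambda>g. en_list en_prod (map (prod_val a b) g)) (groups M cl kd)) else [])"
  by (auto simp: body_def inst_concat toks_concat o_def toks_en_sname toks_en_group)

lemma toks_staged:
  "j + length ks \<le> m \<Longrightarrow> toks c (staged n m j ks) =
    concat (map (\<lambda>i. toks c (inst i (i - n) (body (ks ! (i - j))))) [j..<j + length ks])"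
proof (induction ks arbitrary: j)
  case (Cons kd ks)
  have u: "[j..<j + length (kd # ks)] = j # [Suc j..<Suc j + length ks]" by (subst upt_conv_Cons) simp_all
  have "map (\<lambda>i. toks c (inst i (i - n) (body ((kd # ks) ! (i - j))))) [Suc j..<Suc j + length ks] =
      map (\<lambda>i. toks c (inst i (i - n) (body (ks ! (i - Suc j))))) [Suc j..<Suc j + length ks]"
    by (intro map_cong) (auto simp: nth_Cons')
  then have t: "concat (map (\<lambda>i. toks c (inst i (i - n) (body ((kd # ks) ! (i - j))))) [Suc j..<Suc j + length ks]) =
      toks c (staged n m (Suc j) ks)"
    using Cons.IH[of "Suc j"] Cons.prems by (simp only: list.size add_Suc_right add_Suc add_0_right)
  have "min j m = j" using Cons.prems by simp
  then show ?case unfolding u list.map concat.simps t by (simp add: toks_Cons)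
qed simp

lemma toks_frame:
  "toks 0 frame = LB # LB # LB # en_nat (num 0 0)" "toks 1 frame = []" "toks 2 frame = [RB, LB, RB, LB]"
  "toks 3 frame = []" "toks 4 frame = RB # en_nat (num 0 0) @ [RB, LB, LB, RB, RB, RB]"
  by (simp_all only: frame_def toks_append toks_map_Tk) simp_all

text \<open>Parts 0, 2, 4 come only from the frame, parts 1 and 3 only from the blocks, in block
  order because sorting is stable.\<close>

lemma all_toks_final:
  "all_toks (sort_keys (staged n (length ks) 0 ks @ frame)) = en_instance (grammar M cl n ks) [[]]"
proof -
  let ?s = "staged n (length ks) 0 ks"
  have u: "[0..<5] = [0, 1, 2, 3, 4]" by (simp add: upt_rec)
  have st: "toks c ?s = concat (map (\<lambda>i. toks c (inst i (i - n) (body (ks ! i)))) [0..<length ks])" for c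
    using toks_staged[of 0 ks "length ks" c n] by simp
  have s0: "toks 0 ?s = []" "toks 2 ?s = []" "toks 4 ?s = []"
    unfolding st toks_body by (simp_all add: concat_map_Nil)
  have s1: "toks 1 ?s = concat (map en_nat (concat (map (\<lambda>j. map (name_val j (j - n)) (group_names (groups M cl (ks ! j)))) [0..<length ks])))"
    unfolding st toks_body concat_map_concat_map by (simp add: o_def)
  have s3: "toks 3 ?s = concat (map (en_list en_prod) (concat (map (\<lambda>j. map (map (prod_val j (j - n))) (groups M cl (ks ! j))) [0..<length ks])))"
    unfolding st toks_body concat_map_concat_map by (simp add: o_def)
  have "all_toks (sort_keys (?s @ frame)) = toks 0 frame @ toks 1 ?s @ toks 2 frame @ toks 3 ?s @ toks 4 frame"
    unfolding all_toks_sort_keys u by (simp only: list.map concat.simps toks_append s0 toks_frame append_Nil append_Nil2)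
  then show ?thesis
    unfolding s1 s3 toks_frame by (simp add: en_instance_def grammar_def en_list_def)
qed

lemma start_cells_append: "u \<noteq> [] \<Longrightarrow> start_cells f (u @ v) = start_cells f u @ start_cells False v"
  by (cases u; cases v) (auto simp: start_cells_def)

lemma scan_fin:
  assumes "set w \<subseteq> insert FF names_and_toks"
  shows "scan nx (Fin f) w = (Fin (f \<and> all_toks w = []), start_cells f (to_bits (all_toks w)))"
  using assms
proof (induction w arbitrary: f)
  case Nil
  then show ?case by (simp add: all_toks_def to_bits_def start_cells_def)
next
  case (Cons s w)
  show ?case
  proof (cases "\<exists>c t. s = Tk c t")
    case True
    then obtain c t where s: "s = Tk c t" by blast
    have "tok_bits t \<noteq> []" by (cases t) auto
    moreover have "to_bits (all_toks (s # w)) = tok_bits t @ to_bits (all_toks w)"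
      by (simp add: all_toks_def to_bits_def s)
    ultimately show ?thesis
      using Cons.IH[of False] Cons.prems by (simp add: s nx_fin_def start_cells_append) (simp add: all_toks_def)
  next
    case False
    then have "nx (Fin f) s = (Fin f, [])" "all_toks (s # w) = all_toks w"
      using Cons.prems by (cases s; auto simp: nx_fin_def names_and_toks_def all_toks_def)+
    then show ?thesis using Cons by simp
  qed
qed

section \<open>Simulating the learner on the queue\<close>

definition tape :: "bool list \<Rightarrow> nat \<Rightarrow> asym list" where
  "tape z t = map (\<lambda>i. Lc (i = 0) (cell_at (tm_run M' z t) i)) [- int t..int (length z) + int t]"

lemma length_tape: "length (tape z t) = length z + 2 * t + 1"
  by (simp add: tape_def)

lemma start_cells_tape:
  assumes "z \<noteq> []"
  shows "start_cells True z @ [Lc False blank_cell] = tape z 0"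
proof (rule nth_equalityI)
  obtain b bs where z: "z = b # bs" using assms by (cases z) auto
  have "length (start_cells True z) = length z" by (simp add: z start_cells_def)
  then show l: "length (start_cells True z @ [Lc False blank_cell]) = length (tape z 0)"
    by (simp add: length_tape)
  fix i assume "i < length (start_cells True z @ [Lc False blank_cell])"
  then have i: "i \<le> length z" unfolding l by (simp add: length_tape)
  then have "tape z 0 ! i = Lc (i = 0) (if i < length z then bit_code (z ! i) else 0, if i = 0 then Some 0 else None)"
    by (simp add: tape_def nth_upto tm_run_def tm_init_def cell_at_def)
  then show "(start_cells True z @ [Lc False blank_cell]) ! i = tape z 0 ! i"
    using i by (cases i) (auto simp: z start_cells_def nth_append)
qed

text \<open>Stated for an arbitrary left end \<open>a\<close>, with the two cells before it in the
  state, so that the induction can peel off one cell at a time.\<close>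

lemma scan_learn:
  fixes C :: "int \<Rightarrow> cell"
  assumes "a \<le> b + 1"
  shows "scan nx (Lrn (C (a - 2)) (a - 1 = 0) (C (a - 1)) h r) (map (\<lambda>i. Lc (i = 0) (C i)) [a..b]) =
    (Lrn (C (b - 1)) (b = 0) (C b) (h \<or> (\<exists>i \<in> {a..b}. snd (C i) = Some 1 \<or> snd (C i) = Some 2))
       (r \<or> 0 \<in> {a..b} \<and> fst (C 0) = 2),
     map (\<lambda>i. Lc (i = 0) (local_step M' (C (i - 1)) (C i) (C (i + 1)))) [a - 1..b - 1])"
  using assms
proof (induction "nat (b + 1 - a)" arbitrary: a h r)
  case 0
  then have "a = b + 1" by simp
  then show ?case by simp
next
  case (Suc m)
  then have ab: "a \<le> b" by simp
  let ?h = "h \<or> snd (C a) = Some 1 \<or> snd (C a) = Some 2" and ?r = "r \<or> a = 0 \<and> fst (C a) = 2"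
  have IH: "scan nx (Lrn (C (a + 1 - 2)) (a + 1 - 1 = 0) (C (a + 1 - 1)) ?h ?r) (map (\<lambda>i. Lc (i = 0) (C i)) [a + 1..b]) =
    (Lrn (C (b - 1)) (b = 0) (C b) (?h \<or> (\<exists>i \<in> {a + 1..b}. snd (C i) = Some 1 \<or> snd (C i) = Some 2))
       (?r \<or> 0 \<in> {a + 1..b} \<and> fst (C 0) = 2),
     map (\<lambda>i. Lc (i = 0) (local_step M' (C (i - 1)) (C i) (C (i + 1)))) [a + 1 - 1..b - 1])"
    using Suc ab by (intro Suc.hyps(1)) auto
  have e: "[a..b] = a # [a + 1..b]" "[a - 1..b - 1] = (a - 1) # [a..b - 1]"
    using ab by (simp_all add: upto_rec1)
  have "{a..b} = insert a {a + 1..b}" using ab by auto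
  then have h: "(?h \<or> (\<exists>i \<in> {a + 1..b}. snd (C i) = Some 1 \<or> snd (C i) = Some 2)) \<longleftrightarrow>
      (h \<or> (\<exists>i \<in> {a..b}. snd (C i) = Some 1 \<or> snd (C i) = Some 2))"
    and r: "(?r \<or> 0 \<in> {a + 1..b} \<and> fst (C 0) = 2) \<longleftrightarrow> (r \<or> 0 \<in> {a..b} \<and> fst (C 0) = 2)" by auto
  have s: "nx (Lrn (C (a - 2)) (a - 1 = 0) (C (a - 1)) h r) (Lc (a = 0) (C a)) =
     (Lrn (C (a + 1 - 2)) (a + 1 - 1 = 0) (C (a + 1 - 1)) ?h ?r, [Lc (a - 1 = 0) (local_step M' (C (a - 1 - 1)) (C (a - 1)) (C (a - 1 + 1)))])"
    by (simp add: nx_learn_def)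
  show ?case
    unfolding e list.map scan.simps s fst_conv snd_conv IH h r by simp
qed

abbreviation "learn_start \<equiv> Lrn blank_cell False blank_cell False False"

lemma scan_tape:
  "scan nx learn_start (tape z t) =
    (Lrn (cell_at (tm_run M' z t) (int (length z) + int t - 1)) (int (length z) + int t = 0)
       (cell_at (tm_run M' z t) (int (length z) + int t)) (halted (tm_run M' z t)) (fst (snd (tm_run M' z t)) 0 = 2),
     map (\<lambda>i. Lc (i = 0) (cell_at (tm_run M' z (Suc t)) i)) [- int t - 1..int (length z) + int t - 1])"
proof -
  let ?C = "cell_at (tm_run M' z t)" and ?a = "- int t" and ?b = "int (length z) + int t"
  have bl: "?C (?a - 2) = blank_cell" "?C (?a - 1) = blank_cell"
    by (auto intro!: cell_at_run_outside[OF wf'])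
  \<comment> \<open>The cell under the head is never blank, so it lies in the window and a halting
    state cannot be missed.\<close>
  have "?C (snd (snd (tm_run M' z t))) \<noteq> blank_cell" by (simp add: cell_at_def)
  then have "snd (snd (tm_run M' z t)) \<in> {?a..?b}"
    using cell_at_run_outside[OF wf', of "snd (snd (tm_run M' z t))" t z] by fastforce
  then have h: "(\<exists>i \<in> {?a..?b}. snd (?C i) = Some 1 \<or> snd (?C i) = Some 2) \<longleftrightarrow> halted (tm_run M' z t)"
    by (auto simp: cell_at_def halted_def split: if_splits)
  have "0 \<in> {?a..?b}" "fst (?C 0) = fst (snd (tm_run M' z t)) 0" by (auto simp: cell_at_def)
  moreover have "?a - 1 \<noteq> 0" by simp
  ultimately show ?thesis
    using scan_learn[of ?a ?b ?C False False] bl h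
    by (simp only: tape_def cell_at_run_Suc[OF wf'] simp_thms)
qed

lemma reach_learn_step:
  assumes "\<not> halted (tm_run M' z t)"
  shows "rch (length z + 2 * t + 2) (learn_start, tape z t @ [Hash]) (learn_start, tape z (Suc t) @ [Hash])"
proof -
  let ?C = "cell_at (tm_run M' z t)" and ?a = "- int t" and ?b = "int (length z) + int t"
  let ?D = "\<lambda>i. Lc (i = 0) (cell_at (tm_run M' z (Suc t)) i)"
  have bl: "?C (?b + 1) = blank_cell" "?C (?b + 1 + 1) = blank_cell"
    by (auto intro!: cell_at_run_outside[OF wf'])
  have "[?a - 1..?b + 1] = [?a - 1..?b - 1] @ [?b, ?b + 1]"
    by (simp add: upto_rec2)
  moreover have "- int (Suc t) = ?a - 1" "int (length z) + int (Suc t) = ?b + 1" by simp_all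
  ultimately have "tape z (Suc t) = map ?D [?a - 1..?b - 1] @ [?D ?b, ?D (?b + 1)]"
    by (simp only: tape_def map_append list.map)
  moreover have "?D ?b = Lc (?b = 0) (local_step M' (?C (?b - 1)) (?C ?b) blank_cell)"
    "?D (?b + 1) = Lc False (local_step M' (?C ?b) blank_cell blank_cell)"
    using bl by (simp_all add: cell_at_run_Suc[OF wf'])
  ultimately have "map ?D [?a - 1..?b - 1] @
     [Lc (?b = 0) (local_step M' (?C (?b - 1)) (?C ?b) blank_cell), Lc False (local_step M' (?C ?b) blank_cell blank_cell), Hash]
     = tape z (Suc t) @ [Hash]" by simp
  moreover have "rch (length z + 2 * t + 2) (learn_start, tape z t @ [Hash]) (learn_start, map ?D [?a - 1..?b - 1] @
     [Lc (?b = 0) (local_step M' (?C (?b - 1)) (?C ?b) blank_cell), Lc False (local_step M' (?C ?b) blank_cell blank_cell), Hash])"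
    by (rule reach_pass[OF scan_tape]) (use assms in \<open>auto simp: nx_learn_def length_tape\<close>)
  ultimately show ?thesis by (simp only:)
qed

text \<open>The automaton stops at the first halting time, which may precede \<open>d\<close>; the
  configuration is the same at both times.\<close>

lemma reach_learn:
  assumes "halted (tm_run M' z d)"
  shows "\<exists>v. rch (Suc d * (length z + 2 * d + 2)) (learn_start, tape z 0 @ [Hash])
    (if fst (snd (tm_run M' z d)) 0 = 2 then Acc else Rej, v)"
proof -
  define s where "s = (LEAST t. halted (tm_run M' z t))"
  have s: "halted (tm_run M' z s)" "s \<le> d" "\<And>t. t < s \<Longrightarrow> \<not> halted (tm_run M' z t)"
    unfolding s_def by (rule LeastI[where P = "\<lambda>t. halted (tm_run M' z t)", OF assms],
      rule Least_le[where P = "\<lambda>t. halted (tm_run M' z t)", OF assms], rule not_less_Least)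
  let ?B = "length z + 2 * d + 2"
  have 1: "rch (s * ?B) (learn_start, tape z 0 @ [Hash]) (learn_start, tape z s @ [Hash])"
  proof (rule reach_loop[where g = "\<lambda>t. (learn_start, tape z t @ [Hash])"])
    fix t assume "t < s"
    then show "rch ?B (learn_start, tape z t @ [Hash]) (learn_start, tape z (Suc t) @ [Hash])"
      using s by (intro reach_mono[OF reach_learn_step]) auto
  qed
  have 2: "rch ?B (learn_start, tape z s @ [Hash])
     (if fst (snd (tm_run M' z s)) 0 = 2 then Acc else Rej,
      map (\<lambda>i. Lc (i = 0) (cell_at (tm_run M' z (Suc s)) i)) [- int s - 1..int (length z) + int s - 1] @ [Hash])"
    by (rule reach_pass[OF scan_tape]) (use s in \<open>auto simp: nx_learn_def length_tape\<close>)
  have "tm_run M' z d = tm_run M' z s" by (rule run_halted[OF s(1,2)])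
  moreover have "s * ?B + ?B \<le> Suc d * ?B"
    using mult_le_mono1[OF s(2), of ?B] unfolding mult_Suc by linarith
  from reach_mono[OF reach_trans[OF 1 2] this] have "\<exists>v. rch (Suc d * ?B) (learn_start, tape z 0 @ [Hash])
    (if fst (snd (tm_run M' z s)) 0 = 2 then Acc else Rej, v)" by (rule exI)
  ultimately show ?thesis by (simp only:)
qed

definition inc_len :: "nat \<Rightarrow> nat" where
  "inc_len n = level_len n * (template_len * Suc (level_len n)) + length frame"

definition code_time :: "nat \<Rightarrow> nat" where
  "code_time n = (n + 1) + k3 * ((n + 2) * (level_len n * (n + 2) + 1)) +
     (level_len n * level_len n + 1) * (level_len n + 1) + (level_len n + 1) +
     (level_len n + 1) * (inc_len n + 1) + (inc_len n * inc_len n + 1) * (inc_len n + 1) + (inc_len n + 1)"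

lemma length_kinds: "length (kinds x) \<le> level_len (length x)"
proof -
  have "\<forall>s \<in> set (level x k3). key s < 5" using level_keys key_Mac(5) by fastforce
  then show ?thesis using length_sort_keys[of "level x k3"] sort_level[of x] length_level[of k3 x] by simp
qed

lemma staged_keys:
  assumes "s \<in> set (staged n m j ks @ frame)"
  shows "key s < 5" "s \<noteq> Hash"
proof -
  have "set (staged n m j ks) \<subseteq> {FF} \<union> range FU \<union> names_and_toks"
    by (induction ks arbitrary: j) (auto dest: subsetD[OF inst_names_and_toks[OF body_names]])
  then have "s \<in> {FF} \<union> range FU \<union> names_and_toks"
    using assms by (auto simp: frame_def names_and_toks_def)
  then show "key s < 5" "s \<noteq> Hash" by (auto simp: names_and_toks_def split: asym.splits)
qed

lemma staged_final_symbols: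
  assumes "j + length ks \<le> m"
  shows "set (staged n m j ks @ frame) \<subseteq> insert FF names_and_toks"
proof -
  have "set (staged n m j ks) \<subseteq> insert FF names_and_toks"
    using assms by (induction ks arbitrary: j) (auto dest: subsetD[OF inst_names_and_toks[OF body_names]])
  then show ?thesis by (auto simp: frame_def names_and_toks_def)
qed

lemma all_toks_length: "length (all_toks w) \<le> length w"
proof (induction w)
  case (Cons s w)
  then show ?case by (cases s) (auto simp: all_toks_def)
qed (simp add: all_toks_def)

lemma length_to_bits: "length (to_bits ts) = 2 * length ts"
proof (induction ts)
  case (Cons t ts)
  then show ?case by (cases t) (auto simp: to_bits_def)
qed (simp add: to_bits_def)

text \<open>Chains all phases up to the learner's initial tape. The bound on \<open>z\<close> later
  turns the learner's time bound into one in terms of \<open>length x\<close>.\<close>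

lemma reach_code:
  assumes n: "\<And>i. i < length (kinds x) \<Longrightarrow> (kinds x ! i = KR) = (n \<le> i)"
  defines "z \<equiv> to_bits (en_instance (grammar M cl n (kinds x)) [[]])"
  shows "rch (code_time (length x)) (Start True, map Bt x @ [Hash]) (learn_start, tape z 0 @ [Hash])"
    and "length z \<le> 2 * inc_len (length x)"
proof -
  let ?ks = "kinds x" and ?l = "level_len (length x)" and ?i = "inc_len (length x)"
  let ?w = "staged n (length ?ks) 0 ?ks @ frame"
  have lk: "length ?ks \<le> ?l" by (rule length_kinds)
  have len: "length (staged n m 0 ?ks @ frame) \<le> ?i" if "m \<le> length ?ks" for m
  proof -
    have "length (staged n m 0 ?ks) \<le> length ?ks * (template_len * Suc m)" by (rule length_staged)
    also have "\<dots> \<le> ?l * (template_len * Suc ?l)" using that lk by (intro mult_le_mono) auto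
    finally show ?thesis by (simp add: inc_len_def)
  qed
  have keys: "\<forall>s \<in> set (staged n m 0 ?ks @ frame). key s < 5" and
    nohash: "Hash \<notin> set (staged n m 0 ?ks @ frame)" for m
    using staged_keys by blast+
  have sw: "set (sort_keys ?w) \<subseteq> set ?w" by (auto simp: sort_keys_def)
  have lsw: "length (sort_keys ?w) = length ?w" by (rule length_sort_keys[OF keys])
  have z: "to_bits (all_toks (sort_keys ?w)) = z" unfolding all_toks_final z_def ..
  have "length (all_toks (sort_keys ?w)) \<le> length ?w" using all_toks_length[of "sort_keys ?w"] lsw by simp
  also note len[OF order_refl]
  finally show "length z \<le> 2 * ?i" unfolding z[symmetric] length_to_bits by simp
  have zne: "all_toks (sort_keys ?w) \<noteq> []" "z \<noteq> []"
  proof -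
    show a: "all_toks (sort_keys ?w) \<noteq> []" unfolding all_toks_final by (simp add: en_instance_def)
    then have "0 < length z" unfolding z[symmetric] length_to_bits by simp
    then show "z \<noteq> []" by simp
  qed
  have 1: "rch (length x + 1) (Start True, map Bt x @ [Hash]) (Mul 0 False, level x 0 @ [Hash])"
    using reach_start by simp
  note 2 = reach_levels[of x]
  have 3: "rch ((?l * ?l + 1) * (?l + 1)) (Srt False None False, level x k3 @ [Hash]) (Exp, map Mac ?ks @ [Hash])"
  proof -
    have "\<forall>s \<in> set (level x k3). key s < 5 \<and> s \<noteq> Hash" using level_keys key_Mac(5) by fastforce
    then have "rch ((length (level x k3) * length (level x k3) + 1) * (length (level x k3) + 1))
      (Srt False None False, level x k3 @ [Hash]) (Exp, map Mac ?ks @ [Hash])"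
      using reach_sort[of "level x k3" False] sort_level[of x] by auto
    moreover have "(length (level x k3) * length (level x k3) + 1) * (length (level x k3) + 1) \<le> (?l * ?l + 1) * (?l + 1)"
      using length_level[of k3 x] by (intro mult_le_mono add_le_mono) auto
    ultimately show ?thesis by (rule reach_mono)
  qed
  have 4: "rch (?l + 1) (Exp, map Mac ?ks @ [Hash]) (Inc None, (staged n 0 0 ?ks @ frame) @ [Hash])"
    using reach_mono[OF reach_expand[of ?ks], of "?l + 1"] lk by (simp add: staged_0)
  have 5: "rch ((?l + 1) * (?i + 1)) (Inc None, (staged n 0 0 ?ks @ frame) @ [Hash]) (Srt True None False, ?w @ [Hash])"
  proof -
    have "rch (length ?ks * (?i + 1)) (Inc None, (staged n 0 0 ?ks @ frame) @ [Hash]) (Inc None, ?w @ [Hash])"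
    proof (rule reach_loop[where g = "\<lambda>m. (Inc None, (staged n m 0 ?ks @ frame) @ [Hash])"])
      fix m assume m: "m < length ?ks"
      have "scan nx (Inc None) (staged n m 0 ?ks @ frame) = (Inc (Some (n \<le> m)), staged n (Suc m) 0 ?ks @ frame)"
        using scan_staged[of ?ks n 0 m] n m by (simp add: scan_append scan_frame)
      then show "rch (?i + 1) (Inc None, (staged n m 0 ?ks @ frame) @ [Hash]) (Inc None, (staged n (Suc m) 0 ?ks @ frame) @ [Hash])"
        using len[of m] m by (intro reach_pass) (auto simp: nx_inc_def simp del: length_append)
    qed
    moreover have "rch (?i + 1) (Inc None, ?w @ [Hash]) (Srt True None False, ?w @ [Hash])"
    proof (rule reach_pass)
      show "scan nx (Inc None) ?w = (Inc None, ?w)"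
        using scan_staged_done[of 0 ?ks "length ?ks" n] by (simp add: scan_append scan_frame)
    qed (use len[OF order_refl] in \<open>auto simp: nx_inc_def simp del: length_append\<close>)
    ultimately have "rch (length ?ks * (?i + 1) + (?i + 1)) (Inc None, (staged n 0 0 ?ks @ frame) @ [Hash])
      (Srt True None False, ?w @ [Hash])" by (rule reach_trans)
    moreover have "length ?ks * (?i + 1) \<le> ?l * (?i + 1)" using lk by (rule mult_le_mono1)
    then have "length ?ks * (?i + 1) + (?i + 1) \<le> (?l + 1) * (?i + 1)" by simp
    ultimately show ?thesis by (rule reach_mono)
  qed
  have 6: "rch ((?i * ?i + 1) * (?i + 1)) (Srt True None False, ?w @ [Hash]) (Fin True, sort_keys ?w @ [Hash])"
  proof -
    have "rch ((length ?w * length ?w + 1) * (length ?w + 1)) (Srt True None False, ?w @ [Hash])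
      (Fin True, sort_keys ?w @ [Hash])"
      using reach_sort[OF nohash keys, of "length ?ks" True] by simp
    moreover have "(length ?w * length ?w + 1) * (length ?w + 1) \<le> (?i * ?i + 1) * (?i + 1)"
      using len[OF order_refl] by (intro mult_le_mono add_le_mono) auto
    ultimately show ?thesis by (rule reach_mono)
  qed
  have 7: "rch (?i + 1) (Fin True, sort_keys ?w @ [Hash]) (learn_start, tape z 0 @ [Hash])"
  proof -
    have "set (sort_keys ?w) \<subseteq> insert FF names_and_toks"
      by (rule subset_trans[OF sw staged_final_symbols]) simp
    then have "scan nx (Fin True) (sort_keys ?w) = (Fin False, start_cells True z)"
      using scan_fin[of "sort_keys ?w" True] zne z by simp
    then have "rch (?i + 1) (Fin True, sort_keys ?w @ [Hash]) (learn_start, start_cells True z @ [Lc False blank_cell, Hash])"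
      using lsw len[OF order_refl] by (intro reach_pass) (auto simp: nx_fin_def simp del: length_append)
    moreover have "start_cells True z @ [Lc False blank_cell, Hash] = tape z 0 @ [Hash]"
      using start_cells_tape[OF zne(2)] by simp
    ultimately show ?thesis by (simp only:)
  qed
  show "rch (code_time (length x)) (Start True, map Bt x @ [Hash]) (learn_start, tape z 0 @ [Hash])"
    unfolding code_time_def
    by (rule reach_trans[OF reach_trans[OF reach_trans[OF reach_trans[OF reach_trans[OF reach_trans[OF 1 2] 3] 4] 5] 6] 7])
qed

lemma poly_bounded_code_time: "poly_bounded code_time" "poly_bounded inc_len"
proof -
  have l: "poly_bounded level_len"
    unfolding level_len_def Suc_eq_plus1 by (intro poly_bounded_intros)
  show i: "poly_bounded inc_len"
    unfolding inc_len_def Suc_eq_plus1 by (intro poly_bounded_intros l)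
  show "poly_bounded code_time"
    unfolding code_time_def by (intro poly_bounded_intros l i)
qed

end

section \<open>The reduction\<close>

lemma ex_accepting_iff:
  assumes "halted (tm_run M z s)"
  shows "(\<exists>t. fst (tm_run M z t) = 1) \<longleftrightarrow> fst (tm_run M z s) = 1"
proof
  assume "\<exists>t. fst (tm_run M z t) = 1"
  then obtain t where t: "fst (tm_run M z t) = 1" by blast
  then have "halted (tm_run M z t)" by (simp add: halted_def)
  then have "tm_run M z (max s t) = tm_run M z t" by (rule run_halted) simp
  moreover have "tm_run M z (max s t) = tm_run M z s" using assms by (rule run_halted) simp
  ultimately show "fst (tm_run M z s) = 1" using t by simp
qed blast

lemma tm_output_first:
  assumes "tm_output c = a # as"
  shows "fst (snd c) 0 = a"
proof -
  let ?n = "LEAST k. fst (snd c) (int k) = 0"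
  have o: "tm_output c = map (\<lambda>i. fst (snd c) (int i)) [0..<?n]"
    by (simp add: tm_output_def split_beta)
  have "?n \<noteq> 0"
  proof
    assume "?n = 0"
    then show False using o assms by simp
  qed
  then have "hd (tm_output c) = fst (snd c) (int 0)" unfolding o by (simp add: hd_map)
  then show ?thesis using assms by simp
qed

text \<open>\<open>en_answer\<close> begins with True exactly for a setting, so tape cell 0 decides
  existence at the halting time.\<close>

lemma learner_first_cell:
  assumes learn: "\<exists>t \<le> B. halted (tm_run M z t) \<and>
        (if (\<exists>p. consistent_setting G W p)
         then (\<exists>p. consistent_setting G W p \<and>
                   tm_output (tm_run M z t) = map bit_code (en_answer (Some p)))
         else tm_output (tm_run M z t) = map bit_code (en_answer None))"
  shows "\<exists>t \<le> B. halted (tm_run M z t) \<and> (fst (snd (tm_run M z t)) 0 = 2 \<longleftrightarrow> (\<exists>p. consistent_setting G W p))"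
proof -
  obtain t where t: "t \<le> B" "halted (tm_run M z t)"
    "if (\<exists>p. consistent_setting G W p)
         then (\<exists>p. consistent_setting G W p \<and>
                   tm_output (tm_run M z t) = map bit_code (en_answer (Some p)))
         else tm_output (tm_run M z t) = map bit_code (en_answer None)"
    using learn by blast
  have "fst (snd (tm_run M z t)) 0 = 2 \<longleftrightarrow> (\<exists>p. consistent_setting G W p)"
  proof (cases "\<exists>p. consistent_setting G W p")
    case True
    then obtain p where "tm_output (tm_run M z t) = map bit_code (en_answer (Some p))" using t(3) by auto
    then have "tm_output (tm_run M z t) = 2 # map bit_code (map (\<lambda>j. j = 2) p)" by (simp add: bit_code_def)
    from tm_output_first[OF this] True show ?thesis by simp
  next
    case False
    then have "tm_output (tm_run M z t) = [1]" using t(3) by (simp add: bit_code_def)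
    from tm_output_first[OF this] False show ?thesis by simp
  qed
  then show ?thesis using t(1,2) by blast
qed

lemma power_bound: "a * Suc n ^ i \<le> a * Suc n ^ j" if "i \<le> j" for a n i j :: nat
  using that by (intro mult_le_mono2 power_increasing) auto

theorem in_P_if_learner:
  assumes learner: "poly_time_ppcfg_learner M'" and NP: "in_NP L"
  shows "in_P L"
proof -
  obtain V c k where V: "in_P V" and L: "\<And>x. x \<in> L \<longleftrightarrow>
      (\<exists>y. length y \<le> c * (length x + 1) ^ k \<and> pair_enc x y \<in> V)"
    using NP unfolding in_NP_def by blast
  obtain M vc vk where M: "wf_tm M" and acc: "\<And>z. \<exists>t \<le> vc * (length z + 1) ^ vk.
      halted (tm_run M z t) \<and> (fst (tm_run M z t) = 1 \<longleftrightarrow> z \<in> V)"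
    using V unfolding in_P_def by blast
  obtain lc lk where M': "wf_tm M'" and learn: "\<And>G W. valid_instance G W \<Longrightarrow>
     (let x = to_bits (en_instance G W) in
      \<exists>t \<le> lc * (length x + 1) ^ lk. halted (tm_run M' x t) \<and>
        (if (\<exists>p. consistent_setting G W p)
         then (\<exists>p. consistent_setting G W p \<and>
                   tm_output (tm_run M' x t) = map bit_code (en_answer (Some p)))
         else tm_output (tm_run M' x t) = map bit_code (en_answer None)))"
    using learner unfolding poly_time_ppcfg_learner_def by blast
  obtain cl where cl: "set cl = cells M" using finite_list[OF finite_cells] by blast
  \<comment> \<open>The verifier's input satisfies |pair_enc x y| + 1 \<le> (c + 3) (n + 1)^(k + 1),
    so its running time is at most \<open>e0 * Suc n ^ e1\<close>.\<close>
  define e0 e1 where "e0 = vc * (c + 3) ^ vk" and "e1 = Suc k * vk"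
  \<comment> \<open>With D = e0 (n + 1)^e1, the margin needs D + 3, hence \<open>c2\<close>. The row
    length is at most (2 c2 + c + 2) (n + 1)^(e1 + k + 1), and multiplying by D gives
    \<open>c3\<close> and \<open>k3\<close>.\<close>
  define c2 c3 k3 where "c2 = e0 + 3" and "c3 = e0 * (2 * c2 + c + 2)" and "k3 = e1 + (e1 + k + 1)"
  interpret lr: learner_reduction M cl M' k c e1 c2 k3 c3
    by unfold_locales (simp_all add: M' k3_def)
  define T' where "T' n = lc * (2 * lr.inc_len n + 1) ^ lk" for n
  define F where "F n = lr.code_time n + (T' n + 1) * (2 * lr.inc_len n + 2 * T' n + 2)" for n
  have F: "poly_bounded F"
    unfolding F_def T'_def by (intro poly_bounded_intros lr.poly_bounded_code_time)
  have run: "\<exists>j \<le> F (length x). fst ((qstep lr.nx ^^ j) (Start True, map Bt x @ [Hash])) = (if x \<in> L then Acc else Rej)" for x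
  proof -
    let ?n = "length x"
    let ?B = "c * Suc ?n ^ k" and ?K = "c2 * Suc ?n ^ e1" and ?R = "c3 * Suc ?n ^ k3" and ?D = "e0 * Suc ?n ^ e1"
    have halts: "\<exists>t \<le> ?D. halted (tm_run M (pair_enc x y) t) \<and> (fst (tm_run M (pair_enc x y) t) = 1 \<longleftrightarrow> pair_enc x y \<in> V)"
      if "length y \<le> ?B" for y
    proof -
      obtain t where t: "t \<le> vc * (length (pair_enc x y) + 1) ^ vk" "halted (tm_run M (pair_enc x y) t)"
        "fst (tm_run M (pair_enc x y) t) = 1 \<longleftrightarrow> pair_enc x y \<in> V" using acc by blast
      have "length (pair_enc x y) + 1 \<le> 3 * Suc ?n ^ 1 + c * Suc ?n ^ k" using that by simp
      also have "\<dots> \<le> 3 * Suc ?n ^ Suc k + c * Suc ?n ^ Suc k"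
        by (intro add_mono power_bound) auto
      also have "\<dots> = (c + 3) * Suc ?n ^ Suc k" by (simp only: distrib_right add.commute)
      finally have "vc * (length (pair_enc x y) + 1) ^ vk \<le> vc * ((c + 3) * Suc ?n ^ Suc k) ^ vk"
        by (intro mult_le_mono2 power_mono) auto
      also have "\<dots> = ?D" by (simp only: e0_def e1_def power_mult_distrib power_mult mult.assoc)
      finally show ?thesis using t by (meson order_trans)
    qed
    have pos: "0 < Suc ?n ^ e1" by simp
    interpret bv: bounded_verifier M cl ?K ?B ?R ?D x
    proof
      show "\<exists>t \<le> ?D. halted (tm_run M (pair_enc x y) t)" if "length y \<le> ?B" for y using halts[OF that] by blast
      show "?D + 3 \<le> ?K" using pos unfolding c2_def distrib_right by linarith
      let ?P = "Suc ?n ^ (e1 + k + 1)"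
      have 1: "?K \<le> c2 * ?P" "?B \<le> c * ?P" by (intro power_bound; simp)+
      have "2 * ?n + 1 \<le> 2 * Suc ?n ^ 1" by simp
      also have "\<dots> \<le> 2 * ?P" by (intro power_bound) simp
      finally have "2 * ?K + ?B + 2 * ?n + 1 \<le> (2 * c2 + c + 2) * ?P"
        using 1 unfolding distrib_right mult.assoc by linarith
      then have "?D * (2 * ?K + ?B + 2 * ?n + 1) \<le> ?D * ((2 * c2 + c + 2) * ?P)" by (rule mult_le_mono2)
      also have "\<dots> = ?R" by (simp only: c3_def k3_def power_add mult_ac)
      finally show "?D * (2 * ?K + ?B + 2 * ?n + 1) \<le> ?R" .
    qed (use M cl in auto)
    have ks: "lr.kinds x = bv.ks" by (simp only: lr.kinds_def bv.ks_def Let_def)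
    define G where "G = grammar M cl (Suc bv.N) bv.ks"
    define z where "z = to_bits (en_instance G [[]])"
    have KR: "(lr.kinds x ! i = KR) = (Suc bv.N \<le> i)" if "i < length (lr.kinds x)" for i
      using bv.KR_iff that unfolding ks .
    have code: "lr.rch (lr.code_time ?n) (Start True, map Bt x @ [Hash]) (lr.learn_start, lr.tape z 0 @ [Hash])"
      "length z \<le> 2 * lr.inc_len ?n"
      using lr.reach_code[OF KR] unfolding ks z_def G_def by auto
    have "valid_instance G [[]]" unfolding G_def by (rule grammar_valid)
    from learner_first_cell[OF learn[OF this, unfolded Let_def]]
    obtain t where t: "t \<le> lc * (length z + 1) ^ lk" "halted (tm_run M' z t)"
      "fst (snd (tm_run M' z t)) 0 = 2 \<longleftrightarrow> (\<exists>p. consistent_setting G [[]] p)"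
      unfolding z_def by blast
    have "(\<exists>p. consistent_setting G [[]] p) \<longleftrightarrow>
      (\<exists>y. length y \<le> ?B \<and> (\<exists>t. fst (tm_run M (pair_enc x y) t) = 1))"
      unfolding G_def by (rule bv.ex_consistent_grammar)
    also have "\<dots> \<longleftrightarrow> (\<exists>y. length y \<le> ?B \<and> pair_enc x y \<in> V)"
    proof -
      have "(\<exists>t. fst (tm_run M (pair_enc x y) t) = 1) \<longleftrightarrow> pair_enc x y \<in> V" if "length y \<le> ?B" for y
        using halts[OF that] ex_accepting_iff by blast
      then show ?thesis by blast
    qed
    also have "\<dots> \<longleftrightarrow> x \<in> L" using L[of x] by simp
    finally have iff: "(\<exists>p. consistent_setting G [[]] p) \<longleftrightarrow> x \<in> L" .
    have "length z + 1 \<le> 2 * lr.inc_len ?n + 1" using code(2) by simp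
    then have "lc * (length z + 1) ^ lk \<le> T' ?n"
      unfolding T'_def by (intro mult_le_mono2 power_mono) auto
    then have tT: "t \<le> T' ?n" using t(1) by simp
    obtain v where v: "lr.rch (Suc t * (length z + 2 * t + 2)) (lr.learn_start, lr.tape z 0 @ [Hash])
      (if x \<in> L then Acc else Rej, v)"
      using lr.reach_learn[OF t(2)] unfolding t(3) iff by blast
    have "Suc t * (length z + 2 * t + 2) \<le> (T' ?n + 1) * (2 * lr.inc_len ?n + 2 * T' ?n + 2)"
      using tT code(2) by (intro mult_le_mono) auto
    then have "lr.code_time ?n + Suc t * (length z + 2 * t + 2) \<le> F ?n"
      unfolding F_def by (rule add_left_mono)
    from reach_mono[OF reach_trans[OF code(1) v] this]
    obtain j where "j \<le> F ?n" "(qstep lr.nx ^^ j) (Start True, map Bt x @ [Hash]) = (if x \<in> L then Acc else Rej, v)"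
      unfolding reach_def by blast
    then show ?thesis by (intro exI[of _ j]) simp
  qed
  show ?thesis by (rule lr.in_P_if_queue_run[OF F run])
qed

theorem mainTheorem4:
  assumes "P_neq_NP"
  shows "\<not> (\<exists>M. poly_time_ppcfg_learner M)"
  using assms in_P_if_learner unfolding P_neq_NP_def by blast

end
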